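(* In the partial-identification setting described in the context, suppose the following conditions hold. (a) (Regularity) $\mathbb E[|Y(1)|^q]\le C_q$ for some $q>2$, and $Y(1)$ admits a uniformly bounded conditional density (given $X=x$ and $A=1$) with respect to Lebesgue measure. (b) (Boundedness) There is $\varepsilon>0$ such that $e_1(X)\in[\varepsilon,1-\varepsilon]$ a.s. and $\hat e_1(X)\in[\varepsilon,1-\varepsilon]$ for all but finitely many $n$. (c) (Strong consistency) $\|\hat g_1-g_1\|_1\to0$ a.s., $\hat\eta_1\to\eta_1$ almost surely, and $\|\hat\eta_1-\eta_1\|_\infty=O(1)$. (d) (Rate) $\|\hat\eta_1-\eta_1\|_2=o\left(\left[\frac{\log\log n}{n}\right]^{1/4}\right)$. Let $\hat\sigma_{1-}^2=\frac1n\sum_{k=1}^K\sum_{i\in I_k}\psi(W_i;\hat\mu_1^-,\hat\eta)^2$. Then for any $\rho>0$, $$\hat\mu_1^-\pm\hat\sigma_{1-}\sqrt{\frac{2n\rho^2+1}{n^2\rho^2}\log\frac{(n\rho^2+1)}{\alpha}}$$ constitutes a $(1-\alpha)$ asymptotic confidence sequence for $\mu_1^-$.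
   Context: All $O(\cdot)$ and $o(\cdot)$ are in the almost sure sense. Norms $\|\cdot\|_p$ of functions of $X$ are $L_p$ norms under the law of $X$. $\alpha\in(0,1)$, and $C_q<\infty$ is a constant. Asymptotic confidence sequence: intervals $\{[\tilde L_n,\tilde U_n]\}_{n\ge1}$ form a $(1-\alpha)$ asymptotic confidence sequence for a real parameter $\vartheta$ if there is a (possibly unknown) sequence $\{[L_n^\star,U_n^\star]\}_{n\ge1}$ with $\mathbb P(\forall n\ge1,\ \vartheta\in[L_n^\star,U_n^\star])\ge1-\alpha$ and $L_n^\star/\tilde L_n\to1$, $U_n^\star/\tilde U_n\to1$ almost surely. Setting. The data $W_i=(Y_i,A_i,X_i)$, $i\ge1$, are i.i.d. copies of $W=(Y,A,X)$, with binary treatment $A$, covariates $X$, potential outcomes $Y(0),Y(1)$ and $Y=AY(1)+(1-A)Y(0)$. There may be an unmeasured confounder $U\in\mathcal U$ with $(Y(0),Y(1))$ independent of $A$ given $(X,U)$, and the $\Gamma$-selection bias model holds: for a fixed $1\le\Gamma<\infty$, the ratio of the odds of treatment $\mathbb P(A=1\mid X,U=u)/\mathbb P(A=0\mid X,U=u)$ to the same odds at $u'$ lies in $[1/\Gamma,\Gamma]$ for all $u,u'\in\mathcal U$, almost surely. With $a_+=\max\{a,0\}$ and $a_-=-\min\{a,0\}$, let $g_1$ solve $$\min_{g(\cdot)}\ \mathbb E\left[(Y-g(X))_+^2+\Gamma(Y-g(X))_-^2\mid A=1\right],$$ let $e_1(X)=\mathbb P(A=1\mid X)$, let $\nu_1(X)=\mathbb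 P(Y\ge g_1(X)\mid A=1,X)+\Gamma\,\mathbb P(Y<g_1(X)\mid A=1,X)$, and let $\eta_1=(g_1,e_1,\nu_1)$ be the true nuisance. The target is $\mu_1^-=\mathbb E[AY+(1-A)g_1(X)]$, a sharp lower bound for $\mathbb E[Y(1)]$. For $\eta=(g,e,\nu)$ define $$\psi(W;\mu,\eta)=AY+(1-A)g(X)+A\,\frac{(Y-g(X))_+-\Gamma(Y-g(X))_-}{\nu(X)}\cdot\frac{1-e(X)}{e(X)}-\mu.$$ Estimator. $\{I_k\}_{k=1}^K$ is a $K$-fold random partition of $\{1,\dots,n\}$ with $|I_k|/n\to1/K$ a.s. A split-sample scheme is used: the nuisance parameters are estimated from one part of the sample ($\{W_i\}_{i\in I_1^c}$), giving $\hat\eta=\hat\eta_1=(\hat g_1,\hat e_1,\hat\nu_1)$, and $\hat\mu_1^-$ is the solution $\mu$ obtained by equating to $0$ the empirical average of $\psi(W;\mu,\hat\eta)$ over the remaining part of the sample ($\{W_i\}_{i\in I_1}$).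
   Formalization: Added assumption: almost surely, the estimate of ν₁ (itself at least 1) is bounded below by a positive, possibly random, constant for all but finitely many n; without it the claim can fail. Each observation keeps its randomly assigned fold as n grows. *)

theory Defs
  imports "HOL-Probability.Probability" "HOL-Library.Landau_Symbols"
begin

text \<open>
  Ratios tending to 1 are expressed by the library relation for asymptotic equivalence of
  sequences, in which a ratio 0/0 counts as 1.
\<close>

definition asymptotic_confidence_sequence ::
  "'w measure \<Rightarrow> real \<Rightarrow> real \<Rightarrow> (nat \<Rightarrow> 'w \<Rightarrow> real) \<Rightarrow> (nat \<Rightarrow> 'w \<Rightarrow> real) \<Rightarrow> bool" where
  "asymptotic_confidence_sequence M \<alpha> \<theta> Lt Ut \<longleftrightarrow>
     (\<exists>Ls Us :: nat \<Rightarrow> 'w \<Rightarrow> real.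
        (\<forall>n\<ge>1. Ls n \<in> borel_measurable M \<and> Us n \<in> borel_measurable M) \<and>
        measure M {\<omega> \<in> space M. \<forall>n\<ge>1. \<theta> \<in> {Ls n \<omega> .. Us n \<omega>}} \<ge> 1 - \<alpha> \<and>
        (AE \<omega> in M. (\<lambda>n. Ls n \<omega>) \<sim>[sequentially] (\<lambda>n. Lt n \<omega>)) \<and>
        (AE \<omega> in M. (\<lambda>n. Us n \<omega>) \<sim>[sequentially] (\<lambda>n. Ut n \<omega>)))"

text \<open>
  Norms are extended nonnegative, so that a bound on a norm includes its finiteness. For triples of
  functions, the pointwise norm is the Euclidean one on \<open>real \<times> real \<times> real\<close>.
\<close>

definition Lp_norm :: "'x measure \<Rightarrow> real \<Rightarrow> ('x \<Rightarrow> 'b::real_normed_vector) \<Rightarrow> ennreal" where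
  "Lp_norm Q p f =
     (let I = \<integral>\<^sup>+x. ennreal (norm (f x) powr p) \<partial>Q
      in if I = \<infinity> then \<infinity> else ennreal (enn2real I powr (1 / p)))"

definition Linf_norm :: "'x measure \<Rightarrow> ('x \<Rightarrow> 'b::real_normed_vector) \<Rightarrow> ennreal" where
  "Linf_norm Q f = esssup Q (\<lambda>x. ennreal (norm (f x)))"

definition sigma_gen :: "'p measure \<Rightarrow> 'b measure \<Rightarrow> ('p \<Rightarrow> 'b) \<Rightarrow> 'p measure" where
  "sigma_gen P N Z = vimage_algebra (space P) Z N"

definition cond_prob_given :: "'p measure \<Rightarrow> 'p measure \<Rightarrow> ('p \<Rightarrow> bool) \<Rightarrow> 'p \<Rightarrow> real" where
  "cond_prob_given P F E = real_cond_exp P F (indicator {\<omega> \<in> space P. E \<omega>})"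

definition cond_indep_var ::
  "'p measure \<Rightarrow> 'p measure \<Rightarrow> 'b measure \<Rightarrow> ('p \<Rightarrow> 'b) \<Rightarrow> 'c measure \<Rightarrow> ('p \<Rightarrow> 'c) \<Rightarrow> bool" where
  "cond_indep_var P F N1 V1 N2 V2 \<longleftrightarrow>
     V1 \<in> measurable P N1 \<and> V2 \<in> measurable P N2 \<and>
     (\<forall>B1\<in>sets N1. \<forall>B2\<in>sets N2. AE \<omega> in P.
        cond_prob_given P F (\<lambda>\<omega>. V1 \<omega> \<in> B1 \<and> V2 \<omega> \<in> B2) \<omega> =
        cond_prob_given P F (\<lambda>\<omega>. V1 \<omega> \<in> B1) \<omega> * cond_prob_given P F (\<lambda>\<omega>. V2 \<omega> \<in> B2) \<omega>)"

text \<open>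
  The range of the confounder is \<open>space MU\<close>, and \<open>p\<close> is a version of the propensity
  \<open>P(A = 1 | X = x, U = u)\<close>. Since division by 0 yields 0 while \<open>1/\<Gamma> > 0\<close>, the
  bound on the odds ratio can only hold where both propensities lie strictly between 0 and 1.
\<close>

definition odds :: "real \<Rightarrow> real" where
  "odds p = p / (1 - p)"

definition selection_bias_model ::
  "'p measure \<Rightarrow> 'x measure \<Rightarrow> 'u measure \<Rightarrow> ('p \<Rightarrow> bool) \<Rightarrow> ('p \<Rightarrow> 'x) \<Rightarrow> ('p \<Rightarrow> 'u) \<Rightarrow> real \<Rightarrow> bool" where
  "selection_bias_model P MX MU A X U \<Gamma> \<longleftrightarrow>
     (\<exists>p \<in> borel_measurable (MX \<Otimes>\<^sub>M MU).
        (\<forall>z\<in>space (MX \<Otimes>\<^sub>M MU). 0 \<le> p z \<and> p z \<le> 1) \<and>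
        (AE \<omega> in P. p (X \<omega>, U \<omega>) =
           cond_prob_given P (sigma_gen P (MX \<Otimes>\<^sub>M MU) (\<lambda>\<omega>. (X \<omega>, U \<omega>))) A \<omega>) \<and>
        (AE \<omega> in P. \<forall>u\<in>space MU. \<forall>u'\<in>space MU.
           odds (p (X \<omega>, u)) / odds (p (X \<omega>, u')) \<in> {1 / \<Gamma> .. \<Gamma>}))"

definition pos_part :: "real \<Rightarrow> real" where
  "pos_part a = max a 0"

definition neg_part :: "real \<Rightarrow> real" where
  "neg_part a = - min a 0"

definition given_treated :: "'p measure \<Rightarrow> ('p \<Rightarrow> bool) \<Rightarrow> 'p measure" where
  "given_treated P A = uniform_measure P {\<omega> \<in> space P. A \<omega>}"

definition g_risk ::
  "'p measure \<Rightarrow> ('p \<Rightarrow> real) \<Rightarrow> ('p \<Rightarrow> bool) \<Rightarrow> ('p \<Rightarrow> 'x) \<Rightarrow> real \<Rightarrow> ('x \<Rightarrow> real) \<Rightarrow> ennreal" where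
  "g_risk P Y A X \<Gamma> g =
     (\<integral>\<^sup>+\<omega>. ennreal ((pos_part (Y \<omega> - g (X \<omega>)))\<^sup>2 + \<Gamma> * (neg_part (Y \<omega> - g (X \<omega>)))\<^sup>2)
        \<partial>given_treated P A)"

definition is_g1 ::
  "'p measure \<Rightarrow> 'x measure \<Rightarrow> ('p \<Rightarrow> real) \<Rightarrow> ('p \<Rightarrow> bool) \<Rightarrow> ('p \<Rightarrow> 'x) \<Rightarrow> real \<Rightarrow> ('x \<Rightarrow> real) \<Rightarrow> bool" where
  "is_g1 P MX Y A X \<Gamma> g \<longleftrightarrow>
     g \<in> borel_measurable MX \<and>
     (\<forall>g'\<in>borel_measurable MX. g_risk P Y A X \<Gamma> g \<le> g_risk P Y A X \<Gamma> g')"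

definition is_e1 ::
  "'p measure \<Rightarrow> 'x measure \<Rightarrow> ('p \<Rightarrow> bool) \<Rightarrow> ('p \<Rightarrow> 'x) \<Rightarrow> ('x \<Rightarrow> real) \<Rightarrow> bool" where
  "is_e1 P MX A X e \<longleftrightarrow>
     e \<in> borel_measurable MX \<and>
     (AE \<omega> in P. e (X \<omega>) = cond_prob_given P (sigma_gen P MX X) A \<omega>)"

definition is_nu1 ::
  "'p measure \<Rightarrow> 'x measure \<Rightarrow> ('p \<Rightarrow> real) \<Rightarrow> ('p \<Rightarrow> bool) \<Rightarrow> ('p \<Rightarrow> 'x) \<Rightarrow> real \<Rightarrow>
   ('x \<Rightarrow> real) \<Rightarrow> ('x \<Rightarrow> real) \<Rightarrow> bool" where
  "is_nu1 P MX Y A X \<Gamma> g1 \<nu> \<longleftrightarrow>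
     \<nu> \<in> borel_measurable MX \<and>
     (AE \<omega> in given_treated P A. \<nu> (X \<omega>) =
        cond_prob_given (given_treated P A) (sigma_gen P MX X) (\<lambda>\<omega>. Y \<omega> \<ge> g1 (X \<omega>)) \<omega> +
        \<Gamma> * cond_prob_given (given_treated P A) (sigma_gen P MX X) (\<lambda>\<omega>. Y \<omega> < g1 (X \<omega>)) \<omega>)"

type_synonym 'x obs = "real \<times> bool \<times> 'x"
type_synonym 'x nuisance = "'x \<Rightarrow> real \<times> real \<times> real"

definition obs_space :: "'x measure \<Rightarrow> 'x obs measure" where
  "obs_space MX = borel \<Otimes>\<^sub>M (count_space UNIV \<Otimes>\<^sub>M MX)"

definition psi :: "real \<Rightarrow> 'x obs \<Rightarrow> real \<Rightarrow> 'x nuisance \<Rightarrow> real" where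
  "psi \<Gamma> w \<mu> \<eta> =
     (case w of (y, a, x) \<Rightarrow> case \<eta> x of (g, e, \<nu>) \<Rightarrow>
        of_bool a * y + (1 - of_bool a) * g
        + of_bool a * ((pos_part (y - g) - \<Gamma> * neg_part (y - g)) / \<nu>) * ((1 - e) / e)
        - \<mu>)"

text \<open>
  A random partition of the growing sample is encoded by fold labels: observation \<open>i\<close> is
  put into fold \<open>\<kappa> i\<close> when it arrives, and keeps that fold as \<open>n\<close> grows.
  The labels are independent of the data.
\<close>

definition fold_idx :: "(nat \<Rightarrow> 'w \<Rightarrow> nat) \<Rightarrow> nat \<Rightarrow> nat \<Rightarrow> 'w \<Rightarrow> nat set" where
  "fold_idx \<kappa> k n \<omega> = {i \<in> {1..n}. \<kappa> i \<omega> = k}"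

definition random_partition ::
  "'w measure \<Rightarrow> nat \<Rightarrow> 'x measure \<Rightarrow> (nat \<Rightarrow> 'w \<Rightarrow> 'x obs) \<Rightarrow> (nat \<Rightarrow> 'w \<Rightarrow> nat) \<Rightarrow> bool" where
  "random_partition M K MX W \<kappa> \<longleftrightarrow>
     (\<forall>i\<ge>1. \<forall>\<omega>\<in>space M. \<kappa> i \<omega> \<in> {1..K}) \<and>
     (\<forall>i\<ge>1. \<kappa> i \<in> measurable M (count_space UNIV)) \<and>
     prob_space.indep_set M
       (sets (sigma_gen M (\<Pi>\<^sub>M i\<in>{1..}. count_space UNIV) (\<lambda>\<omega>. \<lambda>i\<in>{1..}. \<kappa> i \<omega>)))
       (sets (sigma_gen M (\<Pi>\<^sub>M i\<in>{1..}. obs_space MX) (\<lambda>\<omega>. \<lambda>i\<in>{1..}. W i \<omega>))) \<and>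
     (\<forall>k\<in>{1..K}. AE \<omega> in M.
        (\<lambda>n. real (card (fold_idx \<kappa> k n \<omega>)) / real n) \<longlonglongrightarrow> 1 / real K)"

text \<open>
  A nuisance estimator maps the sample size \<open>n\<close>, the set \<open>J\<close> of training indices and
  the training observations to a triple of functions of \<open>x\<close>.
\<close>

type_synonym 'x learner = "nat \<Rightarrow> nat set \<Rightarrow> (nat \<Rightarrow> 'x obs) \<Rightarrow> 'x nuisance"

definition measurable_learner :: "'x measure \<Rightarrow> 'x learner \<Rightarrow> bool" where
  "measurable_learner MX T \<longleftrightarrow>
     (\<forall>n. \<forall>J\<subseteq>{1..n}. (\<lambda>(w, x). T n J w x) \<in> borel_measurable ((\<Pi>\<^sub>M i\<in>J. obs_space MX) \<Otimes>\<^sub>M MX))"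

definition eta_hat ::
  "'x learner \<Rightarrow> (nat \<Rightarrow> 'w \<Rightarrow> nat) \<Rightarrow> (nat \<Rightarrow> 'w \<Rightarrow> 'x obs) \<Rightarrow> nat \<Rightarrow> 'w \<Rightarrow> 'x nuisance" where
  "eta_hat T \<kappa> W n \<omega> =
     (let J = {1..n} - fold_idx \<kappa> 1 n \<omega> in T n J (\<lambda>i\<in>J. W i \<omega>))"

definition half_width :: "real \<Rightarrow> real \<Rightarrow> nat \<Rightarrow> real" where
  "half_width \<alpha> \<rho> n =
     sqrt ((2 * real n * \<rho>\<^sup>2 + 1) / ((real n)\<^sup>2 * \<rho>\<^sup>2) * ln ((real n * \<rho>\<^sup>2 + 1) / \<alpha>))"

end

theory Submission
  imports Defs "HOL-Real_Asymp.Real_Asymp"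
begin

text \<open>
  The intervals with endpoints \<open>min L \<mu>1\<close> and \<open>max U \<mu>1\<close> contain \<open>\<mu>1\<close> at all times, and they agree with the
  given ones as soon as the error of the estimator is at most the half-width. It therefore suffices that
  this holds eventually, almost surely. The half-width is at least the estimated standard deviation
  times \<open>sqrt (ln n / n)\<close>, while the error is \<open>o (sqrt (ln n / n))\<close>. The error has three parts: the centred sum of
  the true estimating function, the sum of the difference between estimated and true estimating
  functions, centred given the folds and the training sample, and a bias. The two sums are controlled
  by truncation at \<open>n powr \<beta>\<close> with \<open>1 / q < \<beta> < 1 / 2\<close>, exponential inequalities and the Borel-Cantelli lemma.
  The bias is quadratic in the error of the nuisance, because the estimating function is orthogonal
  to the nuisance (through the first-order condition for \<open>g1\<close>) and the outcome has a bounded conditional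
  density. The same density keeps the true estimating function from being constant, so that the
  estimated standard deviation stays away from zero.
\<close>

section \<open>Exponential bounds for independent sums\<close>

text \<open>The room for crude bounds is logarithmic: the half-width carries \<open>ln n\<close>,
  whereas the squared nuisance rate is only \<open>sqrt (ln (ln n) / n)\<close>. This permits union
  bounds over all \<open>n\<close>. The obstacle is that the estimated nuisance, hence the summed
  function, changes with every \<open>n\<close>, so the sums for different \<open>n\<close> are not
  partial sums of one sequence. What helps is that the second moment of the difference of estimating
  functions, given the training sample, becomes as small as desired; its exponential bound at level
  \<open>sqrt (n * ln n)\<close> is then of order \<open>n powr (- 2)\<close>, summable on its own.
  The true function has no such small variance and is treated along a sparse sequence. The estimated
  standard deviation is bounded below through absolute deviations and the Cauchy-Schwarz inequality,
  because squares of the estimating function have only \<open>q / 2\<close> moments and fall outside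
  the deviation bounds. The bounds on the estimate are random, so the almost sure statements are
  proved simultaneously for a countable family of deterministic bounds.\<close>

lemma exp_le_quadratic:
  fixes x :: real
  assumes "x \<le> 1"
  shows "exp x \<le> 1 + x + x\<^sup>2"
proof (cases "0 \<le> x")
  case True
  then show ?thesis using exp_bound assms by blast
next
  case False
  define y where "y = - x"
  have y: "y > 0" using False by (simp add: y_def)
  have "exp x = 1 / exp y" by (simp add: y_def exp_minus field_simps)
  also have "\<dots> \<le> 1 / (1 + y)" using y exp_ge_add_one_self[of y] by (intro divide_left_mono) (auto simp: add_pos_pos)
  also have "\<dots> \<le> 1 - y + y\<^sup>2"
  proof -
    \<comment> \<open>For negative arguments the bound rests on \<open>exp y \<ge> 1 + y\<close> and
      on this factorisation of \<open>1 + y ^ 3\<close>.\<close>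
    have "(1 - y + y\<^sup>2) * (1 + y) = 1 + y ^ 3" by (simp add: algebra_simps power2_eq_square power3_eq_cube)
    then have "1 \<le> (1 - y + y\<^sup>2) * (1 + y)" using y by simp
    then show ?thesis using y by (simp add: divide_simps)
  qed
  finally show ?thesis by (simp add: y_def)
qed

text \<open>Bernstein-type bound: in the quadratic majorant of \<open>exp\<close> the linear term
  vanishes by centring, and the variance is at most the second moment, so the mean is at most
  \<open>1 + l\<^sup>2 * v\<close>. The centred variable is bounded by \<open>2 * B\<close>, whence
  the condition on \<open>l\<close>.\<close>

lemma (in prob_space) centered_mgf_le:
  fixes X :: "'a \<Rightarrow> real" and B v l :: real
  assumes [measurable]: "X \<in> borel_measurable M"
    and B: "AE x in M. \<bar>X x\<bar> \<le> B" and v: "expectation (\<lambda>x. (X x)\<^sup>2) \<le> v"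
    and l: "2 * \<bar>l\<bar> * B \<le> 1"
  shows "(\<integral>\<^sup>+x. ennreal (exp (l * (X x - expectation X))) \<partial>M) \<le> ennreal (exp (l\<^sup>2 * v))"
proof -
  have int: "integrable M X" using B by (intro integrable_const_bound[where B=B]) auto
  have B2: "AE x in M. (X x)\<^sup>2 \<le> B\<^sup>2" using B by eventually_elim (metis abs_ge_zero power2_abs power_mono)
  have int2: "integrable M (\<lambda>x. (X x)\<^sup>2)" using B2 by (intro integrable_const_bound[where B="B\<^sup>2"]) auto
  define m where "m = expectation X"
  have m: "\<bar>m\<bar> \<le> B"
  proof -
    have "AE x in M. X x \<le> B" "AE x in M. - B \<le> X x" using B by (eventually_elim, simp)+
    then show ?thesis unfolding m_def using integral_le_const[OF int] integral_ge_const[OF int, of "-B"]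
      by (simp add: abs_le_iff) 
  qed
  define Z where "Z = (\<lambda>x. l * (X x - m))"
  have Zle: "AE x in M. Z x \<le> 1"
    using B
  proof eventually_elim
    case (elim x)
    have "\<bar>X x - m\<bar> \<le> 2 * B" using elim m by linarith
    then have "\<bar>l\<bar> * \<bar>X x - m\<bar> \<le> \<bar>l\<bar> * (2 * B)" by (intro mult_left_mono) auto
    then have "\<bar>Z x\<bar> \<le> 1" using l by (simp add: Z_def abs_mult)
    then show ?case by simp
  qed
  have intZ: "integrable M Z" unfolding Z_def using int by simp
  have Z2: "(Z x)\<^sup>2 = l\<^sup>2 * ((X x)\<^sup>2 - 2 * m * X x + m\<^sup>2)" for x
    by (simp add: Z_def power2_eq_square algebra_simps)
  have intZ2: "integrable M (\<lambda>x. (Z x)\<^sup>2)" unfolding Z2 using int int2 by simp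
  have EZ: "expectation Z = 0" unfolding Z_def using int by (simp add: m_def[symmetric] prob_space)
  have EZ2: "expectation (\<lambda>x. (Z x)\<^sup>2) = l\<^sup>2 * (expectation (\<lambda>x. (X x)\<^sup>2) - m\<^sup>2)"
    unfolding Z2 using int int2 by (simp add: m_def[symmetric] prob_space power2_eq_square)
  have "(\<integral>\<^sup>+x. ennreal (exp (Z x)) \<partial>M) \<le> (\<integral>\<^sup>+x. ennreal (1 + Z x + (Z x)\<^sup>2) \<partial>M)"
    by (intro nn_integral_mono_AE) (use Zle in eventually_elim, auto intro!: ennreal_leI exp_le_quadratic)
  also have "\<dots> = ennreal (expectation (\<lambda>x. 1 + Z x + (Z x)\<^sup>2))"
  proof (intro nn_integral_eq_integral AE_I2)
    show "integrable M (\<lambda>x. 1 + Z x + (Z x)\<^sup>2)" using intZ intZ2 by simp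
    fix x 
    \<comment> \<open>Completing the square shows that the majorant is nonnegative everywhere, so
      its nonnegative integral is its expectation.\<close>
    have "1 + Z x + (Z x)\<^sup>2 = (1 / 2 + Z x)\<^sup>2 + 3 / 4" by (simp add: power2_eq_square algebra_simps)
    then show "0 \<le> 1 + Z x + (Z x)\<^sup>2" by simp
  qed
  also have "\<dots> \<le> ennreal (exp (l\<^sup>2 * v))"
  proof (rule ennreal_leI)
    have "expectation (\<lambda>x. 1 + Z x + (Z x)\<^sup>2) = 1 + l\<^sup>2 * (expectation (\<lambda>x. (X x)\<^sup>2) - m\<^sup>2)"
      using intZ intZ2 by (simp add: EZ EZ2 prob_space)
    also have "\<dots> \<le> 1 + l\<^sup>2 * v"
      using v by (intro add_left_mono mult_left_mono) (auto intro: order_trans[rotated])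
    also have "\<dots> \<le> exp (l\<^sup>2 * v)" by simp
    finally show "expectation (\<lambda>x. 1 + Z x + (Z x)\<^sup>2) \<le> exp (l\<^sup>2 * v)" .
  qed
  finally show ?thesis by (simp add: Z_def m_def)
qed

text \<open>Markov's inequality for the exponential of the sum, which factorises under the product
  measure. The sum runs over a part \<open>I\<close> of the coordinates, the others contributing
  factors 1; this lets a short block of indices be bounded by its own cardinality.\<close>

lemma (in prob_space) PiM_chernoff_one_sided:
  fixes X :: "'a \<Rightarrow> real" and B v l t :: real
  assumes J: "finite J" "I \<subseteq> J" and X[measurable]: "X \<in> borel_measurable M"
    and B: "AE x in M. \<bar>X x\<bar> \<le> B" and v: "expectation (\<lambda>x. (X x)\<^sup>2) \<le> v"
    and l: "0 \<le> l" "2 * l * B \<le> 1"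
  shows "emeasure (\<Pi>\<^sub>M i\<in>J. M) {z \<in> space (\<Pi>\<^sub>M i\<in>J. M). t < (\<Sum>i\<in>I. X (z i) - expectation X)}
     \<le> ennreal (exp (- l * t + card I * (l\<^sup>2 * v)))"
proof -
  interpret product_sigma_finite "\<lambda>_. M" ..
  let ?P = "\<Pi>\<^sub>M i\<in>J. M" and ?S = "\<lambda>z. \<Sum>i\<in>I. X (z i) - expectation X"
  have I: "finite I" using J finite_subset by auto
  have [measurable]: "(\<lambda>z. z i) \<in> measurable ?P M" if "i \<in> I" for i
    using that J by (auto intro: measurable_component_singleton)
  have "emeasure ?P {z \<in> space ?P. t < ?S z}
      \<le> emeasure ?P {z \<in> space ?P. 1 \<le> ennreal (exp (- l * t)) * ennreal (exp (l * ?S z))}"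
    using l by (intro emeasure_mono) (auto simp: ennreal_mult[symmetric] exp_add[symmetric] mult_left_mono)
  also have "\<dots> = emeasure ?P ({z \<in> space ?P. 1 \<le> ennreal (exp (- l * t)) * ennreal (exp (l * ?S z))} \<inter> space ?P)"
    by (rule arg_cong[where f="emeasure ?P"]) auto
  also have "\<dots> \<le> ennreal (exp (- l * t)) * (\<integral>\<^sup>+z. ennreal (exp (l * ?S z)) * indicator (space ?P) z \<partial>?P)"
    by (rule order_trans[OF _ nn_integral_Markov_inequality]) (auto intro!: emeasure_mono)
  also have "(\<integral>\<^sup>+z. ennreal (exp (l * ?S z)) * indicator (space ?P) z \<partial>?P) =
      (\<integral>\<^sup>+z. (\<Prod>i\<in>J. if i \<in> I then ennreal (exp (l * (X (z i) - expectation X))) else 1) \<partial>?P)"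
    using I J by (intro nn_integral_cong)
      (simp add: sum_distrib_left exp_sum prod_ennreal prod.If_cases Int_absorb1)
  also have "\<dots> = (\<Prod>i\<in>J. \<integral>\<^sup>+x. (if i \<in> I then ennreal (exp (l * (X x - expectation X))) else 1) \<partial>M)"
    using J by (intro product_nn_integral_prod) auto
  also have "\<dots> = (\<Prod>i\<in>J. if i \<in> I then (\<integral>\<^sup>+x. ennreal (exp (l * (X x - expectation X))) \<partial>M) else 1)"
    by (intro prod.cong) (auto simp: emeasure_space_1)
  also have "\<dots> = (\<Prod>i\<in>I. \<integral>\<^sup>+x. ennreal (exp (l * (X x - expectation X))) \<partial>M)"
    using J by (simp add: prod.If_cases Int_absorb1)
  also have "\<dots> \<le> (\<Prod>i\<in>I. ennreal (exp (l\<^sup>2 * v)))"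
    using l by (intro prod_mono_ennreal centered_mgf_le[OF X B v]) auto
  also have "\<dots> = ennreal (exp (card I * (l\<^sup>2 * v)))"
    by (simp add: ennreal_power exp_of_nat_mult)
  finally show ?thesis
    by (simp add: ennreal_mult[symmetric] exp_add[symmetric] mult_left_mono)
qed

lemma (in prob_space) PiM_chernoff:
  fixes X :: "'a \<Rightarrow> real" and B v l t :: real
  assumes J: "finite J" "I \<subseteq> J" and X[measurable]: "X \<in> borel_measurable M"
    and B: "AE x in M. \<bar>X x\<bar> \<le> B" and v: "expectation (\<lambda>x. (X x)\<^sup>2) \<le> v"
    and l: "0 \<le> l" "2 * l * B \<le> 1"
  shows "emeasure (\<Pi>\<^sub>M i\<in>J. M) {z \<in> space (\<Pi>\<^sub>M i\<in>J. M). t < \<bar>\<Sum>i\<in>I. X (z i) - expectation X\<bar>}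
     \<le> ennreal (2 * exp (- l * t + card I * (l\<^sup>2 * v)))"
proof -
  let ?P = "\<Pi>\<^sub>M i\<in>J. M" and ?e = "exp (- l * t + card I * (l\<^sup>2 * v))"
  let ?A = "{z \<in> space ?P. t < (\<Sum>i\<in>I. X (z i) - expectation X)}"
  let ?B = "{z \<in> space ?P. t < (\<Sum>i\<in>I. - X (z i) - expectation (\<lambda>x. - X x))}"
  have [measurable]: "(\<lambda>z. z i) \<in> measurable ?P M" if "i \<in> I" for i
    using that J by (auto intro: measurable_component_singleton)
  have "{z \<in> space ?P. t < \<bar>\<Sum>i\<in>I. X (z i) - expectation X\<bar>} = ?A \<union> ?B"
    by (auto simp: abs_if sum_subtractf sum_negf)
  then have "emeasure ?P {z \<in> space ?P. t < \<bar>\<Sum>i\<in>I. X (z i) - expectation X\<bar>} \<le> emeasure ?P ?A + emeasure ?P ?B"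
    by (simp, intro emeasure_subadditive) auto
  also have "\<dots> \<le> ennreal ?e + ennreal ?e"
    using assms by (intro add_mono PiM_chernoff_one_sided) auto
  finally show ?thesis by (simp add: ennreal_plus[symmetric] del: ennreal_plus)
qed

section \<open>Conditioning on the folds and the training sample\<close>

text \<open>Fubini for the split of the coordinates into training block \<open>I - J\<close> and
  evaluation block \<open>J\<close>. A bound on every section plays the part of a bound on the
  conditional probability given the training block.\<close>

lemma (in product_prob_space) emeasure_PiM_split_le:
  assumes fin: "finite I" and J: "J \<subseteq> I"
    and A: "A \<in> sets ((\<Pi>\<^sub>M i\<in>I - J. M i) \<Otimes>\<^sub>M (\<Pi>\<^sub>M i\<in>J. M i))"
    and le: "\<And>w. w \<in> space (\<Pi>\<^sub>M i\<in>I - J. M i) \<Longrightarrow>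
      emeasure (\<Pi>\<^sub>M i\<in>J. M i) {z \<in> space (\<Pi>\<^sub>M i\<in>J. M i). (w, z) \<in> A} \<le> p"
  shows "emeasure (\<Pi>\<^sub>M i\<in>I. M i) {x \<in> space (\<Pi>\<^sub>M i\<in>I. M i). (restrict x (I - J), restrict x J) \<in> A} \<le> p"
proof -
  let ?T = "\<Pi>\<^sub>M i\<in>I - J. M i" and ?E = "\<Pi>\<^sub>M i\<in>J. M i" and ?P = "\<Pi>\<^sub>M i\<in>I. M i"
  interpret T: prob_space ?T by (intro prob_space_PiM prob_space)
  interpret E: prob_space ?E by (intro prob_space_PiM prob_space)
  have UN: "(I - J) \<union> J = I" and disj: "(I - J) \<inter> J = {}" using J by auto
  have mm: "merge (I - J) J \<in> measurable (?T \<Otimes>\<^sub>M ?E) ?P"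
    using measurable_merge[of "I - J" J M] unfolding UN .
  define S where "S = {x \<in> space ?P. (restrict x (I - J), restrict x J) \<in> A}"
  have rm: "(\<lambda>x. (restrict x (I - J), restrict x J)) \<in> measurable ?P (?T \<Otimes>\<^sub>M ?E)"
    using J by (intro measurable_Pair measurable_restrict_subset) auto
  have S: "S \<in> sets ?P"
    using measurable_sets[OF rm A] unfolding S_def by (simp add: vimage_def Int_def conj_commute)
  have "?P = distr (?T \<Otimes>\<^sub>M ?E) ?P (merge (I - J) J)"
    using distr_merge[OF disj finite_Diff[OF fin] finite_subset[OF J fin]] unfolding UN by (rule sym)
  then have "emeasure ?P S = emeasure (distr (?T \<Otimes>\<^sub>M ?E) ?P (merge (I - J) J)) S"
    by simp
  also have "\<dots> = emeasure (?T \<Otimes>\<^sub>M ?E) (merge (I - J) J -` S \<inter> space (?T \<Otimes>\<^sub>M ?E))"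
    using mm S by (rule emeasure_distr)
  also have "merge (I - J) J -` S \<inter> space (?T \<Otimes>\<^sub>M ?E) = A"
  proof -
    have *: "(restrict (merge (I - J) J (w, z)) (I - J), restrict (merge (I - J) J (w, z)) J) = (w, z)"
      if "w \<in> space ?T" "z \<in> space ?E" for w z
      using that by (auto simp: space_PiM fun_eq_iff merge_def restrict_def PiE_def extensional_def)
    have "merge (I - J) J (w, z) \<in> space ?P" if "w \<in> space ?T" "z \<in> space ?E" for w z
      using measurable_space[OF mm, of "(w,z)"] that by (simp add: space_pair_measure)
    then show ?thesis using * sets.sets_into_space[OF A]
      by (auto simp: S_def space_pair_measure)
  qed
  also have "emeasure (?T \<Otimes>\<^sub>M ?E) A = (\<integral>\<^sup>+w. emeasure ?E (Pair w -` A) \<partial>?T)"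
    using A by (rule E.emeasure_pair_measure_alt)
  also have "\<dots> \<le> (\<integral>\<^sup>+w. p \<partial>?T)"
  proof (intro nn_integral_mono)
    fix w assume w: "w \<in> space ?T"
    have "Pair w -` A = {z \<in> space ?E. (w, z) \<in> A}"
      using sets.sets_into_space[OF A] by (auto simp: space_pair_measure)
    then show "emeasure ?E (Pair w -` A) \<le> p" using le[OF w] by simp
  qed
  also have "\<dots> = p" by (simp add: T.emeasure_space_1)
  finally show ?thesis by (simp add: S_def)
qed

section \<open>Fold labels, training block and evaluation block of an i.i.d. sample\<close>

locale split_sample = prob_space M for M :: "'w measure" +
  fixes MX :: "'x measure" and L :: "'x obs measure"
    and W :: "nat \<Rightarrow> 'w \<Rightarrow> 'x obs" and \<kappa> :: "nat \<Rightarrow> 'w \<Rightarrow> nat" and K :: nat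
  assumes W_indep: "indep_vars (\<lambda>_. obs_space MX) W {1..}"
    and W_distr: "\<And>i. i \<ge> 1 \<Longrightarrow> distr M (obs_space MX) (W i) = L"
    and partition: "random_partition M K MX W \<kappa>"
begin

abbreviation "F n s \<equiv> fold_idx \<kappa> 1 n s"

abbreviation "training n s \<equiv> restrict (\<lambda>i. W i s) ({1..n} - F n s)"

lemma W_measurable: "i \<ge> 1 \<Longrightarrow> W i \<in> measurable M (obs_space MX)"
  using W_indep by (auto simp: indep_vars_def)

lemma sets_L: "sets L = sets (obs_space MX)"
  using W_distr[of 1] by (metis order_refl sets_distr)

lemma prob_space_L: "prob_space L"
  using W_distr[of 1] W_measurable[of 1] by (metis order_refl prob_space_distr)

lemma F_subset: "F n s \<subseteq> {1..n}"
  by (auto simp: fold_idx_def)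

lemma sets_PiM_L: "sets (\<Pi>\<^sub>M i\<in>J. L) = sets (\<Pi>\<^sub>M i\<in>J. obs_space MX)"
  by (intro sets_PiM_cong) (auto simp: sets_L)

lemma space_PiM_L: "space (\<Pi>\<^sub>M i\<in>J. L) = space (\<Pi>\<^sub>M i\<in>J. obs_space MX)"
  using sets_PiM_L by (rule sets_eq_imp_space_eq)

lemma distr_W_restrict:
  assumes n: "n \<ge> 1"
  shows "distr M (\<Pi>\<^sub>M i\<in>{1..n}. obs_space MX) (\<lambda>s. \<lambda>i\<in>{1..n}. W i s) = (\<Pi>\<^sub>M i\<in>{1..n}. L)"
proof -
  have "indep_vars (\<lambda>_. obs_space MX) W {1..n}"
    using W_indep by (rule indep_vars_subset) auto
  then have "distr M (\<Pi>\<^sub>M i\<in>{1..n}. obs_space MX) (\<lambda>s. \<lambda>i\<in>{1..n}. W i s)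
      = (\<Pi>\<^sub>M i\<in>{1..n}. distr M (obs_space MX) (W i))"
    using n by (subst indep_vars_iff_distr_eq_PiM'[symmetric]) (auto intro: W_measurable)
  also have "\<dots> = (\<Pi>\<^sub>M i\<in>{1..n}. L)"
    by (intro PiM_cong) (auto simp: W_distr)
  finally show ?thesis .
qed

text \<open>Independence of labels and data is postulated for the two infinite sequences, so the
  event has to be exhibited in the sigma-algebra generated by all labels, as a cylinder over the
  first \<open>n\<close> of them.\<close>

lemma fold_event:
  "{s \<in> space M. F n s = J} \<in> sets (sigma_gen M (\<Pi>\<^sub>M i\<in>{1..}. count_space UNIV) (\<lambda>s. \<lambda>i\<in>{1..}. \<kappa> i s))"
proof (cases "J \<subseteq> {1..n}")
  case True
  define B where "B = {x \<in> space (\<Pi>\<^sub>M i\<in>{1..}. count_space (UNIV :: nat set)). \<forall>i\<in>{1..n}. x i = 1 \<longleftrightarrow> i \<in> J}"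
  have B: "B \<in> sets (\<Pi>\<^sub>M i\<in>{1..}. count_space UNIV)"
    unfolding B_def by measurable
  have "{s \<in> space M. F n s = J} = (\<lambda>s. \<lambda>i\<in>{1..}. \<kappa> i s) -` B \<inter> space M"
    using True by (auto simp: B_def fold_idx_def space_PiM set_eq_iff)
  then show ?thesis unfolding sigma_gen_def using B by (simp add: in_vimage_algebra)
next
  case False
  then have "{s \<in> space M. F n s = J} = {}" using F_subset by blast
  then show ?thesis by (simp only: sets.empty_sets)
qed

lemma W_event:
  assumes B: "B \<in> sets (\<Pi>\<^sub>M i\<in>{1..n}. obs_space MX)"
  shows "{s \<in> space M. (\<lambda>i\<in>{1..n}. W i s) \<in> B}
    \<in> sets (sigma_gen M (\<Pi>\<^sub>M i\<in>{1..}. obs_space MX) (\<lambda>s. \<lambda>i\<in>{1..}. W i s))"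
proof -
  define C where "C = (\<lambda>x. restrict x {1..n}) -` B \<inter> space (\<Pi>\<^sub>M i\<in>{1..}. obs_space MX)"
  have C: "C \<in> sets (\<Pi>\<^sub>M i\<in>{1..}. obs_space MX)"
    unfolding C_def by (intro measurable_sets[OF measurable_restrict_subset B]) auto
  have "{s \<in> space M. (\<lambda>i\<in>{1..n}. W i s) \<in> B} = (\<lambda>s. \<lambda>i\<in>{1..}. W i s) -` C \<inter> space M"
  proof -
    have "restrict (\<lambda>i\<in>{1..}. W i s) {1..n} = (\<lambda>i\<in>{1..n}. W i s)" for s
      by (auto simp: restrict_def fun_eq_iff)
    moreover have "(\<lambda>i\<in>{1..}. W i s) \<in> space (\<Pi>\<^sub>M i\<in>{1..}. obs_space MX)" if "s \<in> space M" for s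
      using measurable_space[OF W_measurable that] by (auto simp: space_PiM)
    ultimately show ?thesis by (auto simp: C_def)
  qed
  then show ?thesis unfolding sigma_gen_def using C by (simp add: in_vimage_algebra)
qed

lemma indep_folds_W:
  "indep_set
       (sets (sigma_gen M (\<Pi>\<^sub>M i\<in>{1..}. count_space UNIV) (\<lambda>s. \<lambda>i\<in>{1..}. \<kappa> i s)))
       (sets (sigma_gen M (\<Pi>\<^sub>M i\<in>{1..}. obs_space MX) (\<lambda>s. \<lambda>i\<in>{1..}. W i s)))"
  using partition by (auto simp: random_partition_def)

lemma fold_event': "{s \<in> space M. F n s = J} \<in> events"
  using fold_event indep_setD_ev1[OF indep_folds_W] by blast

text \<open>The fold has finitely many possible values \<open>J\<close>. On each of them the event
  depends on the data only, through \<open>B J\<close>, and the data are independent of the labels.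
  The probability is therefore an average, with the fold probabilities as weights, of terms that are
  at most \<open>p\<close> by Fubini.\<close>

lemma conditional_bound:
  fixes A :: "nat set \<Rightarrow> ((nat \<Rightarrow> 'x obs) \<times> (nat \<Rightarrow> 'x obs)) set" and p :: real
  assumes n: "n \<ge> 1" and p: "p \<ge> 0"
    and A: "\<And>J. J \<subseteq> {1..n} \<Longrightarrow>
      A J \<in> sets ((\<Pi>\<^sub>M i\<in>{1..n} - J. obs_space MX) \<Otimes>\<^sub>M (\<Pi>\<^sub>M i\<in>J. obs_space MX))"
    and le: "\<And>J w. J \<subseteq> {1..n} \<Longrightarrow> w \<in> space (\<Pi>\<^sub>M i\<in>{1..n} - J. obs_space MX) \<Longrightarrow>
      emeasure (\<Pi>\<^sub>M i\<in>J. L) {z \<in> space (\<Pi>\<^sub>M i\<in>J. L). (w, z) \<in> A J} \<le> ennreal p"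
  defines "E \<equiv> {s \<in> space M. (training n s, restrict (\<lambda>i. W i s) (F n s)) \<in> A (F n s)}"
  shows "E \<in> events" and "prob E \<le> p"
proof -
  interpret L: prob_space L by (rule prob_space_L)
  interpret PP: product_prob_space "\<lambda>_. L" "{1..n}" ..
  define B where "B J = {x \<in> space (\<Pi>\<^sub>M i\<in>{1..n}. obs_space MX). (restrict x ({1..n} - J), restrict x J) \<in> A J}" for J
  have B: "B J \<in> sets (\<Pi>\<^sub>M i\<in>{1..n}. obs_space MX)" if J: "J \<subseteq> {1..n}" for J
  proof -
    have rm: "(\<lambda>x. (restrict x ({1..n} - J), restrict x J)) \<in> measurable (\<Pi>\<^sub>M i\<in>{1..n}. obs_space MX)
        ((\<Pi>\<^sub>M i\<in>{1..n} - J. obs_space MX) \<Otimes>\<^sub>M (\<Pi>\<^sub>M i\<in>J. obs_space MX))"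
      using J by (intro measurable_Pair measurable_restrict_subset) auto
    show ?thesis
      using measurable_sets[OF rm A[OF J]] unfolding B_def by (simp add: vimage_def Int_def conj_commute)
  qed
  define EF where "EF J = {s \<in> space M. F n s = J}" for J
  define EW where "EW J = {s \<in> space M. (\<lambda>i\<in>{1..n}. W i s) \<in> B J}" for J
  have EF: "EF J \<in> events" for J unfolding EF_def by (rule fold_event')
  have EW: "EW J \<in> events" if "J \<subseteq> {1..n}" for J
    using W_event[OF B[OF that]] indep_setD_ev2[OF indep_folds_W] unfolding EW_def by blast
  have indep: "prob (EF J \<inter> EW J) = prob (EF J) * prob (EW J)" if "J \<subseteq> {1..n}" for J
    unfolding EF_def EW_def by (intro indep_setD[OF indep_folds_W] fold_event W_event B that)
  have mW: "(\<lambda>s. \<lambda>i\<in>{1..n}. W i s) \<in> measurable M (\<Pi>\<^sub>M i\<in>{1..n}. obs_space MX)"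
    by (intro measurable_restrict W_measurable) auto
  have pW: "prob (EW J) \<le> p" if J: "J \<subseteq> {1..n}" for J
  proof -
    have sp: "sets ((\<Pi>\<^sub>M i\<in>{1..n} - J. L) \<Otimes>\<^sub>M (\<Pi>\<^sub>M i\<in>J. L)) = sets ((\<Pi>\<^sub>M i\<in>{1..n} - J. obs_space MX) \<Otimes>\<^sub>M (\<Pi>\<^sub>M i\<in>J. obs_space MX))"
      by (intro sets_pair_measure_cong sets_PiM_L)
    have "emeasure M (EW J) = emeasure (distr M (\<Pi>\<^sub>M i\<in>{1..n}. obs_space MX) (\<lambda>s. \<lambda>i\<in>{1..n}. W i s)) (B J)"
      using B[OF J] by (subst emeasure_distr[OF mW]) (auto simp: EW_def intro!: arg_cong[where f="emeasure M"])
    also have "\<dots> = emeasure (\<Pi>\<^sub>M i\<in>{1..n}. L) (B J)" using distr_W_restrict[OF n] by simp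
    also have "\<dots> \<le> ennreal p"
      unfolding B_def space_PiM_L[symmetric]
      using J le[OF J] A[OF J, folded sp] by (intro PP.emeasure_PiM_split_le) (auto simp: space_PiM_L)
    finally show ?thesis using p by (simp add: emeasure_eq_measure)
  qed
  have E_eq: "E = (\<Union>J\<in>Pow {1..n}. EF J \<inter> EW J)"
  proof -
    have *: "restrict (\<lambda>i\<in>{1..n}. W i s) J = restrict (\<lambda>i. W i s) J" if "J \<subseteq> {1..n}" for J s
      using that by (auto simp: fun_eq_iff)
    have sp: "(\<lambda>i\<in>{1..n}. W i s) \<in> space (\<Pi>\<^sub>M i\<in>{1..n}. obs_space MX)" if "s \<in> space M" for s
      using measurable_space[OF mW that] .
    show ?thesis
    proof (intro set_eqI iffI)
      fix s assume "s \<in> E"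
      then show "s \<in> (\<Union>J\<in>Pow {1..n}. EF J \<inter> EW J)"
        using F_subset[of n s] sp by (auto simp: E_def EF_def EW_def B_def * simp del: restrict_restrict One_nat_def intro!: bexI[of _ "F n s"])
    next
      fix s assume "s \<in> (\<Union>J\<in>Pow {1..n}. EF J \<inter> EW J)"
      then show "s \<in> E"
        by (auto simp: E_def EF_def EW_def B_def * F_subset simp del: restrict_restrict One_nat_def)
    qed
  qed
  show "E \<in> events" unfolding E_eq using EF EW by (intro sets.finite_UN) auto
  have "prob E = (\<Sum>J\<in>Pow {1..n}. prob (EF J \<inter> EW J))"
    unfolding E_eq using EF EW
    by (intro finite_measure_finite_Union) (auto simp: disjoint_family_on_def EF_def)
  also have "\<dots> \<le> (\<Sum>J\<in>Pow {1..n}. prob (EF J) * p)"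
    using indep pW by (intro sum_mono) (auto intro!: mult_left_mono)
  also have "\<dots> = prob (\<Union>J\<in>Pow {1..n}. EF J) * p"
    using EF by (subst finite_measure_finite_Union) (auto simp: disjoint_family_on_def EF_def sum_distrib_right)
  also have "\<dots> \<le> 1 * p" using p by (intro mult_right_mono) auto
  finally show "prob E \<le> p" by simp
qed

text \<open>The integral freezes the fold and the training sample, so it is the conditional mean of
  each summand given both. \<open>S\<close> selects a block of indices.\<close>

definition dev where
  "dev H n S s = (\<Sum>i\<in>F n s \<inter> S. H (F n s) (training n s) (W i s) - (\<integral>z. H (F n s) (training n s) z \<partial>L))"

abbreviation "training_space n J \<equiv> \<Pi>\<^sub>M i\<in>{1..n} - J. obs_space MX"

text \<open>The two bounds are asked for every training sample, not for almost every one, because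
  the Fubini argument needs a bound on each section.\<close>

definition admissible :: "('x obs \<Rightarrow> real) \<Rightarrow> real \<Rightarrow> real \<Rightarrow> nat \<Rightarrow> (nat set \<Rightarrow> (nat \<Rightarrow> 'x obs) \<Rightarrow> 'x obs \<Rightarrow> real) \<Rightarrow> bool" where
  "admissible D C v n H \<longleftrightarrow> (\<forall>J\<subseteq>{1..n}.
     (\<lambda>(w, z). H J w z) \<in> borel_measurable ((training_space n J) \<Otimes>\<^sub>M obs_space MX) \<and>
     (\<forall>w\<in>space (training_space n J).
        (AE z in L. \<bar>H J w z\<bar> \<le> C * D z) \<and> (\<integral>z. (H J w z)\<^sup>2 \<partial>L) \<le> v))"

end

section \<open>Functions dominated by an envelope with more than two moments\<close>

locale split_sample_envelope = split_sample M MX L W \<kappa> K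
  for M :: "'w measure" and MX :: "'x measure" and L :: "'x obs measure"
    and W :: "nat \<Rightarrow> 'w \<Rightarrow> 'x obs" and \<kappa> :: "nat \<Rightarrow> 'w \<Rightarrow> nat" and K :: nat +
  fixes D :: "'x obs \<Rightarrow> real" and q :: real
  assumes D_meas: "D \<in> borel_measurable (obs_space MX)"
    and D_ge_1: "\<And>z. D z \<ge> 1" and q: "q > 2" and D_int: "integrable L (\<lambda>z. D z powr q)"
begin

sublocale L: prob_space L by (rule prob_space_L)

lemma measurable_L: "measurable L N = measurable (obs_space MX) N"
  using sets_L by (intro measurable_cong_sets) auto

lemma D_L[measurable]: "D \<in> borel_measurable L"
  using D_meas by (simp add: measurable_L)

lemma D_powr_le: "1 \<le> r \<Longrightarrow> r \<le> q \<Longrightarrow> D z powr r \<le> D z powr q"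
  using D_ge_1[of z] by (intro powr_mono) auto

lemma integrable_D_powr:
  assumes "1 \<le> r" "r \<le> q"
  shows "integrable L (\<lambda>z. D z powr r)"
  by (rule Bochner_Integration.integrable_bound[OF D_int]) (auto simp: D_powr_le assms)

lemma integrable_D: "integrable L D"
  using integrable_D_powr[of 1] q D_ge_1 by (simp add: abs_of_pos less_le_trans[OF zero_less_one])

lemma integrable_D2: "integrable L (\<lambda>z. (D z)\<^sup>2)"
proof -
  have "(D z)\<^sup>2 = D z powr 2" for z using D_ge_1[of z] by simp
  then show ?thesis using integrable_D_powr[of 2] q by simp
qed

lemma integrable_dominated:
  assumes "h \<in> borel_measurable (obs_space MX)" "AE z in L. \<bar>h z\<bar> \<le> C * D z"
  shows "integrable L h" "integrable L (\<lambda>z. (h z)\<^sup>2)"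
proof -
  have h[measurable]: "h \<in> borel_measurable L" using assms(1) by (simp add: measurable_L)
  show "integrable L h"
    by (rule Bochner_Integration.integrable_bound[OF integrable_mult_right[OF integrable_D, of C]])
      (use assms(2) in auto)
  show "integrable L (\<lambda>z. (h z)\<^sup>2)"
  proof (rule Bochner_Integration.integrable_bound[OF integrable_mult_right[OF integrable_D2, of "C\<^sup>2"]])
    show "AE z in L. norm ((h z)\<^sup>2) \<le> norm (C\<^sup>2 * (D z)\<^sup>2)"
      using assms(2)
    proof eventually_elim
      case (elim z)
      have "\<bar>h z\<bar>\<^sup>2 \<le> (C * D z)\<^sup>2" using elim by (intro power_mono) auto
      then show ?case by (simp add: power_mult_distrib)
    qed
  qed auto
qed

definition mD where "mD = (\<integral>z. D z powr q \<partial>L)"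

lemma mD_nonneg: "0 \<le> mD" unfolding mD_def by simp

text \<open>Where \<open>D z > b\<close>, one has
  \<open>D z \<le> b powr (1 - q) * D z powr q\<close>, so the part cut off has a mean controlled by
  the \<open>q\<close>-th moment.\<close>

lemma truncation_bias:
  assumes h: "h \<in> borel_measurable (obs_space MX)" "AE z in L. \<bar>h z\<bar> \<le> C * D z" and C: "C \<ge> 0" and b: "b > 0"
  shows "\<bar>(\<integral>z. h z \<partial>L) - (\<integral>z. (if D z \<le> b then h z else 0) \<partial>L)\<bar> \<le> C * (mD * b powr (1 - q))"
proof -
  have hL[measurable]: "h \<in> borel_measurable L" using h by (simp add: measurable_L)
  have int: "integrable L h" by (rule integrable_dominated(1)[OF h])
  have int2: "integrable L (\<lambda>z. if D z \<le> b then h z else 0)"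
    by (rule Bochner_Integration.integrable_bound[OF int]) auto
  have "\<bar>(\<integral>z. h z \<partial>L) - (\<integral>z. (if D z \<le> b then h z else 0) \<partial>L)\<bar>
      = \<bar>\<integral>z. (if D z \<le> b then 0 else h z) \<partial>L\<bar>"
    unfolding Bochner_Integration.integral_diff[OF int int2, symmetric]
    by (intro arg_cong[where f=abs] Bochner_Integration.integral_cong) auto
  also have "\<dots> \<le> (\<integral>z. \<bar>if D z \<le> b then 0 else h z\<bar> \<partial>L)" by (rule integral_abs_bound)
  also have "\<dots> \<le> (\<integral>z. C * (b powr (1 - q) * D z powr q) \<partial>L)"
  proof (rule integral_mono_AE')
    show "integrable L (\<lambda>z. C * (b powr (1 - q) * D z powr q))" using D_int by simp
    show "AE z in L. \<bar>if D z \<le> b then 0 else h z\<bar> \<le> C * (b powr (1 - q) * D z powr q)"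
      using h(2)
    proof eventually_elim
      case (elim z)
      show ?case
      proof (cases "D z \<le> b")
        case True then show ?thesis using C by simp
      next
        case False
        have "1 * D z \<le> (D z / b) powr (q - 1) * D z"
          using False b q D_ge_1[of z] by (intro mult_right_mono ge_one_powr_ge_zero) (auto simp: field_simps)
        also have "\<dots> = b powr (1 - q) * D z powr q"
          using b D_ge_1[of z] by (simp add: powr_divide powr_diff powr_mult field_simps)
        finally have "C * D z \<le> C * (b powr (1 - q) * D z powr q)" using C by (intro mult_left_mono) auto
        then show ?thesis using elim False by simp
      qed
    qed
  qed (auto simp: C)
  also have "\<dots> = C * (mD * b powr (1 - q))" by (simp add: mD_def)
  finally show ?thesis .
qed

lemma admissible_measurable_slice:
  assumes "admissible D C v n H" "J \<subseteq> {1..n}" "w \<in> space (training_space n J)"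
  shows "H J w \<in> borel_measurable (obs_space MX)"
proof -
  have "(\<lambda>(w, z). H J w z) \<in> borel_measurable ((training_space n J) \<Otimes>\<^sub>M obs_space MX)"
    using assms unfolding admissible_def by blast
  from measurable_compose[OF measurable_Pair1'[OF assms(3)] this] show ?thesis by simp
qed

text \<open>If all evaluation observations satisfy the envelope bound, truncation does not alter the
  summands but only their means, each by at most the truncation bias. That is the offset added to
  \<open>t\<close>; the truncated function is bounded by \<open>C * b\<close> and obeys the
  exponential bound. The variance term counts \<open>card S\<close> and not \<open>n\<close>, which
  makes short blocks cheap.\<close>

lemma truncated_deviation:
  fixes b C l t v :: real
  assumes adm: "admissible D C v n H" and n: "n \<ge> 1" and S: "S \<subseteq> {1..n}"
    and C: "C \<ge> 0" and b: "b > 0" and l: "0 \<le> l" "2 * l * (C * b) \<le> 1"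
  defines "E \<equiv> {s \<in> space M. (\<forall>i\<in>F n s. D (W i s) \<le> b) \<and>
     t + n * (C * (mD * b powr (1 - q))) < \<bar>dev H n S s\<bar>}"
  shows "E \<in> events" "prob E \<le> 2 * exp (- l * t + card S * (l\<^sup>2 * v))"
proof -
  let ?T = "\<lambda>J. \<Pi>\<^sub>M i\<in>{1..n} - J. obs_space MX" and ?Q = "\<lambda>J. \<Pi>\<^sub>M i\<in>J. obs_space MX"
  define bias where "bias = C * (mD * b powr (1 - q))"
  define A where "A J = {(w, z) \<in> space (?T J \<Otimes>\<^sub>M ?Q J). (\<forall>i\<in>J. D (z i) \<le> b) \<and>
     t + n * bias < \<bar>\<Sum>i\<in>J \<inter> S. H J w (z i) - (\<integral>z. H J w z \<partial>L)\<bar>}" for J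
  have finS: "finite S" using S finite_subset by auto
  have trS: "restrict (\<lambda>i. W i s) J \<in> space (?Q J)" if "s \<in> space M" "J \<subseteq> {1..n}" for J s
    using that measurable_space[OF W_measurable] by (auto simp: space_PiM)
  have E_eq: "E = {s \<in> space M. (training n s, restrict (\<lambda>i. W i s) (F n s)) \<in> A (F n s)}"
    using trS F_subset unfolding E_def A_def dev_def bias_def
    by (auto simp: space_pair_measure)
  have A: "A J \<in> sets (?T J \<Otimes>\<^sub>M ?Q J)" if J: "J \<subseteq> {1..n}" for J
  proof -
    have H[measurable]: "(\<lambda>(w, z). H J w z) \<in> borel_measurable (?T J \<Otimes>\<^sub>M obs_space MX)"
      using adm J unfolding admissible_def by blast
    have "(\<lambda>(w, z). H J w z) \<in> borel_measurable (?T J \<Otimes>\<^sub>M L)"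
      using H by (subst measurable_cong_sets[OF sets_pair_measure_cong[OF refl sets_L] refl])
    then have I[measurable]: "(\<lambda>w. \<integral>z. H J w z \<partial>L) \<in> borel_measurable (?T J)"
      by (rule L.borel_measurable_lebesgue_integral)
    have comp[measurable]: "(\<lambda>wz. snd wz i) \<in> measurable (?T J \<Otimes>\<^sub>M ?Q J) (obs_space MX)" if "i \<in> J" for i
      using that by measurable
    have Hi[measurable]: "(\<lambda>wz. H J (fst wz) (snd wz i)) \<in> borel_measurable (?T J \<Otimes>\<^sub>M ?Q J)" if "i \<in> J" for i
      using measurable_compose[OF measurable_Pair[OF measurable_fst comp[OF that]] H] by simp
    have Di[measurable]: "(\<lambda>wz. D (snd wz i)) \<in> borel_measurable (?T J \<Otimes>\<^sub>M ?Q J)" if "i \<in> J" for i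
      using measurable_compose[OF comp[OF that] D_meas] by simp
    have "A J = {wz \<in> space (?T J \<Otimes>\<^sub>M ?Q J). (\<forall>i\<in>J. D (snd wz i) \<le> b) \<and>
     t + n * bias < \<bar>\<Sum>i\<in>J \<inter> S. H J (fst wz) (snd wz i) - (\<integral>z. H J (fst wz) z \<partial>L)\<bar>}"
      unfolding A_def by (auto simp: case_prod_beta)
    moreover have "finite J" using J finite_subset by auto
    moreover have g: "(\<lambda>wz. \<bar>\<Sum>i\<in>J \<inter> S. H J (fst wz) (snd wz i) - (\<integral>z. H J (fst wz) z \<partial>L)\<bar>) \<in> borel_measurable (?T J \<Otimes>\<^sub>M ?Q J)"
      by (intro borel_measurable_abs borel_measurable_sum borel_measurable_diff Hi measurable_compose[OF measurable_fst I]) auto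
    ultimately show ?thesis
      by (simp only:) (intro sets.sets_Collect_conj sets.sets_Collect_finite_All
        borel_measurable_le[OF Di borel_measurable_const] borel_measurable_less[OF borel_measurable_const g])
  qed
  have le: "emeasure (\<Pi>\<^sub>M i\<in>J. L) {z \<in> space (\<Pi>\<^sub>M i\<in>J. L). (w, z) \<in> A J}
      \<le> ennreal (2 * exp (- l * t + card S * (l\<^sup>2 * v)))"
    if J: "J \<subseteq> {1..n}" and w: "w \<in> space (?T J)" for J w
  proof -
    have H[measurable]: "H J w \<in> borel_measurable (obs_space MX)"
      by (rule admissible_measurable_slice[OF adm J w])
    have Hb: "AE z in L. \<bar>H J w z\<bar> \<le> C * D z" and Hv: "(\<integral>z. (H J w z)\<^sup>2 \<partial>L) \<le> v"
      using adm J w unfolding admissible_def by blast+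
    define X where "X = (\<lambda>z. if D z \<le> b then H J w z else 0)"
    have X[measurable]: "X \<in> borel_measurable L" using H unfolding X_def measurable_L
      using D_meas by measurable
    have finJ: "finite J" using J finite_subset by auto
    have v0: "0 \<le> v" using Hv by (rule order_trans[rotated]) simp
    have XB: "AE z in L. \<bar>X z\<bar> \<le> C * b" 
      using Hb
    proof eventually_elim
      case (elim z)
      have "D z \<le> b \<Longrightarrow> C * D z \<le> C * b" using C by (intro mult_left_mono) auto
      then show ?case using elim C b by (auto simp: X_def)
    qed
    have Xv: "(\<integral>z. (X z)\<^sup>2 \<partial>L) \<le> v"
      using Hv by (rule order_trans[rotated])
        (auto intro!: integral_mono' integrable_dominated(2)[OF H Hb] simp: X_def)
    have bias: "\<bar>(\<integral>z. H J w z \<partial>L) - (\<integral>z. X z \<partial>L)\<bar> \<le> bias"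
      unfolding X_def bias_def by (rule truncation_bias[OF H Hb C b])
    have bias0: "0 \<le> bias" using C by (simp add: bias_def mD_nonneg)
    have "{z \<in> space (\<Pi>\<^sub>M i\<in>J. L). (w, z) \<in> A J} \<subseteq>
        {z \<in> space (\<Pi>\<^sub>M i\<in>J. L). t < \<bar>\<Sum>i\<in>J \<inter> S. X (z i) - (\<integral>z. X z \<partial>L)\<bar>}"
    proof safe
      fix z assume z: "z \<in> space (\<Pi>\<^sub>M i\<in>J. L)" and "(w, z) \<in> A J"
      then have Db: "\<forall>i\<in>J. D (z i) \<le> b" and
        gt: "t + n * bias < \<bar>\<Sum>i\<in>J \<inter> S. H J w (z i) - (\<integral>z. H J w z \<partial>L)\<bar>"
        by (auto simp: A_def)
      have "(\<Sum>i\<in>J \<inter> S. H J w (z i) - (\<integral>z. H J w z \<partial>L)) =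
        (\<Sum>i\<in>J \<inter> S. X (z i) - (\<integral>z. X z \<partial>L)) + real (card (J \<inter> S)) * ((\<integral>z. X z \<partial>L) - (\<integral>z. H J w z \<partial>L))"
        using Db by (simp add: X_def sum_subtractf algebra_simps)
      moreover have "\<bar>real (card (J \<inter> S)) * ((\<integral>z. X z \<partial>L) - (\<integral>z. H J w z \<partial>L))\<bar> \<le> n * bias"
        unfolding abs_mult
      proof (intro mult_mono)
        have "card (J \<inter> S) \<le> card {1..n}" using J by (intro card_mono) auto
        then show "\<bar>real (card (J \<inter> S))\<bar> \<le> real n" by simp
      qed (use bias bias0 in auto)
      ultimately show "t < \<bar>\<Sum>i\<in>J \<inter> S. X (z i) - (\<integral>z. X z \<partial>L)\<bar>" using gt by linarith
    qed
    then have "emeasure (\<Pi>\<^sub>M i\<in>J. L) {z \<in> space (\<Pi>\<^sub>M i\<in>J. L). (w, z) \<in> A J} \<le>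
      emeasure (\<Pi>\<^sub>M i\<in>J. L) {z \<in> space (\<Pi>\<^sub>M i\<in>J. L). t < \<bar>\<Sum>i\<in>J \<inter> S. X (z i) - (\<integral>z. X z \<partial>L)\<bar>}"
      by (intro emeasure_mono) auto
    also have "\<dots> \<le> ennreal (2 * exp (- l * t + card (J \<inter> S) * (l\<^sup>2 * v)))"
      using finJ l by (intro L.PiM_chernoff[OF _ _ X XB Xv]) auto
    also have "\<dots> \<le> ennreal (2 * exp (- l * t + card S * (l\<^sup>2 * v)))"
      using v0 finS by (intro ennreal_leI mult_left_mono) (auto intro!: mult_right_mono card_mono)
    finally show ?thesis .
  qed
  show "E \<in> events" "prob E \<le> 2 * exp (- l * t + card S * (l\<^sup>2 * v))"
    unfolding E_eq by (intro conditional_bound[OF n _ A le]; simp)+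
qed

end

section \<open>Almost sure deviation rates\<close>

lemma (in prob_space) eventually_not_in_of_summable:
  assumes ev: "\<forall>\<^sub>F n in sequentially. A n \<in> events \<and> prob (A n) \<le> f n" and f: "summable f"
  shows "AE x in M. \<forall>\<^sub>F n in sequentially. x \<notin> A n"
proof -
  obtain n0 where n0: "\<And>n. n \<ge> n0 \<Longrightarrow> A n \<in> events \<and> prob (A n) \<le> f n"
    using ev unfolding eventually_sequentially by blast
  \<comment> \<open>The bounds hold only from \<open>n0\<close> on; the finitely many earlier events
    are replaced by the empty set, which changes nothing eventually.\<close>
  define B where "B n = (if n \<ge> n0 then A n else {})" for n
  have "summable (\<lambda>n. prob (B n))"
    by (rule summable_comparison_test[OF _ f]) (use n0 in \<open>auto simp: B_def intro!: exI[of _ n0]\<close>)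
  then have "AE x in M. \<forall>\<^sub>F n in sequentially. x \<in> space M - B n"
    using n0 by (intro borel_cantelli_AE1) (auto simp: B_def emeasure_eq_measure)
  then show ?thesis
  proof eventually_elim
    case (elim x)
    with eventually_ge_at_top[of n0] show ?case by eventually_elim (auto simp: B_def)
  qed
qed

context split_sample_envelope
begin

text \<open>The envelope condition is part of the event so that truncation at
  \<open>n powr \<beta>\<close> is harmless on it; \<open>eventually_D_le\<close> removes the
  condition almost surely.\<close>

definition dev_event where
  "dev_event \<delta> \<beta> H n S = {s \<in> space M. (\<forall>i\<in>F n s. D (W i s) \<le> n powr \<beta>) \<and> \<delta> * sqrt (n * ln n) < \<bar>dev H n S s\<bar>}"

text \<open>The choice \<open>l = \<theta> * sqrt (ln n / n)\<close> turns both terms of the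
  exponent into multiples of \<open>ln n\<close>, hence the bound into a power of \<open>n\<close>;
  \<open>\<theta>\<close> stays free so that the exponent can be tuned. Half of
  \<open>\<delta>\<close> pays for the truncation bias. The condition \<open>\<beta> < 1 / 2\<close>
  makes \<open>l\<close> times the truncation level tend to 0. The threshold for \<open>n\<close>
  precedes \<open>H\<close> and \<open>S\<close>, since both will vary with
  \<open>n\<close>.\<close>

lemma dev_prob:
  fixes C \<delta> \<theta> v r \<beta> :: real
  assumes C: "C \<ge> 0" and d: "\<delta> > 0" and th: "\<theta> \<ge> 0" and v: "v \<ge> 0" and r: "r \<ge> 0"
    and b: "1 / q < \<beta>" "\<beta> < 1 / 2"
  shows "\<forall>\<^sub>F n in sequentially. \<forall>H S. admissible D C v n H \<longrightarrow> S \<subseteq> {1..n} \<longrightarrow> card S \<le> r * n \<longrightarrow>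
     dev_event \<delta> \<beta> H n S \<in> events \<and> prob (dev_event \<delta> \<beta> H n S) \<le> 2 * n powr (r * \<theta>\<^sup>2 * v - \<theta> * \<delta> / 2)"
proof -
  have e1: "\<forall>\<^sub>F n::nat in sequentially. 2 * (\<theta> * sqrt (ln n / n)) * (C * n powr \<beta>) \<le> 1"
  proof -
    have "((\<lambda>n::nat. sqrt (ln n / n) * n powr \<beta>) \<longlongrightarrow> 0) sequentially"
      using b by real_asymp
    then have "((\<lambda>n::nat. 2 * \<theta> * C * (sqrt (ln n / n) * n powr \<beta>)) \<longlongrightarrow> 2 * \<theta> * C * 0) sequentially"
      by (rule tendsto_mult_left)
    then have "\<forall>\<^sub>F n::nat in sequentially. 2 * \<theta> * C * (sqrt (ln n / n) * n powr \<beta>) < 1"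
      by (simp add: order_tendstoD)
    then show ?thesis by eventually_elim (simp add: mult_ac)
  qed
  have e2: "\<forall>\<^sub>F n::nat in sequentially. n * (C * (mD * (n powr \<beta>) powr (1 - q))) \<le> \<delta> / 2 * sqrt (n * ln n)"
  proof -
    \<comment> \<open>The exponent of \<open>n\<close> in the accumulated truncation bias. Since
      \<open>\<beta> > 1 / q\<close> and \<open>q > 2\<close>, the product
      \<open>\<beta> * (q - 1)\<close> is at least \<open>1 - 1 / q\<close>, hence at least
      \<open>1 / 2\<close>; the factor \<open>sqrt (ln n)\<close> then absorbs all
      constants.\<close>
    define a where "a = 1 + \<beta> * (1 - q)"
    have "1 / 2 \<le> \<beta> * (q - 1)"
    proof -
      have "1 / 2 \<le> 1 / q * (q - 1)" using q by (simp add: field_simps)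
      also have "\<dots> \<le> \<beta> * (q - 1)" using b q by (intro mult_right_mono) auto
      finally show ?thesis .
    qed
    then have a: "a \<le> 1 / 2" unfolding a_def by (simp add: algebra_simps)
    have lim: "filterlim (\<lambda>n::nat. sqrt (ln n)) at_top sequentially" by real_asymp
    have "\<forall>\<^sub>F n::nat in sequentially. 2 * C * mD / \<delta> \<le> sqrt (ln n)"
      using lim unfolding filterlim_at_top by blast
    with eventually_ge_at_top[of 1] show ?thesis
    proof eventually_elim
      case (elim n)
      have "n * (C * (mD * (n powr \<beta>) powr (1 - q))) = (C * mD) * n powr a"
        using elim by (simp add: a_def powr_add powr_powr)
      also have "\<dots> \<le> (C * mD) * n powr (1 / 2)"
        using elim a C mD_nonneg by (intro mult_left_mono powr_mono) auto
      also have "\<dots> \<le> (\<delta> / 2 * sqrt (ln n)) * n powr (1 / 2)"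
        using elim d by (intro mult_right_mono) (auto simp: field_simps)
      also have "\<dots> = \<delta> / 2 * sqrt (n * ln n)"
        using elim by (simp add: powr_half_sqrt real_sqrt_mult)
      finally show ?case .
    qed
  qed
  from e1 e2 eventually_ge_at_top[of 2] show ?thesis
  proof eventually_elim
    case (elim n)
    show ?case
    proof (intro allI impI)
      fix H S assume adm: "admissible D C v n H" and S: "S \<subseteq> {1..n}" "card S \<le> r * n"
      define l where "l = \<theta> * sqrt (ln n / n)"
      define bias where "bias = C * (mD * (n powr \<beta>) powr (1 - q))"
      define t where "t = \<delta> * sqrt (n * ln n) - n * bias"
      have n: "n \<ge> 1" "real n \<ge> 2" using elim by auto
      have ln0: "ln (real n) \<ge> 0" using n by simp
      have l: "0 \<le> l" "2 * l * (C * n powr \<beta>) \<le> 1" using th elim ln0 by (auto simp: l_def)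
      note * = truncated_deviation[OF adm n(1) S(1) C _ l, of t]
      have E: "dev_event \<delta> \<beta> H n S = {s \<in> space M. (\<forall>i\<in>F n s. D (W i s) \<le> n powr \<beta>) \<and>
          t + n * (C * (mD * (n powr \<beta>) powr (1 - q))) < \<bar>dev H n S s\<bar>}"
        by (simp add: dev_event_def t_def bias_def)
      have ll: "l * sqrt (n * ln n) = \<theta> * ln n"
        using ln0 n by (simp add: l_def real_sqrt_mult[symmetric] power2_eq_square[symmetric])
      have "l * (n * bias) \<le> l * (\<delta> / 2 * sqrt (n * ln n))" using elim l by (intro mult_left_mono) (auto simp: bias_def)
      then have lt: "- l * t \<le> - (\<theta> * \<delta> / 2) * ln n"
        using ll by (simp add: t_def algebra_simps)
      have "card S * (l\<^sup>2 * v) \<le> (r * n) * (l\<^sup>2 * v)" using S v by (intro mult_right_mono) auto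
      also have "\<dots> = r * \<theta>\<^sup>2 * v * ln n" using n ln0 by (simp add: l_def power_mult_distrib)
      finally have "- l * t + card S * (l\<^sup>2 * v) \<le> (r * \<theta>\<^sup>2 * v - \<theta> * \<delta> / 2) * ln n"
        using lt by (simp add: algebra_simps)
      then have "2 * exp (- l * t + card S * (l\<^sup>2 * v)) \<le> 2 * n powr (r * \<theta>\<^sup>2 * v - \<theta> * \<delta> / 2)"
        using n by (simp add: powr_def)
      then show "dev_event \<delta> \<beta> H n S \<in> events \<and> prob (dev_event \<delta> \<beta> H n S) \<le> 2 * n powr (r * \<theta>\<^sup>2 * v - \<theta> * \<delta> / 2)"
        using * n unfolding E by (auto intro: order_trans)
    qed
  qed
qed

text \<open>By Markov's inequality for the \<open>q\<close>-th moment, observation \<open>i\<close>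
  exceeds \<open>i powr \<beta>\<close> with probability at most
  \<open>mD * i powr (- (\<beta> * q))\<close>, which is summable because
  \<open>\<beta> * q > 1\<close>. The finitely many exceptions are overtaken by the growing level
  \<open>n powr \<beta>\<close>.\<close>

lemma eventually_D_le:
  assumes b: "1 / q < \<beta>"
  shows "AE s in M. \<forall>\<^sub>F n in sequentially. \<forall>i\<in>{1..n}. D (W i s) \<le> n powr \<beta>"
proof -
  have q0: "q > 0" using q by simp
  have b0: "\<beta> > 0" using b q0 by (meson less_trans zero_less_divide_1_iff)
  have bq: "\<beta> * q > 1" using b q0 by (simp add: field_simps)
  define A where "A i = {s \<in> space M. i powr \<beta> < D (W i s)}" for i :: nat
  have "AE s in M. \<forall>\<^sub>F i in sequentially. s \<notin> A i"
  proof (rule eventually_not_in_of_summable)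
    show "summable (\<lambda>i. mD * real i powr (- (\<beta> * q)))"
      using bq by (intro summable_mult) (simp add: summable_real_powr_iff)
    show "\<forall>\<^sub>F i in sequentially. A i \<in> events \<and> prob (A i) \<le> mD * real i powr (- (\<beta> * q))"
      using eventually_ge_at_top[of 1]
    proof eventually_elim
      case (elim i)
      note [measurable] = W_measurable[OF elim] D_meas
      have A: "A i \<in> events" unfolding A_def by measurable
      have "prob (A i) = measure (distr M (obs_space MX) (W i)) {z \<in> space (obs_space MX). i powr \<beta> < D z}"
        unfolding A_def by (subst measure_distr) (auto intro!: arg_cong[where f=prob] dest: measurable_space[OF W_measurable[OF elim]])
      also have "\<dots> = measure L {z \<in> space L. i powr \<beta> < D z}"
        using W_distr[OF elim] by (simp add: sets_eq_imp_space_eq[OF sets_L])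
      also have "\<dots> \<le> measure L {z \<in> space L. D z powr q \<ge> (i powr \<beta>) powr q}"
        using q0 by (intro L.finite_measure_mono) (auto intro!: powr_mono2 simp: measurable_L)
      also have "\<dots> \<le> (\<integral>z. D z powr q \<partial>L) / (i powr \<beta>) powr q"
        using elim by (intro integral_Markov_inequality_measure[where A="{}"]) (auto simp: D_int)
      also have "\<dots> = mD * real i powr (- (\<beta> * q))"
        by (simp add: mD_def powr_powr powr_minus divide_simps)
      finally show ?case using A by simp
    qed
  qed
  then show ?thesis
    using AE_space
  proof eventually_elim
    case (elim s)
    then obtain i0 where i0: "\<And>i. i \<ge> i0 \<Longrightarrow> D (W i s) \<le> i powr \<beta>"
      unfolding eventually_sequentially A_def by (auto simp: not_less)
    define B where "B = Max (insert 0 ((\<lambda>i. D (W i s)) ` {..i0}))"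
    have B: "D (W i s) \<le> B" if "i \<le> i0" for i
      unfolding B_def using that by (intro Max_ge) auto
    have "filterlim (\<lambda>n::nat. n powr \<beta>) at_top sequentially" using b0 by real_asymp
    then have "\<forall>\<^sub>F n::nat in sequentially. B \<le> n powr \<beta>" unfolding filterlim_at_top by blast
    then show ?case
    proof eventually_elim
      case (elim n)
      show ?case
      proof
        fix i assume i: "i \<in> {1..n}"
        show "D (W i s) \<le> n powr \<beta>"
        proof (cases "i \<le> i0")
          case True then show ?thesis using B elim by (meson order_trans)
        next
          case False
          then have "D (W i s) \<le> i powr \<beta>" using i0 by simp
          also have "\<dots> \<le> n powr \<beta>" using i b0 by (intro powr_mono2) auto
          finally show ?thesis .
        qed
      qed
    qed
  qed
qed

lemma array_deviation:
  fixes C \<delta> :: real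
  assumes C: "C \<ge> 0" and d: "\<delta> > 0" and adm: "\<And>n. admissible D C (\<delta>\<^sup>2 / 32) n (H n)"
  shows "AE s in M. \<forall>\<^sub>F n in sequentially. \<bar>dev (H n) n {1..n} s\<bar> \<le> \<delta> * sqrt (n * ln n)"
proof -
  obtain \<beta> where b: "1 / q < \<beta>" "\<beta> < 1 / 2"
    using dense[of "1 / q" "1 / 2"] q by (auto simp: field_simps)
  \<comment> \<open>With \<open>\<theta> = 8 / \<delta>\<close> the variance bound
    \<open>\<delta>\<^sup>2 / 32\<close> contributes 2 and the deviation term -4, leaving a summable
    power.\<close>
  have e: "1 * (8 / \<delta>)\<^sup>2 * (\<delta>\<^sup>2 / 32) - 8 / \<delta> * \<delta> / 2 = - 2"
    using d by (simp add: power_divide)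
  have "AE s in M. \<forall>\<^sub>F n in sequentially. s \<notin> dev_event \<delta> \<beta> (H n) n {1..n}"
  proof (rule eventually_not_in_of_summable)
    show "summable (\<lambda>n. 2 * real n powr (- 2))"
      by (intro summable_mult) (simp add: summable_real_powr_iff)
    have "\<forall>\<^sub>F n in sequentially. \<forall>H S. admissible D C (\<delta>\<^sup>2 / 32) n H \<longrightarrow> S \<subseteq> {1..n} \<longrightarrow> card S \<le> 1 * real n \<longrightarrow>
     dev_event \<delta> \<beta> H n S \<in> events \<and>
     prob (dev_event \<delta> \<beta> H n S)
       \<le> 2 * n powr (1 * (8 / \<delta>)\<^sup>2 * (\<delta>\<^sup>2 / 32) - 8 / \<delta> * \<delta> / 2)"
      using d by (intro dev_prob[OF C d _ _ _ b]) auto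
    then show "\<forall>\<^sub>F n in sequentially. dev_event \<delta> \<beta> (H n) n {1..n} \<in> events \<and> prob (dev_event \<delta> \<beta> (H n) n {1..n}) \<le> 2 * real n powr (- 2)"
      unfolding e
    proof eventually_elim
      case (elim n)
      from elim[rule_format, OF adm[of n], of "{1..n}"] show ?case by simp
    qed
  qed
  then show ?thesis
    using eventually_D_le[OF b(1)] AE_space
  proof eventually_elim
    case (elim s)
    from elim(1,2) show ?case
    proof eventually_elim
      case (elim n)
      then show ?case using F_subset[of n s] \<open>s \<in> space M\<close> unfolding dev_event_def by (auto simp: not_less)
    qed
  qed
qed

text \<open>Observations keep their label, so the part of the fold at time \<open>n\<close> with
  indices up to \<open>m\<close> is the fold at time \<open>m\<close>, and a bound at time
  \<open>m\<close> can be reused.\<close>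

lemma fold_split:
  assumes "m \<le> n"
  shows "F n s = F m s \<union> (F n s \<inter> {m<..n})" "F m s \<inter> (F n s \<inter> {m<..n}) = {}"
  using assms by (auto simp: fold_idx_def)

text \<open>For a fixed function the variance is not small, so the exponential bound for a single \<open>n\<close> is only a
  small negative power of \<open>n\<close>. It is summable along \<open>k ^ p\<close>, and the increments since the last index
  of this form have relative length \<open>o(1)\<close>, so that they admit a union bound over all \<open>n\<close>; no maximal
  inequality is needed.\<close>
lemma iid_deviation:
  fixes C \<delta> :: real
  assumes h: "h \<in> borel_measurable (obs_space MX)" and hC: "AE z in L. \<bar>h z\<bar> \<le> C * D z"
    and C: "C \<ge> 0" and d: "\<delta> > 0"
  shows "AE s in M. \<forall>\<^sub>F n in sequentially. \<bar>\<Sum>i\<in>F n s. h (W i s) - (\<integral>z. h z \<partial>L)\<bar> \<le> \<delta> * sqrt (n * ln n)"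
proof -
  obtain \<beta> where b: "1 / q < \<beta>" "\<beta> < 1 / 2"
    using dense[of "1 / q" "1 / 2"] q by (auto simp: field_simps)
  define H where "H = (\<lambda>(J :: nat set) (w :: nat \<Rightarrow> 'x obs) z. h z)"
  \<comment> \<open>The summand 1 keeps \<open>v\<close> positive, so that one may divide by it even
    if \<open>h\<close> vanishes almost everywhere.\<close>
  define v where "v = (\<integral>z. (h z)\<^sup>2 \<partial>L) + 1"
  have v: "v > 0" unfolding v_def by (intro add_nonneg_pos) auto
  have adm: "admissible D C v n H" for n
    unfolding admissible_def H_def using hC h by (auto simp: v_def)
  define \<delta>' where "\<delta>' = \<delta> / 2"
  have d': "\<delta>' > 0" using d by (simp add: \<delta>'_def)
  \<comment> \<open>The exponent \<open>\<theta>\<^sup>2 * v - \<theta> * \<delta>' / 2\<close> is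
    minimal at \<open>\<theta> = \<delta>' / (4 * v)\<close>, with value \<open>- c\<close>. The
    power \<open>p\<close> is taken so large that the bound at \<open>k ^ p\<close> is at most a
    multiple of \<open>k powr (- 2)\<close>.\<close>
  define c where "c = \<delta>'\<^sup>2 / (16 * v)"
  have c: "c > 0" using d' v by (simp add: c_def)
  define p where "p = nat \<lceil>2 / c\<rceil>"
  have "2 / c \<le> p" unfolding p_def by linarith
  then have p: "p * c \<ge> 2" using c by (simp add: field_simps)
  have p0: "p > 0" using p by (intro gr0I) simp
  define E where "E = dev_event \<delta>' \<beta> H"
  define r where "r n = nat \<lfloor>root p (real n)\<rfloor>" for n
  define m where "m n = r n ^ p" for n
  have r_le: "real (r n) \<le> root p n" for n using p0 unfolding r_def by simp
  have r_ge: "real (r n) \<ge> root p n - 1" for n unfolding r_def by linarith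
  have m_le: "m n \<le> n" for n
  proof -
    have "real (r n) ^ p \<le> root p n ^ p" by (intro power_mono r_le) auto
    then show ?thesis using p0 by (simp add: m_def flip: of_nat_power)
  qed
  have r_top: "filterlim r at_top sequentially"
  proof -
    have "filterlim (\<lambda>n::nat. root p n - 1) at_top sequentially" using p0 by real_asymp
    then have "filterlim (\<lambda>n. real (r n)) at_top sequentially"
      by (rule filterlim_at_top_mono) (use r_ge in auto)
    then show ?thesis by (simp add: filterlim_sequentially_iff_filterlim_real)
  qed
  \<comment> \<open>The largest \<open>p\<close>-th power below \<open>n\<close> is at least
    \<open>(root p n - 1) ^ p\<close>, which is \<open>n\<close> times a factor tending to 1. The
    fraction in the claim is what makes the exponent of the block bound equal to -2 for
    \<open>\<theta> = 8 / \<delta>'\<close>.\<close>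
  have gap: "\<forall>\<^sub>F n in sequentially. card {m n<..n} \<le> \<delta>'\<^sup>2 / (32 * v) * n"
  proof -
    have "((\<lambda>n::nat. (1 - 1 / root p n) ^ p) \<longlongrightarrow> (1 - 0) ^ p) sequentially"
      using p0 by (intro tendsto_power tendsto_diff tendsto_const) real_asymp
    moreover have "1 - \<delta>'\<^sup>2 / (32 * v) < (1 - 0) ^ p" using d' v by simp
    ultimately have "\<forall>\<^sub>F n::nat in sequentially. 1 - \<delta>'\<^sup>2 / (32 * v) < (1 - 1 / root p n) ^ p"
      by (rule order_tendstoD(1))
    with eventually_ge_at_top[of 1] show ?thesis
    proof eventually_elim
      case (elim n)
      have n1: "1 \<le> root p n" using elim p0 by simp
      have "(1 - 1 / root p n) ^ p * n = ((1 - 1 / root p n) * root p n) ^ p"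
        using p0 by (simp add: power_mult_distrib)
      also have "(1 - 1 / root p n) * root p n = root p n - 1" using n1 by (simp add: field_simps)
      also have "(root p n - 1) ^ p \<le> real (r n) ^ p" using n1 r_ge by (intro power_mono) auto
      finally have "(1 - 1 / root p n) ^ p * n \<le> m n" by (simp add: m_def)
      moreover have "(1 - \<delta>'\<^sup>2 / (32 * v)) * n \<le> (1 - 1 / root p n) ^ p * n"
        using elim by (intro mult_right_mono) auto
      ultimately show ?case using m_le[of n] by (simp add: algebra_simps of_nat_diff)
    qed
  qed
  have A: "AE s in M. \<forall>\<^sub>F k in sequentially. s \<notin> E (k ^ p) {1..k ^ p}"
  proof (rule eventually_not_in_of_summable)
    show "summable (\<lambda>k. 2 * real k powr (- 2))"
      by (intro summable_mult) (simp add: summable_real_powr_iff)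
    have lim: "filterlim (\<lambda>k::nat. k ^ p) at_top sequentially"
      using p0 by (intro filterlim_subseq) (auto simp: strict_mono_def power_strict_mono)
    have e: "1 * (\<delta>' / (4 * v))\<^sup>2 * v - \<delta>' / (4 * v) * \<delta>' / 2 = - c"
      using v by (simp add: c_def power2_eq_square field_simps)
    have "\<forall>\<^sub>F n in sequentially. \<forall>H S. admissible D C v n H \<longrightarrow> S \<subseteq> {1..n} \<longrightarrow> card S \<le> 1 * real n \<longrightarrow>
      dev_event \<delta>' \<beta> H n S \<in> events \<and>
      prob (dev_event \<delta>' \<beta> H n S)
       \<le> 2 * n powr (1 * (\<delta>' / (4 * v))\<^sup>2 * v - \<delta>' / (4 * v) * \<delta>' / 2)"
      using d' v by (intro dev_prob[OF C d' _ _ _ b]) auto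
    from eventually_compose_filterlim[OF this lim] eventually_ge_at_top[of 1]
    show "\<forall>\<^sub>F k in sequentially. E (k ^ p) {1..k ^ p} \<in> events \<and> prob (E (k ^ p) {1..k ^ p}) \<le> 2 * real k powr (- 2)"
      unfolding e
    proof eventually_elim
      case (elim k)
      from elim(1)[rule_format, OF adm, of "{1..k ^ p}"]
      have "E (k ^ p) {1..k ^ p} \<in> events \<and> prob (E (k ^ p) {1..k ^ p}) \<le> 2 * real (k ^ p) powr (- c)"
        by (simp add: E_def)
      moreover have "real (k ^ p) powr (- c) \<le> real k powr (- 2)"
      proof -
        have "real (k ^ p) powr (- c) = real k powr (- (p * c))"
          using elim by (simp add: powr_realpow[symmetric] powr_powr)
        also have "\<dots> \<le> real k powr (- 2)" using p elim by (intro powr_mono) auto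
        finally show ?thesis .
      qed
      ultimately show ?case by linarith
    qed
  qed
  have B: "AE s in M. \<forall>\<^sub>F n in sequentially. s \<notin> E n {m n<..n}"
  proof (rule eventually_not_in_of_summable)
    show "summable (\<lambda>k. 2 * real k powr (- 2))"
      by (intro summable_mult) (simp add: summable_real_powr_iff)
    have e: "\<delta>'\<^sup>2 / (32 * v) * (8 / \<delta>')\<^sup>2 * v - 8 / \<delta>' * \<delta>' / 2 = - 2"
      using v d' by (simp add: power2_eq_square field_simps)
    have "\<forall>\<^sub>F n in sequentially. \<forall>H S. admissible D C v n H \<longrightarrow> S \<subseteq> {1..n} \<longrightarrow> card S \<le> \<delta>'\<^sup>2 / (32 * v) * real n \<longrightarrow>
      dev_event \<delta>' \<beta> H n S \<in> events \<and>
      prob (dev_event \<delta>' \<beta> H n S)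
       \<le> 2 * n powr (\<delta>'\<^sup>2 / (32 * v) * (8 / \<delta>')\<^sup>2 * v - 8 / \<delta>' * \<delta>' / 2)"
      using d' v by (intro dev_prob[OF C d' _ _ _ b]) auto
    with gap show "\<forall>\<^sub>F n in sequentially. E n {m n<..n} \<in> events \<and> prob (E n {m n<..n}) \<le> 2 * real n powr (- 2)"
      unfolding e
    proof eventually_elim
      case (elim n)
      from elim(2)[rule_format, OF adm _ elim(1)] show ?case by (simp add: E_def subset_eq)
    qed
  qed
  have dev_eq: "dev H n S s = (\<Sum>i\<in>F n s \<inter> S. h (W i s) - (\<integral>z. h z \<partial>L))" for n S s
    by (simp add: dev_def H_def)
  show ?thesis
    using A B eventually_D_le[OF b(1)] AE_space
  proof eventually_elim
    case (elim s)
    from eventually_compose_filterlim[OF elim(1) r_top]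
    have "\<forall>\<^sub>F n in sequentially. s \<notin> E (m n) {1..m n}" by (simp add: m_def)
    moreover have m_top: "filterlim m at_top sequentially"
      unfolding m_def using p0
      by (intro filterlim_compose[OF _ r_top, of "\<lambda>k. k ^ p"] filterlim_subseq) (auto simp: strict_mono_def power_strict_mono)
    from eventually_compose_filterlim[OF elim(3) m_top]
    have "\<forall>\<^sub>F n in sequentially. \<forall>i\<in>{1..m n}. D (W i s) \<le> m n powr \<beta>" .
    moreover have "\<forall>\<^sub>F n in sequentially. m n \<ge> 1"
      using m_top unfolding filterlim_at_top by blast
    ultimately show ?case using elim(2,3)
    proof eventually_elim
      case (elim n)
      have "\<bar>dev H (m n) {1..m n} s\<bar> \<le> \<delta>' * sqrt (m n * ln (m n))"
        using elim(1,2) F_subset[of "m n" s] \<open>s \<in> space M\<close> unfolding E_def dev_event_def by (auto simp: not_less)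
      also have "\<dots> \<le> \<delta>' * sqrt (n * ln n)"
        using d' m_le[of n] elim(3) by (intro mult_left_mono real_sqrt_le_mono mult_mono) auto
      finally have 1: "\<bar>dev H (m n) {1..m n} s\<bar> \<le> \<delta>' * sqrt (n * ln n)" .
      have 2: "\<bar>dev H n {m n<..n} s\<bar> \<le> \<delta>' * sqrt (n * ln n)"
        using elim(4,5) F_subset[of n s] \<open>s \<in> space M\<close> unfolding E_def dev_event_def by (auto simp: not_less)
      have "(\<Sum>i\<in>F n s. h (W i s) - (\<integral>z. h z \<partial>L)) = dev H (m n) {1..m n} s + dev H n {m n<..n} s"
        unfolding dev_eq using fold_split[OF m_le[of n], of s] F_subset[of "m n" s]
        by (subst sum.union_disjoint[symmetric]) (auto simp: fold_idx_def Int_absorb2)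
      then show ?case using 1 2 by (simp add: \<delta>'_def)
    qed
  qed
qed

end

section \<open>The asymmetric squared loss\<close>

text \<open>Half the derivative of \<open>loss\<close> below; in the estimating function it is the
  numerator of the correction for treated units.\<close>

definition score :: "real \<Rightarrow> real \<Rightarrow> real" where
  "score \<Gamma> u = pos_part u - \<Gamma> * neg_part u"

definition loss :: "real \<Rightarrow> real \<Rightarrow> real" where
  "loss \<Gamma> u = (pos_part u)\<^sup>2 + \<Gamma> * (neg_part u)\<^sup>2"

lemma score_eq: "score \<Gamma> u = (if 0 \<le> u then u else \<Gamma> * u)"
  by (auto simp: score_def pos_part_def neg_part_def)

lemma loss_eq: "loss \<Gamma> u = (if 0 \<le> u then u\<^sup>2 else \<Gamma> * u\<^sup>2)"
  by (auto simp: loss_def pos_part_def neg_part_def)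

lemma measurable_score[measurable]: "score \<Gamma> \<in> borel_measurable borel"
  unfolding score_eq[abs_def] by measurable

lemma measurable_loss[measurable]: "loss \<Gamma> \<in> borel_measurable borel"
  unfolding loss_eq[abs_def] by measurable

context
  fixes \<Gamma> :: real
  assumes G: "1 \<le> \<Gamma>"
begin

lemma loss_nonneg: "0 \<le> loss \<Gamma> u"
  using G by (simp add: loss_eq)

lemma loss_ge: "u\<^sup>2 \<le> loss \<Gamma> u"
  using G by (auto simp: loss_eq mult_right_mono[of 1 \<Gamma> "u\<^sup>2", simplified])

lemma loss_le: "loss \<Gamma> u \<le> \<Gamma> * u\<^sup>2"
  using G by (auto simp: loss_eq mult_right_mono[of 1 \<Gamma> "u\<^sup>2", simplified])

text \<open>\<open>loss\<close> has derivative \<open>2 * score\<close>, which is Lipschitz with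
  constant \<open>2 * \<Gamma>\<close>; this is the resulting quadratic majorant, checked on each
  side of the kink.\<close>

lemma loss_shift_le: "loss \<Gamma> (u - d) \<le> loss \<Gamma> u - 2 * d * score \<Gamma> u + \<Gamma> * d\<^sup>2"
proof -
  have d2: "d\<^sup>2 \<le> \<Gamma> * d\<^sup>2" using G mult_right_mono[of 1 \<Gamma> "d\<^sup>2"] by simp
  consider "u \<ge> 0" "u - d \<ge> 0" | "u \<ge> 0" "u - d < 0" | "u < 0" "u - d < 0" | "u < 0" "u - d \<ge> 0" by linarith
  then show ?thesis
  proof cases
    case 1 then show ?thesis using d2 by (simp add: loss_eq score_eq power2_diff)
  next
    case 2
    have "(\<Gamma> - 1) * (u * (2 * d - u)) \<ge> 0" using 2 G by (intro mult_nonneg_nonneg) auto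
    then show ?thesis using 2 by (simp add: loss_eq score_eq power2_eq_square algebra_simps)
  next
    case 3 then show ?thesis by (simp add: loss_eq score_eq power2_eq_square algebra_simps)
  next
    case 4
    have "(u - d)\<^sup>2 \<le> \<Gamma> * (u - d)\<^sup>2" using G mult_right_mono[of 1 \<Gamma> "(u - d)\<^sup>2"] by simp
    then show ?thesis using 4 by (simp add: loss_eq score_eq power2_eq_square algebra_simps)
  qed
qed

lemma abs_score_le: "\<bar>score \<Gamma> u\<bar> \<le> \<Gamma> * \<bar>u\<bar>"
  using G mult_right_mono[of 1 \<Gamma> "\<bar>u\<bar>"] by (auto simp: score_eq abs_mult)

lemma score_lipschitz: "\<bar>score \<Gamma> u - score \<Gamma> v\<bar> \<le> \<Gamma> * \<bar>u - v\<bar>"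
proof -
  have *: "\<bar>score \<Gamma> u - score \<Gamma> v\<bar> \<le> \<Gamma> * \<bar>u - v\<bar>" if "v \<le> u" for u v
  proof -
    have up: "\<Gamma> * u \<ge> u" if "u \<ge> 0" for u using that G mult_right_mono[of 1 \<Gamma> u] by simp
    have dn: "\<Gamma> * v \<le> v" if "v \<le> 0" for v using that G mult_right_mono_neg[of 1 \<Gamma> v] by simp
    have mono: "\<Gamma> * v \<le> \<Gamma> * u" using that G by simp
    have diff: "\<Gamma> * (u - v) \<ge> u - v" using that up[of "u - v"] by simp
    consider "v \<ge> 0" | "v < 0" "u \<ge> 0" | "u < 0" using that by linarith
    then show ?thesis
    proof cases
      case 1 then show ?thesis using that diff by (simp add: score_eq)
    next
      case 2
      have "\<Gamma> * v \<le> v" by (rule dn) (use 2 in simp)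
      moreover have "u \<le> \<Gamma> * u" by (rule up) (use 2 in simp)
      moreover have "score \<Gamma> u - score \<Gamma> v = u - \<Gamma> * v" using 2 by (simp add: score_eq)
      moreover have "\<Gamma> * (u - v) = \<Gamma> * u - \<Gamma> * v" by (rule right_diff_distrib)
      ultimately show ?thesis using that by linarith
    next
      case 3 then show ?thesis using that mono by (simp add: score_eq algebra_simps)
    qed
  qed
  show ?thesis using *[of v u] *[of u v] by (cases "v \<le> u") (auto simp: abs_minus_commute)
qed

text \<open>\<open>score\<close> is piecewise linear with its kink at 0, so the linearisation in
  \<open>g\<close> is exact unless \<open>y\<close> lies between \<open>g\<close> and
  \<open>g'\<close>. Under a bounded density such crossings have probability of order
  \<open>\<bar>g - g'\<bar>\<close>, so an error of order \<open>\<bar>g - g'\<bar>\<close> on them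
  has a quadratic mean.\<close>

lemma score_linearization:
  "\<bar>score \<Gamma> (y - g) - score \<Gamma> (y - g') + (if g' \<le> y then 1 else \<Gamma>) * (g - g')\<bar>
    \<le> (if min g g' \<le> y \<and> y \<le> max g g' then \<Gamma> * \<bar>g - g'\<bar> else 0)"
proof -
  consider "g' \<le> y" "g \<le> y" | "y < g'" "y < g" | "g' \<le> y" "y < g" | "y < g'" "g \<le> y" by linarith
  then show ?thesis
  proof cases
    case 1 then show ?thesis using G by (simp add: score_eq)
  next
    case 2 then show ?thesis using G by (simp add: score_eq algebra_simps)
  next
    case 3
    have "score \<Gamma> (y - g) - score \<Gamma> (y - g') + (g - g') = - ((\<Gamma> - 1) * (g - y))"
      using 3 by (simp add: score_eq algebra_simps)
    then have "\<bar>score \<Gamma> (y - g) - score \<Gamma> (y - g') + (g - g')\<bar> = (\<Gamma> - 1) * (g - y)"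
      using 3 G by (simp add: abs_mult)
    also have "\<dots> \<le> \<Gamma> * (g - g')" using 3 G by (intro mult_mono) auto
    finally show ?thesis using 3 by simp
  next
    case 4
    have "score \<Gamma> (y - g) - score \<Gamma> (y - g') + \<Gamma> * (g - g') = - ((\<Gamma> - 1) * (y - g))"
      using 4 by (simp add: score_eq algebra_simps)
    then have "\<bar>score \<Gamma> (y - g) - score \<Gamma> (y - g') + \<Gamma> * (g - g')\<bar> = (\<Gamma> - 1) * (y - g)"
      using 4 G by (simp add: abs_mult)
    also have "\<dots> \<le> \<Gamma> * (g' - g)" using 4 G by (intro mult_mono) auto
    finally show ?thesis using 4 by simp
  qed
qed

end

section \<open>Population quantities\<close>

locale selection_population = prob_space P for P :: "'p measure" +
  fixes MX :: "'x measure" and Y1 Y :: "'p \<Rightarrow> real" and A :: "'p \<Rightarrow> bool" and X :: "'p \<Rightarrow> 'x"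
    and \<Gamma> q Cq \<epsilon> :: real and g1 e1 \<nu>1 :: "'x \<Rightarrow> real"
  assumes Y1[measurable]: "Y1 \<in> borel_measurable P" and Y[measurable]: "Y \<in> borel_measurable P"
    and A[measurable]: "A \<in> measurable P (count_space UNIV)" and X[measurable]: "X \<in> measurable P MX"
    and Y_eq: "\<And>s. A s \<Longrightarrow> Y s = Y1 s"
    and Gamma: "1 \<le> \<Gamma>"
    and g1: "is_g1 P MX Y A X \<Gamma> g1" and e1: "is_e1 P MX A X e1" and nu1: "is_nu1 P MX Y A X \<Gamma> g1 \<nu>1"
    and q: "q > 2" and moment: "(\<integral>\<^sup>+s. ennreal (\<bar>Y1 s\<bar> powr q) \<partial>P) \<le> ennreal Cq"
    and cond_density: "\<exists>f C. (\<forall>z. f z \<le> ennreal C) \<and>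
           distributed (given_treated P A) (distr (given_treated P A) MX X \<Otimes>\<^sub>M lborel)
             (\<lambda>s. (X s, Y1 s)) f"
    and eps: "\<epsilon> > 0" and overlap: "AE x in distr P MX X. e1 x \<in> {\<epsilon> .. 1 - \<epsilon>}"
begin

abbreviation a :: "'p \<Rightarrow> real" where "a s \<equiv> of_bool (A s)"

abbreviation "Q \<equiv> given_treated P A"

definition pA :: real where "pA = prob {s \<in> space P. A s}"

lemma g1_meas[measurable]: "g1 \<in> borel_measurable MX" using g1 by (simp add: is_g1_def)
lemma e1_meas[measurable]: "e1 \<in> borel_measurable MX" using e1 by (simp add: is_e1_def)
lemma nu1_meas[measurable]: "\<nu>1 \<in> borel_measurable MX" using nu1 by (simp add: is_nu1_def)

lemma a_meas[measurable]: "a \<in> borel_measurable P" by measurable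

lemma subalg_X:
  assumes "space N = space P" "sets N = sets P" shows "subalgebra N (sigma_gen N MX X)"
proof -
  have "X \<in> measurable N MX" using measurable_cong_sets[OF assms(2) refl] X by blast
  then show ?thesis unfolding subalgebra_def sigma_gen_def by (auto simp: measurable_iff_sets)
qed

lemma measurable_sigma_gen:
  assumes "space N = space P" "k \<in> borel_measurable MX"
  shows "(\<lambda>s. k (X s)) \<in> borel_measurable (sigma_gen N MX X)"
  unfolding sigma_gen_def
  by (rule measurable_compose[OF measurable_vimage_algebra1 assms(2)]) (use assms(1) measurable_space[OF X] in auto)

lemma AE_X: "AE x in distr P MX X. R x \<Longrightarrow> AE s in P. R (X s)"
  by (rule AE_distrD[OF X])

lemma overlap': "AE s in P. \<epsilon> \<le> e1 (X s) \<and> e1 (X s) \<le> 1 - \<epsilon>"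
  using AE_X[OF overlap] by simp

lemma e1_integral:
  assumes k: "k \<in> borel_measurable MX" and int: "integrable P (\<lambda>s. k (X s))"
  shows "integrable P (\<lambda>s. a s * k (X s))" "integrable P (\<lambda>s. e1 (X s) * k (X s))"
    "(\<integral>s. a s * k (X s) \<partial>P) = (\<integral>s. e1 (X s) * k (X s) \<partial>P)"
proof -
  let ?G = "sigma_gen P MX X"
  note k[measurable]
  interpret finite_measure_subalgebra P ?G
    by unfold_locales (rule subalg_X; simp)
  have *: "(indicator {s \<in> space P. A s} s :: real) = a s" if "s \<in> space P" for s
    using that by (auto simp: indicator_def)
  show i: "integrable P (\<lambda>s. a s * k (X s))"
    by (rule Bochner_Integration.integrable_bound[OF int]) auto
  have i': "integrable P (\<lambda>s. k (X s) * indicator {s \<in> space P. A s} s)"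
    using i by (subst Bochner_Integration.integrable_cong[OF refl, of P _ "\<lambda>s. a s * k (X s)"]) (auto simp: * mult.commute)
  note r = real_cond_exp_intg[OF i' measurable_sigma_gen[OF refl k]]
  have e: "AE s in P. k (X s) * real_cond_exp P ?G (indicator {s \<in> space P. A s}) s = e1 (X s) * k (X s)"
    using e1 unfolding is_e1_def cond_prob_given_def by (auto simp: mult.commute)
  show "integrable P (\<lambda>s. e1 (X s) * k (X s))"
    using r(1) by (rule integrable_cong_AE_imp) (use e in auto)
  have "(\<integral>s. a s * k (X s) \<partial>P) = (\<integral>s. k (X s) * indicator {s \<in> space P. A s} s \<partial>P)"
    by (intro Bochner_Integration.integral_cong) (auto simp: * mult.commute)
  also have "\<dots> = (\<integral>s. k (X s) * real_cond_exp P ?G (indicator {s \<in> space P. A s}) s \<partial>P)"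
    by (rule r(2)[symmetric]) measurable
  also have "\<dots> = (\<integral>s. e1 (X s) * k (X s) \<partial>P)"
    using e r(1) by (intro integral_cong_AE) auto
  finally show "(\<integral>s. a s * k (X s) \<partial>P) = (\<integral>s. e1 (X s) * k (X s) \<partial>P)" .
qed

lemma pA_pos: "pA > 0"
proof -
  have "pA = (\<integral>s. a s * 1 \<partial>P)"
  proof -
    have "(\<integral>s. a s * 1 \<partial>P) = (\<integral>s. indicator {s \<in> space P. A s} s \<partial>P)"
      by (intro Bochner_Integration.integral_cong) (auto simp: indicator_def)
    also have "\<dots> = pA" unfolding pA_def by simp
    finally show ?thesis ..
  qed
  also have "\<dots> = (\<integral>s. e1 (X s) * 1 \<partial>P)" by (rule e1_integral(3)) auto
  also have "\<dots> \<ge> (\<integral>s. \<epsilon> \<partial>P)"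
  proof (rule integral_mono_AE)
    show "integrable P (\<lambda>s. e1 (X s) * 1)" by (rule e1_integral(2)) auto
    show "AE s in P. \<epsilon> \<le> e1 (X s) * 1" using overlap' by eventually_elim simp
  qed simp
  finally show ?thesis using eps by (simp add: prob_space)
qed

lemma Q_density: "Q = density P (\<lambda>s. ennreal (a s / pA))"
  unfolding given_treated_def uniform_measure_def
  using pA_pos
  by (intro density_cong) (auto simp: indicator_def emeasure_eq_measure pA_def[symmetric] divide_ennreal ennreal_1[symmetric] simp del: ennreal_1)

lemma sets_Q: "sets Q = sets P" and space_Q: "space Q = space P" by (auto simp: Q_density)

lemma measurable_Q: "measurable Q N = measurable P N"
  using sets_Q by (intro measurable_cong_sets) auto

lemma prob_space_Q: "prob_space Q"
  unfolding given_treated_def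
  using pA_pos by (intro prob_space_uniform_measure) (auto simp: emeasure_eq_measure pA_def[symmetric])

sublocale Q: prob_space Q by (rule prob_space_Q)

lemma AE_Q: "(AE s in Q. R s) \<longleftrightarrow> (AE s in P. A s \<longrightarrow> R s)"
  unfolding Q_density using pA_pos by (subst AE_density) auto

lemma nn_integral_Q:
  "f \<in> borel_measurable P \<Longrightarrow> (\<integral>\<^sup>+s. f s \<partial>Q) = (\<integral>\<^sup>+s. ennreal (a s / pA) * f s \<partial>P)"
  unfolding Q_density by (subst nn_integral_density) auto

lemma integral_Q:
  fixes f :: "'p \<Rightarrow> real"
  shows "f \<in> borel_measurable P \<Longrightarrow> (\<integral>s. f s \<partial>Q) = (\<integral>s. a s * f s \<partial>P) / pA"
  unfolding Q_density using pA_pos by (subst integral_density) (auto simp: divide_simps)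

lemma integrable_Q:
  fixes f :: "'p \<Rightarrow> real"
  shows "f \<in> borel_measurable P \<Longrightarrow> integrable Q f \<longleftrightarrow> integrable P (\<lambda>s. a s * f s)"
proof -
  assume f: "f \<in> borel_measurable P"
  have "integrable Q f \<longleftrightarrow> integrable P (\<lambda>s. (1 / pA) * (a s * f s))"
    unfolding Q_density using pA_pos f by (subst integrable_density) auto
  also have "\<dots> \<longleftrightarrow> integrable P (\<lambda>s. a s * f s)"
    using pA_pos by (subst integrable_mult_left_iff) auto
  finally show ?thesis .
qed

text \<open>Since \<open>e1\<close> is bounded away from 0, a covariate event that is null among the
  treated is null in the population. This transfers facts about \<open>\<nu>1\<close>, which is
  determined through the treated only.\<close>

lemma AE_X_of_treated:
  assumes R: "Measurable.pred MX R" and ae: "AE s in P. A s \<longrightarrow> R (X s)"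
  shows "AE s in P. R (X s)"
proof -
  define k :: "'x \<Rightarrow> real" where "k x = (if R x then 0 else 1)" for x
  have k[measurable]: "k \<in> borel_measurable MX" unfolding k_def using R by measurable
  have kX: "(\<lambda>s. k (X s)) \<in> borel_measurable P" by measurable
  have int: "integrable P (\<lambda>s. k (X s))"
    by (rule integrable_const_bound[where B=1, OF _ kX]) (simp add: k_def)
  have "AE s in P. a s * k (X s) = 0" using ae by eventually_elim (auto simp: k_def)
  then have "(\<integral>s. a s * k (X s) \<partial>P) = 0" by (rule integral_eq_zero_AE)
  then have 0: "(\<integral>s. e1 (X s) * k (X s) \<partial>P) = 0" using e1_integral(3)[OF k int] by simp
  have nonneg: "AE s in P. 0 \<le> e1 (X s) * k (X s)"
    using overlap' by eventually_elim (use eps in \<open>auto simp: k_def\<close>)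
  have "AE s in P. e1 (X s) * k (X s) = 0"
    using 0 integral_nonneg_eq_0_iff_AE[OF e1_integral(2)[OF k int] nonneg] by simp
  then show ?thesis using overlap'
    by eventually_elim (use eps in \<open>auto simp: k_def split: if_splits\<close>)
qed

text \<open>Minus the slope of \<open>score \<Gamma> (Y s - g)\<close> in \<open>g\<close> at
  \<open>g1\<close>, with the value 1 chosen at the kink; \<open>\<nu>1\<close> is its conditional
  mean given the covariates among the treated.\<close>

definition V :: "'p \<Rightarrow> real" where "V s = (if g1 (X s) \<le> Y s then 1 else \<Gamma>)"

lemma V_meas[measurable]: "V \<in> borel_measurable P" unfolding V_def by measurable

lemma V_bounds: "1 \<le> V s" "V s \<le> \<Gamma>" using Gamma by (auto simp: V_def)

lemma subalgebra_Q: "finite_measure_subalgebra Q (sigma_gen Q MX X)"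
  by unfold_locales (rule subalg_X; simp add: sets_Q space_Q)

lemma nu1_cond_exp: "AE s in Q. real_cond_exp Q (sigma_gen Q MX X) V s = \<nu>1 (X s)"
proof -
  interpret S: finite_measure_subalgebra Q "sigma_gen Q MX X" by (rule subalgebra_Q)
  have sg: "sigma_gen P MX X = sigma_gen Q MX X" by (simp add: sigma_gen_def space_Q)
  let ?f = "indicator {s \<in> space Q. g1 (X s) \<le> Y s} :: _ \<Rightarrow> real"
  let ?g = "indicator {s \<in> space Q. Y s < g1 (X s)} :: _ \<Rightarrow> real"
  have f: "integrable Q ?f" and g: "integrable Q ?g"
    by (auto simp: space_Q sets_Q Q.emeasure_eq_measure)
  have "AE s in Q. real_cond_exp Q (sigma_gen Q MX X) (\<lambda>s. ?f s + \<Gamma> * ?g s) s =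
     real_cond_exp Q (sigma_gen Q MX X) ?f s + real_cond_exp Q (sigma_gen Q MX X) (\<lambda>s. \<Gamma> * ?g s) s"
    using f g by (intro S.real_cond_exp_add) auto
  moreover have "AE s in Q. real_cond_exp Q (sigma_gen Q MX X) (\<lambda>s. \<Gamma> * ?g s) s = \<Gamma> * real_cond_exp Q (sigma_gen Q MX X) ?g s"
    using g by (rule S.real_cond_exp_cmult)
  moreover have "AE s in Q. real_cond_exp Q (sigma_gen Q MX X) V s = real_cond_exp Q (sigma_gen Q MX X) (\<lambda>s. ?f s + \<Gamma> * ?g s) s"
    by (intro S.real_cond_exp_cong AE_I2) (auto simp: V_def indicator_def measurable_Q space_Q)
  moreover have "AE s in Q. \<nu>1 (X s) = real_cond_exp Q (sigma_gen P MX X) ?f s + \<Gamma> * real_cond_exp Q (sigma_gen P MX X) ?g s"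
    using nu1 unfolding is_nu1_def cond_prob_given_def by auto
  ultimately show ?thesis unfolding sg by eventually_elim simp
qed

text \<open>As a conditional mean of \<open>V\<close>, the function \<open>\<nu>1\<close> inherits
  its range. The lower bound 1 keeps the denominator of the true estimating function away from
  0.\<close>

lemma nu1_bounds: "AE s in P. 1 \<le> \<nu>1 (X s) \<and> \<nu>1 (X s) \<le> \<Gamma>"
proof (rule AE_X_of_treated)
  interpret S: finite_measure_subalgebra Q "sigma_gen Q MX X" by (rule subalgebra_Q)
  have V: "integrable Q V"
    by (rule Q.integrable_const_bound[where B=\<Gamma>]) (use V_bounds order_trans[OF zero_le_one V_bounds(1)] in \<open>auto simp: measurable_Q\<close>)
  have "AE s in Q. 1 \<le> \<nu>1 (X s) \<and> \<nu>1 (X s) \<le> \<Gamma>"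
    using nu1_cond_exp S.real_cond_exp_ge_c[OF V AE_I2[OF V_bounds(1)]] S.real_cond_exp_le_c[OF V AE_I2[OF V_bounds(2)]]
    by eventually_elim simp
  then show "AE s in P. A s \<longrightarrow> 1 \<le> \<nu>1 (X s) \<and> \<nu>1 (X s) \<le> \<Gamma>"
    unfolding AE_Q .
qed measurable

lemma nu1_integral:
  assumes k[measurable]: "k \<in> borel_measurable MX" and b: "AE s in P. \<bar>k (X s)\<bar> \<le> B"
  shows "(\<integral>s. a s * (V s * k (X s)) \<partial>P) = (\<integral>s. a s * (\<nu>1 (X s) * k (X s)) \<partial>P)"
proof -
  interpret S: finite_measure_subalgebra Q "sigma_gen Q MX X" by (rule subalgebra_Q)
  have bQ: "AE s in Q. \<bar>k (X s)\<bar> \<le> B" unfolding AE_Q using b by eventually_elim auto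
  have kV: "integrable Q (\<lambda>s. k (X s) * V s)"
  proof (rule Q.integrable_const_bound[where B="B * \<Gamma>"])
    show "AE s in Q. norm (k (X s) * V s) \<le> B * \<Gamma>"
      using bQ
    proof eventually_elim
      case (elim s)
      have "\<bar>k (X s)\<bar> * \<bar>V s\<bar> \<le> B * \<Gamma>" using elim V_bounds[of s] by (intro mult_mono) auto
      then show ?case by (simp add: abs_mult)
    qed
  qed (simp add: measurable_Q)
  note r = S.real_cond_exp_intg[OF kV measurable_sigma_gen[OF space_Q k]]
  have "(\<integral>s. k (X s) * V s \<partial>Q) = (\<integral>s. k (X s) * real_cond_exp Q (sigma_gen Q MX X) V s \<partial>Q)"
    by (rule r(2)[symmetric]) (simp add: measurable_Q)
  also have "\<dots> = (\<integral>s. k (X s) * \<nu>1 (X s) \<partial>Q)"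
    using nu1_cond_exp r(1) V_meas
    by (intro integral_cong_AE) (auto simp: measurable_Q)
  finally have "(\<integral>s. a s * (k (X s) * V s) \<partial>P) = (\<integral>s. a s * (k (X s) * \<nu>1 (X s)) \<partial>P)"
    using pA_pos by (simp add: integral_Q)
  then show ?thesis by (simp add: mult.commute)
qed

section \<open>Moments of the outcome, first-order condition and moments of
  \<open>g1\<close>\<close>

lemma powr_Y_integrable: "integrable P (\<lambda>s. a s * \<bar>Y s\<bar> powr q)"
proof -
  have "integrable P (\<lambda>s. \<bar>Y1 s\<bar> powr q)"
    using moment by (intro integrableI_bounded) (auto simp: top.extremum_strict intro: le_less_trans)
  then show ?thesis
    by (rule Bochner_Integration.integrable_bound) (auto simp: Y_eq)
qed

lemma sq_Y_integrable: "integrable P (\<lambda>s. a s * (Y s)\<^sup>2)"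
proof (rule Bochner_Integration.integrable_bound)
  show "integrable P (\<lambda>s. 1 + a s * \<bar>Y s\<bar> powr q)" using powr_Y_integrable by simp
  have "y\<^sup>2 \<le> 1 + \<bar>y\<bar> powr q" for y :: real
  proof (cases "\<bar>y\<bar> \<le> 1")
    case True then show ?thesis by (simp add: abs_square_le_1 add_increasing2)
  next
    case False
    have "y\<^sup>2 = \<bar>y\<bar> powr 2" using False by simp
    also have "\<dots> \<le> \<bar>y\<bar> powr q" using False q by (intro powr_mono) auto
    finally show ?thesis by simp
  qed
  then show "AE s in P. norm (a s * (Y s)\<^sup>2) \<le> norm (1 + a s * \<bar>Y s\<bar> powr q)"
    by (intro AE_I2) (auto simp: of_bool_def)
qed measurable

lemma risk_eq:
  assumes [measurable]: "g \<in> borel_measurable MX"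
  shows "g_risk P Y A X \<Gamma> g = (\<integral>\<^sup>+s. ennreal (a s * loss \<Gamma> (Y s - g (X s)) / pA) \<partial>P)"
proof -
  have "g_risk P Y A X \<Gamma> g = (\<integral>\<^sup>+s. ennreal (loss \<Gamma> (Y s - g (X s))) \<partial>Q)"
    by (simp add: g_risk_def loss_def)
  also have "\<dots> = (\<integral>\<^sup>+s. ennreal (a s / pA) * ennreal (loss \<Gamma> (Y s - g (X s))) \<partial>P)"
    by (rule nn_integral_Q) measurable
  also have "\<dots> = (\<integral>\<^sup>+s. ennreal (a s * loss \<Gamma> (Y s - g (X s)) / pA) \<partial>P)"
    using pA_pos loss_nonneg[OF Gamma] by (intro nn_integral_cong) (simp add: ennreal_mult[symmetric])
  finally show ?thesis .
qed

lemma risk_minimal: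
  assumes "g \<in> borel_measurable MX"
  shows "(\<integral>\<^sup>+s. ennreal (a s * loss \<Gamma> (Y s - g1 (X s)) / pA) \<partial>P)
    \<le> (\<integral>\<^sup>+s. ennreal (a s * loss \<Gamma> (Y s - g (X s)) / pA) \<partial>P)"
proof -
  have "g_risk P Y A X \<Gamma> g1 \<le> g_risk P Y A X \<Gamma> g" using g1 assms unfolding is_g1_def by blast
  then show ?thesis using assms by (simp only: risk_eq g1_meas)
qed

abbreviation res :: "'p \<Rightarrow> real" where "res s \<equiv> Y s - g1 (X s)"

text \<open>No moment of \<open>g1\<close> is available yet: its risk is finite because it is at
  most the risk of the zero function, which the second moment of the treated outcome
  controls.\<close>

lemma loss_integrable: "integrable P (\<lambda>s. a s * loss \<Gamma> (res s))"
proof -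
  have "(\<integral>\<^sup>+s. ennreal (a s * loss \<Gamma> (res s) / pA) \<partial>P) \<le> (\<integral>\<^sup>+s. ennreal (a s * loss \<Gamma> (Y s - 0) / pA) \<partial>P)"
    by (rule risk_minimal[of "\<lambda>_. 0"]) simp
  also have "\<dots> \<le> (\<integral>\<^sup>+s. ennreal (\<Gamma> / pA * (a s * (Y s)\<^sup>2)) \<partial>P)"
    using pA_pos loss_le[OF Gamma] by (intro nn_integral_mono ennreal_leI) (auto simp: divide_right_mono)
  also have "\<dots> < \<infinity>"
    using sq_Y_integrable by (subst nn_integral_eq_integral) (use pA_pos Gamma in auto)
  finally have "integrable P (\<lambda>s. a s * loss \<Gamma> (res s) / pA)"
    using pA_pos loss_nonneg[OF Gamma] by (intro integrableI_bounded) auto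
  then have "integrable P (\<lambda>s. pA * (a s * loss \<Gamma> (res s) / pA))" by (rule integrable_mult_right)
  then show ?thesis using pA_pos by simp
qed

lemma res_integrable: "integrable P (\<lambda>s. a s * \<bar>res s\<bar>)"
proof (rule Bochner_Integration.integrable_bound)
  show "integrable P (\<lambda>s. 1 + a s * loss \<Gamma> (res s))" using loss_integrable by simp
  have *: "\<bar>u\<bar> \<le> 1 + loss \<Gamma> u" for u
  proof -
    have "0 \<le> (\<bar>u\<bar> - 1)\<^sup>2" by simp
    then have "\<bar>u\<bar> * 2 \<le> 1 + u\<^sup>2" by (simp add: power2_diff)
    then show ?thesis using loss_ge[OF Gamma, of u] by simp
  qed
  then show "AE s in P. norm (a s * \<bar>res s\<bar>) \<le> norm (1 + a s * loss \<Gamma> (res s))"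
    using loss_nonneg[OF Gamma] by (intro AE_I2) (auto simp: of_bool_def)
qed measurable

lemma score_integrable:
  assumes h[measurable]: "h \<in> borel_measurable MX" and b: "AE s in P. \<bar>h (X s)\<bar> \<le> B"
  shows "integrable P (\<lambda>s. a s * score \<Gamma> (res s) * h (X s))"
proof (rule Bochner_Integration.integrable_bound)
  show "integrable P (\<lambda>s. \<Gamma> * B * (a s * \<bar>res s\<bar>))" using res_integrable by simp
  show "AE s in P. norm (a s * score \<Gamma> (res s) * h (X s)) \<le> norm (\<Gamma> * B * (a s * \<bar>res s\<bar>))"
    using b
  proof eventually_elim
    case (elim s)
    have "\<bar>score \<Gamma> (res s)\<bar> * \<bar>h (X s)\<bar> \<le> (\<Gamma> * \<bar>res s\<bar>) * \<bar>B\<bar>"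
      using elim abs_score_le[OF Gamma] Gamma by (intro mult_mono) auto
    then show ?case using Gamma by (simp add: abs_mult mult_ac mult_left_mono)
  qed
qed measurable

text \<open>First-order condition: perturb the minimiser \<open>g1\<close> in the direction \<open>h\<close>.\<close>
lemma score_orthogonal:
  assumes h[measurable]: "h \<in> borel_measurable MX" and b: "AE s in P. \<bar>h (X s)\<bar> \<le> B"
  shows "(\<integral>s. a s * score \<Gamma> (res s) * h (X s) \<partial>P) = 0"
proof -
  define J where "J = (\<integral>s. a s * score \<Gamma> (res s) * h (X s) \<partial>P)"
  have int: "integrable P (\<lambda>s. a s * score \<Gamma> (res s) * h (X s))" by (rule score_integrable[OF h b])
  \<comment> \<open>Comparing the risk of \<open>g1\<close> with that of \<open>g1 + t * h\<close>
    gives this for every real \<open>t\<close>. The left side is linear and the right side quadratic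
    in \<open>t\<close>, which forces \<open>J = 0\<close>.\<close>
  have key: "2 * t * J \<le> \<Gamma> * B\<^sup>2 * t\<^sup>2" for t
  proof -
    let ?r = "\<lambda>s. a s * loss \<Gamma> (res s) - 2 * t * (a s * score \<Gamma> (res s) * h (X s)) + \<Gamma> * B\<^sup>2 * t\<^sup>2"
    have ir: "integrable P ?r" using int loss_integrable by simp
    have le: "AE s in P. a s * loss \<Gamma> (Y s - (g1 (X s) + t * h (X s))) \<le> ?r s"
      using b
    proof eventually_elim
      case (elim s)
      have "\<bar>h (X s)\<bar>\<^sup>2 \<le> B\<^sup>2" using elim by (intro power_mono) auto
      then have "\<Gamma> * t\<^sup>2 * (h (X s))\<^sup>2 \<le> \<Gamma> * t\<^sup>2 * B\<^sup>2" using Gamma by (intro mult_left_mono) auto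
      moreover have "0 \<le> \<Gamma> * t\<^sup>2 * B\<^sup>2" using Gamma by simp
      ultimately show ?case
        using loss_shift_le[OF Gamma, of "res s" "t * h (X s)"]
        by (auto simp: of_bool_def algebra_simps power_mult_distrib)
    qed
    have nonneg: "AE s in P. 0 \<le> ?r s / pA"
      using le
    proof eventually_elim
      case (elim s)
      have "0 \<le> a s * loss \<Gamma> (Y s - (g1 (X s) + t * h (X s)))" using loss_nonneg[OF Gamma] by simp
      then have "0 \<le> ?r s" using elim by (rule order_trans)
      then show ?case using pA_pos by simp
    qed
    have "(\<integral>\<^sup>+s. ennreal (a s * loss \<Gamma> (res s) / pA) \<partial>P)
        \<le> (\<integral>\<^sup>+s. ennreal (a s * loss \<Gamma> (Y s - (g1 (X s) + t * h (X s))) / pA) \<partial>P)"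
      by (rule risk_minimal[of "\<lambda>x. g1 x + t * h x"]) measurable
    also have "\<dots> \<le> (\<integral>\<^sup>+s. ennreal (?r s / pA) \<partial>P)"
    proof (intro nn_integral_mono_AE)
      show "AE s in P. ennreal (a s * loss \<Gamma> (Y s - (g1 (X s) + t * h (X s))) / pA) \<le> ennreal (?r s / pA)"
        using le by eventually_elim (use pA_pos in \<open>auto intro!: ennreal_leI divide_right_mono\<close>)
    qed
    also have "\<dots> = ennreal (\<integral>s. ?r s / pA \<partial>P)"
    proof (rule nn_integral_eq_integral)
      show "AE s in P. 0 \<le> ?r s / pA" by (rule nonneg)
    qed (use ir in simp)
    also have "(\<integral>\<^sup>+s. ennreal (a s * loss \<Gamma> (res s) / pA) \<partial>P) = ennreal (\<integral>s. a s * loss \<Gamma> (res s) / pA \<partial>P)"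
      using loss_integrable pA_pos loss_nonneg[OF Gamma] by (intro nn_integral_eq_integral) auto
    finally have "ennreal (\<integral>s. a s * loss \<Gamma> (res s) / pA \<partial>P) \<le> ennreal (\<integral>s. ?r s / pA \<partial>P)" .
    moreover have "0 \<le> (\<integral>s. ?r s / pA \<partial>P)"
      by (rule integral_nonneg_AE[OF nonneg])
    ultimately have "(\<integral>s. a s * loss \<Gamma> (res s) / pA \<partial>P) \<le> (\<integral>s. ?r s / pA \<partial>P)" by simp
    then have "(\<integral>s. a s * loss \<Gamma> (res s) \<partial>P) \<le> (\<integral>s. ?r s \<partial>P)"
      using pA_pos by (simp add: divide_le_cancel)
    also have "\<dots> = (\<integral>s. a s * loss \<Gamma> (res s) \<partial>P) - 2 * t * J + \<Gamma> * B\<^sup>2 * t\<^sup>2"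
      using int loss_integrable by (simp add: J_def prob_space)
    finally show ?thesis by simp
  qed
  \<comment> \<open>The inequality is used at \<open>t = J / (k + 1)\<close>; the 1 avoids a
    division by 0 when \<open>B = 0\<close>.\<close>
  define k where "k = \<Gamma> * B\<^sup>2"
  have k: "k \<ge> 0" using Gamma by (simp add: k_def)
  have "2 * (J / (k + 1)) * J \<le> k * (J / (k + 1))\<^sup>2" using key[of "J / (k + 1)"] by (simp add: k_def)
  then have "(2 * (J / (k + 1)) * J) * (k + 1)\<^sup>2 \<le> (k * (J / (k + 1))\<^sup>2) * (k + 1)\<^sup>2"
    by (rule mult_right_mono) simp
  then have "2 * J\<^sup>2 * (k + 1) \<le> k * J\<^sup>2"
    using k by (simp add: power_divide power2_eq_square)
  then have "J\<^sup>2 * (k + 2) \<le> 0" by (simp add: algebra_simps)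
  then have "J\<^sup>2 \<le> 0" using k by (simp add: mult_le_0_iff)
  then show ?thesis by (simp add: J_def)
qed

text \<open>The first-order condition is tested with \<open>sgn g1 * \<bar>g1\<bar> powr (q - 1)\<close>, truncated to be bounded.\<close>
lemma powr_g1_truncated_le:
  fixes R :: real
  assumes R: "R \<ge> 0"
  shows "(\<integral>s. (if \<bar>g1 (X s)\<bar> \<le> R then \<bar>g1 (X s)\<bar> powr q else 0) \<partial>P)
    \<le> 2 * \<Gamma> * (2 * \<Gamma>) powr (q - 1) * (\<integral>s. a s * \<bar>Y s\<bar> powr q \<partial>P) / \<epsilon>"
proof -
  define h where "h x = (if \<bar>g1 x\<bar> \<le> R then sgn (g1 x) * \<bar>g1 x\<bar> powr (q - 1) else 0)" for x
  define k where "k x = (if \<bar>g1 x\<bar> \<le> R then \<bar>g1 x\<bar> powr q else 0)" for x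
  define c where "c = \<Gamma> * (2 * \<Gamma>) powr (q - 1)"
  have h[measurable]: "h \<in> borel_measurable MX" unfolding h_def by measurable
  have k[measurable]: "k \<in> borel_measurable MX" unfolding k_def by measurable
  have hb: "\<bar>h x\<bar> \<le> R powr (q - 1)" for x
    using q by (auto simp: h_def abs_mult sgn_if intro!: powr_mono2)
  have kb: "\<bar>k x\<bar> \<le> R powr q" for x using q by (auto simp: k_def intro!: powr_mono2)
  have intk: "integrable P (\<lambda>s. k (X s))"
    by (rule integrable_const_bound[where B="R powr q"]) (use kb in auto)
  have pt: "score \<Gamma> (y - g1 x) * h x \<le> c * \<bar>y\<bar> powr q - k x / 2" for y x
  proof (cases "\<bar>g1 x\<bar> \<le> R")
    case False
    then show ?thesis using Gamma by (simp add: h_def k_def c_def)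
  next
    case True
    define g where "g = g1 x"
    have hk: "g * h x = k x"
    proof -
      have "g * sgn g = \<bar>g\<bar>" by (simp add: abs_sgn)
      moreover have "\<bar>g\<bar> * \<bar>g\<bar> powr (q - 1) = \<bar>g\<bar> powr q"
        by (cases "g = 0") (auto simp: powr_diff)
      ultimately show ?thesis using True by (simp add: h_def k_def g_def mult.assoc[symmetric])
    qed
    have absh: "\<bar>h x\<bar> = \<bar>g\<bar> powr (q - 1)" using True by (auto simp: h_def g_def abs_mult sgn_if)
    obtain v where v: "1 \<le> v" "v \<le> \<Gamma>" "score \<Gamma> (y - g) = v * (y - g)"
      using Gamma by (cases "0 \<le> y - g") (auto simp: score_eq intro: that[of 1] that[of \<Gamma>])
    have k0: "0 \<le> k x" by (simp add: k_def)
    have "score \<Gamma> (y - g) * h x = v * (y * h x) - v * k x"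
      using hk by (simp add: v algebra_simps)
    also have "\<dots> \<le> \<Gamma> * (\<bar>y\<bar> * \<bar>h x\<bar>) - k x"
    proof -
      have "v * (y * h x) \<le> v * (\<bar>y\<bar> * \<bar>h x\<bar>)" using v by (intro mult_left_mono) (auto simp: abs_mult[symmetric])
      also have "\<dots> \<le> \<Gamma> * (\<bar>y\<bar> * \<bar>h x\<bar>)" using v by (intro mult_right_mono) auto
      finally show ?thesis using v k0 mult_right_mono[of 1 v "k x"] by simp
    qed
    \<comment> \<open>If \<open>\<bar>g\<bar> \<le> 2 * \<Gamma> * \<bar>y\<bar>\<close>, the cross
      term is bounded by the outcome alone, which fixes \<open>c\<close>; otherwise half of
      \<open>k x\<close> absorbs it.\<close>
    also have "\<dots> \<le> c * \<bar>y\<bar> powr q - k x / 2"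
    proof (cases "\<bar>g\<bar> \<le> 2 * \<Gamma> * \<bar>y\<bar>")
      case True
      have "\<bar>h x\<bar> \<le> (2 * \<Gamma> * \<bar>y\<bar>) powr (q - 1)" unfolding absh using True q by (intro powr_mono2) auto
      then have "\<Gamma> * (\<bar>y\<bar> * \<bar>h x\<bar>) \<le> \<Gamma> * (\<bar>y\<bar> * (2 * \<Gamma> * \<bar>y\<bar>) powr (q - 1))"
        using Gamma by (intro mult_left_mono) auto
      also have "\<dots> = c * \<bar>y\<bar> powr q"
        using Gamma by (cases "y = 0") (auto simp: c_def powr_mult powr_diff)
      finally show ?thesis using k0 by simp
    next
      case False
      have "k x = \<bar>g\<bar> * \<bar>h x\<bar>" using hk k0 by (simp add: abs_mult[symmetric])
      moreover have "2 * (\<Gamma> * (\<bar>y\<bar> * \<bar>h x\<bar>)) \<le> \<bar>g\<bar> * \<bar>h x\<bar>"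
        using False mult_right_mono[of "2 * \<Gamma> * \<bar>y\<bar>" "\<bar>g\<bar>" "\<bar>h x\<bar>"] by (simp add: mult_ac)
      moreover have "0 \<le> c * \<bar>y\<bar> powr q" using Gamma by (simp add: c_def)
      ultimately show ?thesis by simp
    qed
    finally show ?thesis by (simp add: g_def)
  qed
  have "0 = (\<integral>s. a s * score \<Gamma> (res s) * h (X s) \<partial>P)"
    using score_orthogonal[OF h, of "R powr (q - 1)"] hb by simp
  also have "\<dots> \<le> (\<integral>s. c * (a s * \<bar>Y s\<bar> powr q) - (1 / 2) * (a s * k (X s)) \<partial>P)"
  proof (rule integral_mono)
    show "integrable P (\<lambda>s. a s * score \<Gamma> (res s) * h (X s))"
      using hb by (intro score_integrable[OF h, of "R powr (q - 1)"]) auto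
    show "integrable P (\<lambda>s. c * (a s * \<bar>Y s\<bar> powr q) - (1 / 2) * (a s * k (X s)))"
      using powr_Y_integrable e1_integral(1)[OF k intk] by (intro Bochner_Integration.integrable_diff integrable_mult_right)
    show "a s * score \<Gamma> (res s) * h (X s) \<le> c * (a s * \<bar>Y s\<bar> powr q) - (1 / 2) * (a s * k (X s))" for s
      using pt[of "Y s" "X s"] by (simp add: of_bool_def)
  qed
  also have "\<dots> = c * (\<integral>s. a s * \<bar>Y s\<bar> powr q \<partial>P) - (1 / 2) * (\<integral>s. a s * k (X s) \<partial>P)"
    using powr_Y_integrable e1_integral(1)[OF k intk]
    by (subst Bochner_Integration.integral_diff) (auto intro!: integrable_mult_right simp del: integrable_mult_right_iff integrable_mult_left_iff)
  finally have "(\<integral>s. e1 (X s) * k (X s) \<partial>P) \<le> 2 * c * (\<integral>s. a s * \<bar>Y s\<bar> powr q \<partial>P)"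
    using e1_integral(3)[OF k intk] by simp
  moreover have "\<epsilon> * (\<integral>s. k (X s) \<partial>P) \<le> (\<integral>s. e1 (X s) * k (X s) \<partial>P)"
  proof -
    have "(\<integral>s. \<epsilon> * k (X s) \<partial>P) \<le> (\<integral>s. e1 (X s) * k (X s) \<partial>P)"
    proof (rule integral_mono_AE)
      show "AE s in P. \<epsilon> * k (X s) \<le> e1 (X s) * k (X s)"
        using overlap' by eventually_elim (auto intro!: mult_right_mono simp: k_def)
    qed (use intk e1_integral(2)[OF k intk] in auto)
    then show ?thesis by simp
  qed
  ultimately have "(\<integral>s. k (X s) \<partial>P) * \<epsilon> \<le> 2 * c * (\<integral>s. a s * \<bar>Y s\<bar> powr q \<partial>P)"
    by (simp add: mult.commute)
  then have "(\<integral>s. k (X s) \<partial>P) \<le> 2 * c * (\<integral>s. a s * \<bar>Y s\<bar> powr q \<partial>P) / \<epsilon>"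
    using eps by (simp add: pos_le_divide_eq)
  then show ?thesis by (simp add: k_def c_def mult.assoc)
qed

text \<open>The bound of \<open>powr_g1_truncated_le\<close> is uniform in the truncation level, so
  Fatou's lemma applies. The moment assumption concerns the outcome only, but the envelope contains
  \<open>g1\<close>, so \<open>g1\<close> must be shown to inherit the moment.\<close>

lemma powr_g1_integrable: "integrable P (\<lambda>s. \<bar>g1 (X s)\<bar> powr q)"
proof (rule integrableI_bounded)
  define K where "K = 2 * \<Gamma> * (2 * \<Gamma>) powr (q - 1) * (\<integral>s. a s * \<bar>Y s\<bar> powr q \<partial>P) / \<epsilon>"
  define u where "u n s = (if \<bar>g1 (X s)\<bar> \<le> real n then \<bar>g1 (X s)\<bar> powr q else 0)" for n :: nat and s
  have u[measurable]: "u n \<in> borel_measurable P" for n unfolding u_def by measurable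
  have le: "(\<integral>\<^sup>+s. ennreal (u n s) \<partial>P) \<le> ennreal K" for n
  proof -
    have int: "integrable P (u n)"
      by (rule integrable_const_bound[where B="real n powr q"]) (use q in \<open>auto simp: u_def intro!: AE_I2 powr_mono2\<close>)
    have "(\<integral>\<^sup>+s. ennreal (u n s) \<partial>P) = ennreal (\<integral>s. u n s \<partial>P)"
      by (rule nn_integral_eq_integral[OF int]) (simp add: u_def)
    also have "\<dots> \<le> ennreal K" unfolding u_def K_def by (intro ennreal_leI powr_g1_truncated_le) simp
    finally show ?thesis .
  qed
  have "(\<integral>\<^sup>+s. ennreal (norm (\<bar>g1 (X s)\<bar> powr q)) \<partial>P) = (\<integral>\<^sup>+s. liminf (\<lambda>n. ennreal (u n s)) \<partial>P)"
  proof (intro nn_integral_cong)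
    fix s
    have "\<forall>\<^sub>F n in sequentially. u n s = \<bar>g1 (X s)\<bar> powr q"
      using eventually_ge_at_top[of "nat \<lceil>\<bar>g1 (X s)\<bar>\<rceil>"]
    proof eventually_elim
      case (elim n)
      then have "\<bar>g1 (X s)\<bar> \<le> real n" by linarith
      then show ?case by (simp add: u_def)
    qed
    then have "\<forall>\<^sub>F n in sequentially. ennreal (u n s) = ennreal (\<bar>g1 (X s)\<bar> powr q)" by eventually_elim simp
    then have "((\<lambda>n. ennreal (u n s)) \<longlongrightarrow> ennreal (\<bar>g1 (X s)\<bar> powr q)) sequentially"
      by (rule tendsto_eventually)
    then show "ennreal (norm (\<bar>g1 (X s)\<bar> powr q)) = liminf (\<lambda>n. ennreal (u n s))"
      by (simp add: lim_imp_Liminf)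
  qed
  also have "\<dots> \<le> liminf (\<lambda>n. \<integral>\<^sup>+s. ennreal (u n s) \<partial>P)" by (rule nn_integral_liminf) simp
  also have "\<dots> \<le> ennreal K" using le by (intro Liminf_le) (auto intro!: always_eventually)
  finally show "(\<integral>\<^sup>+s. ennreal (norm (\<bar>g1 (X s)\<bar> powr q)) \<partial>P) < \<infinity>" by (simp add: le_less_trans)
qed measurable

text \<open>The outcome counts for treated units only: there alone does it enter the estimating
  function, and there alone is it \<open>Y1\<close>, whose moment is bounded.\<close>

definition D :: "'x obs \<Rightarrow> real" where
  "D z = (case z of (y, t, x) \<Rightarrow> 1 + of_bool t * \<bar>y\<bar> + \<bar>g1 x\<bar>)"

lemma D_ge_1: "D z \<ge> 1" by (simp add: D_def split: prod.split)

lemma D_meas: "D \<in> borel_measurable (obs_space MX)"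
  unfolding D_def obs_space_def by measurable

lemma D_powr_integrable: "integrable P (\<lambda>s. D (Y s, A s, X s) powr q)"
proof (rule Bochner_Integration.integrable_bound)
  show "integrable P (\<lambda>s. 3 powr q * (1 + a s * \<bar>Y s\<bar> powr q + \<bar>g1 (X s)\<bar> powr q))"
    using powr_Y_integrable powr_g1_integrable by simp
  show "AE s in P. norm (D (Y s, A s, X s) powr q) \<le> norm (3 powr q * (1 + a s * \<bar>Y s\<bar> powr q + \<bar>g1 (X s)\<bar> powr q))"
  proof (rule AE_I2)
    fix s
    define u where "u = a s * \<bar>Y s\<bar>"
    define v where "v = \<bar>g1 (X s)\<bar>"
    define m where "m = max 1 (max u v)"
    have uv: "0 \<le> u" "0 \<le> v" by (auto simp: u_def v_def)
    have "(1 + u + v) powr q \<le> (3 * m) powr q" using uv q by (intro powr_mono2) (auto simp: m_def)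
    also have "\<dots> = 3 powr q * m powr q" by (rule powr_mult)
    also have "m powr q \<le> 1 + u powr q + v powr q" by (auto simp: m_def max_def)
    also have "u powr q = a s * \<bar>Y s\<bar> powr q" by (simp add: u_def of_bool_def)
    finally show "norm (D (Y s, A s, X s) powr q) \<le> norm (3 powr q * (1 + a s * \<bar>Y s\<bar> powr q + \<bar>g1 (X s)\<bar> powr q))"
      by (simp add: D_def u_def v_def)
  qed
next
  have "(\<lambda>s. D (Y s, A s, X s)) \<in> borel_measurable P" unfolding D_def by measurable
  then show "(\<lambda>s. D (Y s, A s, X s) powr q) \<in> borel_measurable P" by measurable
qed

end

section \<open>Orthogonality of the estimating function\<close>

definition weight :: "real \<Rightarrow> real \<Rightarrow> real" where "weight e \<nu> = (1 - e) / (e * \<nu>)"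

lemma weight_bounds:
  assumes "0 < \<epsilon>" "\<epsilon> \<le> e" "e \<le> 1" "0 < c" "c \<le> \<nu>"
  shows "0 \<le> weight e \<nu>" "weight e \<nu> \<le> 1 / (\<epsilon> * c)"
  using assms unfolding weight_def by (auto intro!: divide_nonneg_nonneg frac_le mult_mono)

lemma weight_diff:
  assumes eps: "0 < \<epsilon>" and e: "\<epsilon> \<le> e" "e \<le> 1" "\<epsilon> \<le> e'" "e' \<le> 1" and c: "0 < c" "c \<le> \<nu>" "1 \<le> \<nu>'"
  shows "\<bar>weight e \<nu> - weight e' \<nu>'\<bar> \<le> \<bar>\<nu> - \<nu>'\<bar> / (\<epsilon> * c) + \<bar>e - e'\<bar> / \<epsilon>\<^sup>2"
proof -
  have pos: "0 < e" "0 < e'" "0 < \<nu>" "0 < \<nu>'" using assms by auto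
  \<comment> \<open>The two arguments are changed one at a time: first \<open>\<nu>\<close> with
    \<open>e\<close> fixed, then \<open>e\<close>, where the difference of
    \<open>(1 - e) / e\<close> and \<open>(1 - e') / e'\<close> is
    \<open>(e' - e) / (e * e')\<close>.\<close>
  have "weight e \<nu> - weight e' \<nu>' = ((1 - e) / e) * ((\<nu>' - \<nu>) / (\<nu> * \<nu>')) + (1 / \<nu>') * ((e' - e) / (e * e'))"
    using pos by (simp add: weight_def divide_simps) (simp add: algebra_simps)
  also have "\<bar>\<dots>\<bar> \<le> \<bar>((1 - e) / e) * ((\<nu>' - \<nu>) / (\<nu> * \<nu>'))\<bar> + \<bar>(1 / \<nu>') * ((e' - e) / (e * e'))\<bar>"
    by (rule abs_triangle_ineq)
  also have "\<bar>((1 - e) / e) * ((\<nu>' - \<nu>) / (\<nu> * \<nu>'))\<bar> \<le> (1 / \<epsilon>) * (\<bar>\<nu> - \<nu>'\<bar> / (c * 1))"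
    unfolding abs_mult abs_divide using pos assms
    by (intro mult_mono frac_le) (auto intro!: mult_mono simp: abs_minus_commute)
  also have "\<bar>(1 / \<nu>') * ((e' - e) / (e * e'))\<bar> \<le> (1 / 1) * (\<bar>e - e'\<bar> / (\<epsilon> * \<epsilon>))"
    unfolding abs_mult abs_divide using pos assms
    by (intro mult_mono frac_le) (auto intro!: mult_mono simp: abs_minus_commute)
  finally show ?thesis by (simp add: power2_eq_square)
qed

lemma measurable_triple:
  fixes f :: "'a \<Rightarrow> real \<times> real \<times> real"
  assumes "f \<in> borel_measurable N"
  shows "(\<lambda>x. fst (f x)) \<in> borel_measurable N" "(\<lambda>x. fst (snd (f x))) \<in> borel_measurable N"
    "(\<lambda>x. snd (snd (f x))) \<in> borel_measurable N"
proof -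
  have "f \<in> measurable N (borel \<Otimes>\<^sub>M (borel \<Otimes>\<^sub>M borel))" using assms by (simp add: borel_prod)
  then show "(\<lambda>x. fst (f x)) \<in> borel_measurable N" "(\<lambda>x. fst (snd (f x))) \<in> borel_measurable N"
    "(\<lambda>x. snd (snd (f x))) \<in> borel_measurable N"
    by (auto intro: measurable_compose[OF _ measurable_fst] measurable_compose[OF _ measurable_snd])
qed

lemma psi_eq:
  assumes "\<eta> x = (g, e, \<nu>)"
  shows "psi \<Gamma> (y, t, x) \<mu> \<eta> = of_bool t * y + (1 - of_bool t) * g + of_bool t * (score \<Gamma> (y - g) * weight e \<nu>) - \<mu>"
  using assms by (simp add: psi_def score_def weight_def)

lemma norm_triple_ge:
  fixes g e \<nu> g' e' \<nu>' :: real
  shows "\<bar>g - g'\<bar> \<le> norm ((g, e, \<nu>) - (g', e', \<nu>'))" "\<bar>e - e'\<bar> \<le> norm ((g, e, \<nu>) - (g', e', \<nu>'))"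
    "\<bar>\<nu> - \<nu>'\<bar> \<le> norm ((g, e, \<nu>) - (g', e', \<nu>'))"
  using norm_fst_le[of "g - g'" "(e - e', \<nu> - \<nu>')"] norm_snd_le[of "(e - e', \<nu> - \<nu>')" "g - g'"]
    norm_fst_le[of "e - e'" "\<nu> - \<nu>'"] norm_snd_le[of "\<nu> - \<nu>'" "e - e'"]
  by simp_all

lemma weight_diff_norm:
  fixes g e \<nu> g' e' \<nu>' \<epsilon> c :: real
  assumes "0 < \<epsilon>" "\<epsilon> \<le> e" "e \<le> 1" "\<epsilon> \<le> e'" "e' \<le> 1" "0 < c" "c \<le> \<nu>" "1 \<le> \<nu>'"
  shows "\<bar>weight e \<nu> - weight e' \<nu>'\<bar> \<le> (1 / (\<epsilon> * c) + 1 / \<epsilon>\<^sup>2) * norm ((g, e, \<nu>) - (g', e', \<nu>'))"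
proof -
  have "\<bar>weight e \<nu> - weight e' \<nu>'\<bar> \<le> \<bar>\<nu> - \<nu>'\<bar> / (\<epsilon> * c) + \<bar>e - e'\<bar> / \<epsilon>\<^sup>2" by (rule weight_diff[OF assms])
  also have "\<dots> \<le> norm ((g, e, \<nu>) - (g', e', \<nu>')) / (\<epsilon> * c) + norm ((g, e, \<nu>) - (g', e', \<nu>')) / \<epsilon>\<^sup>2"
    using assms norm_triple_ge[where g=g and g'=g' and e=e and e'=e' and \<nu>=\<nu> and \<nu>'=\<nu>'] by (intro add_mono divide_right_mono) auto
  finally show ?thesis by (simp add: algebra_simps)
qed

text \<open>The difference of products is split so that the score multiplying the change of weight
  is taken at \<open>g'\<close>. With the true nuisance in that place the envelope contains no
  estimated function, and the error enters only as a factor.\<close>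

lemma psi_diff_bound:
  assumes G: "1 \<le> \<Gamma>" and eps: "0 < \<epsilon>" "\<epsilon> \<le> e" "e \<le> 1" "\<epsilon> \<le> e'" "e' \<le> 1" and c: "0 < c" "c \<le> \<nu>" "1 \<le> \<nu>'"
    and eta: "\<eta> x = (g, e, \<nu>)" "\<eta>' x = (g', e', \<nu>')"
  shows "\<bar>psi \<Gamma> (y, t, x) \<mu> \<eta> - psi \<Gamma> (y, t, x) \<mu> \<eta>'\<bar>
    \<le> (1 + \<Gamma> / (\<epsilon> * c) + \<Gamma> * (1 / (\<epsilon> * c) + 1 / \<epsilon>\<^sup>2)) * (1 + of_bool t * \<bar>y\<bar> + \<bar>g'\<bar>) * norm (\<eta> x - \<eta>' x)"
proof -
  define N where "N = norm ((g, e, \<nu>) - (g', e', \<nu>'))"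
  define Dz where "Dz = 1 + of_bool t * \<bar>y\<bar> + \<bar>g'\<bar>"
  define k where "k = 1 / (\<epsilon> * c) + 1 / \<epsilon>\<^sup>2"
  have N: "0 \<le> N" by (simp add: N_def)
  have D1: "1 \<le> Dz" by (simp add: Dz_def)
  have k0: "0 \<le> k" using assms by (simp add: k_def)
  have gN: "\<bar>g - g'\<bar> \<le> N" unfolding N_def by (rule norm_triple_ge)
  have w: "0 \<le> weight e \<nu>" "weight e \<nu> \<le> 1 / (\<epsilon> * c)" using weight_bounds[OF eps(1-3) c(1,2)] by auto
  have wd: "\<bar>weight e \<nu> - weight e' \<nu>'\<bar> \<le> k * N" unfolding k_def N_def by (rule weight_diff_norm[OF eps c])
  have "\<bar>psi \<Gamma> (y, t, x) \<mu> \<eta> - psi \<Gamma> (y, t, x) \<mu> \<eta>'\<bar> \<le> (1 + \<Gamma> / (\<epsilon> * c) + \<Gamma> * k) * Dz * N"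
  proof (cases t)
    case False
    then have "\<bar>psi \<Gamma> (y, t, x) \<mu> \<eta> - psi \<Gamma> (y, t, x) \<mu> \<eta>'\<bar> = \<bar>g - g'\<bar>"
      by (simp add: psi_eq[where \<eta>=\<eta> and x=x, OF eta(1)] psi_eq[where \<eta>=\<eta>' and x=x, OF eta(2)])
    also have "\<dots> \<le> 1 * 1 * N" using gN by simp
    also have "\<dots> \<le> (1 + \<Gamma> / (\<epsilon> * c) + \<Gamma> * k) * Dz * N"
      using N D1 k0 G assms by (intro mult_mono) auto
    finally show ?thesis .
  next
    case True
    have "psi \<Gamma> (y, t, x) \<mu> \<eta> - psi \<Gamma> (y, t, x) \<mu> \<eta>' =
        (score \<Gamma> (y - g) - score \<Gamma> (y - g')) * weight e \<nu> + score \<Gamma> (y - g') * (weight e \<nu> - weight e' \<nu>')"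
      using True by (simp add: psi_eq[where \<eta>=\<eta> and x=x, OF eta(1)] psi_eq[where \<eta>=\<eta>' and x=x, OF eta(2)] algebra_simps)
    also have "\<bar>\<dots>\<bar> \<le> \<bar>score \<Gamma> (y - g) - score \<Gamma> (y - g')\<bar> * \<bar>weight e \<nu>\<bar> + \<bar>score \<Gamma> (y - g')\<bar> * \<bar>weight e \<nu> - weight e' \<nu>'\<bar>"
      by (metis abs_mult abs_triangle_ineq)
    also have "\<bar>score \<Gamma> (y - g) - score \<Gamma> (y - g')\<bar> * \<bar>weight e \<nu>\<bar> \<le> (\<Gamma> * N) * (1 / (\<epsilon> * c))"
    proof (intro mult_mono)
      have "\<bar>score \<Gamma> (y - g) - score \<Gamma> (y - g')\<bar> \<le> \<Gamma> * \<bar>(y - g) - (y - g')\<bar>" by (rule score_lipschitz[OF G])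
      also have "\<dots> \<le> \<Gamma> * N" using gN G by (intro mult_left_mono) (auto simp: abs_minus_commute)
      finally show "\<bar>score \<Gamma> (y - g) - score \<Gamma> (y - g')\<bar> \<le> \<Gamma> * N" .
    qed (use w N G in auto)
    also have "\<bar>score \<Gamma> (y - g')\<bar> * \<bar>weight e \<nu> - weight e' \<nu>'\<bar> \<le> (\<Gamma> * Dz) * (k * N)"
    proof (intro mult_mono wd)
      have "\<bar>score \<Gamma> (y - g')\<bar> \<le> \<Gamma> * \<bar>y - g'\<bar>" by (rule abs_score_le[OF G])
      also have "\<dots> \<le> \<Gamma> * Dz" using G True by (intro mult_left_mono) (auto simp: Dz_def)
      finally show "\<bar>score \<Gamma> (y - g')\<bar> \<le> \<Gamma> * Dz" .
    qed (use G D1 in auto)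
    also have "(\<Gamma> * N) * (1 / (\<epsilon> * c)) \<le> (\<Gamma> / (\<epsilon> * c)) * Dz * N"
      using mult_left_mono[OF D1, of "\<Gamma> / (\<epsilon> * c) * N"] N G assms by (simp add: mult_ac)
    also have "(\<Gamma> / (\<epsilon> * c)) * Dz * N + (\<Gamma> * Dz) * (k * N) \<le> (1 + \<Gamma> / (\<epsilon> * c) + \<Gamma> * k) * Dz * N"
      using N D1 by (simp add: algebra_simps)
    finally show ?thesis by simp
  qed
  then show ?thesis by (simp add: N_def Dz_def k_def eta)
qed

context selection_population
begin

section \<open>Bias of the estimating function at a perturbed nuisance\<close>

abbreviation "\<eta>1 \<equiv> \<lambda>x. (g1 x, e1 x, \<nu>1 x)"

definition \<mu>1 :: real where "\<mu>1 = (\<integral>s. a s * Y s + (1 - a s) * g1 (X s) \<partial>P)"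

lemma g1_integrable: "integrable P (\<lambda>s. g1 (X s))" and aY_integrable: "integrable P (\<lambda>s. a s * Y s)"
proof -
  have *: "\<bar>y\<bar> \<le> 1 + \<bar>y\<bar> powr q" for y :: real
  proof (cases "\<bar>y\<bar> \<le> 1")
    case False
    then have "\<bar>y\<bar> powr 1 \<le> \<bar>y\<bar> powr q" using q by (intro powr_mono) auto
    then show ?thesis using False by simp
  qed (simp add: add_increasing2)
  show "integrable P (\<lambda>s. g1 (X s))"
    by (rule Bochner_Integration.integrable_bound[of P "\<lambda>s. 1 + \<bar>g1 (X s)\<bar> powr q"])
      (use powr_g1_integrable * in auto)
  show "integrable P (\<lambda>s. a s * Y s)"
    by (rule Bochner_Integration.integrable_bound[of P "\<lambda>s. 1 + a s * \<bar>Y s\<bar> powr q"])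
      (use powr_Y_integrable * in \<open>auto simp: of_bool_def\<close>)
qed

text \<open>Up to the factor \<open>\<Gamma>\<close>, the remainder in
  \<open>score_linearization\<close> at \<open>g' = g1\<close>.\<close>

definition crossing :: "('x \<Rightarrow> real) \<Rightarrow> 'p \<Rightarrow> real" where
  "crossing g s = (if min (g (X s)) (g1 (X s)) \<le> Y s \<and> Y s \<le> max (g (X s)) (g1 (X s)) then \<bar>g (X s) - g1 (X s)\<bar> else 0)"

text \<open>Given the covariates, a bounded density puts mass at most
  \<open>C * \<bar>g - g1\<bar>\<close> on the interval between \<open>g\<close> and
  \<open>g1\<close>, and the cost there is again \<open>\<bar>g - g1\<bar>\<close>. The constant is
  obtained before \<open>g\<close> and \<open>m\<close>, hence is the same for all estimates; the
  bound \<open>m\<close> provides integrability.\<close>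

lemma crossing_cost_bound:
  obtains C where "0 \<le> C" and "\<And>g m. g \<in> borel_measurable MX \<Longrightarrow> (AE s in P. \<bar>g (X s) - g1 (X s)\<bar> \<le> m) \<Longrightarrow>
    (\<integral>s. a s * crossing g s \<partial>P)
    \<le> C * (\<integral>s. (g (X s) - g1 (X s))\<^sup>2 \<partial>P)"
proof -
  obtain f C0 where f: "\<forall>z. f z \<le> ennreal C0" and dist: "distributed Q (distr Q MX X \<Otimes>\<^sub>M lborel) (\<lambda>s. (X s, Y1 s)) f"
    using cond_density by blast
  define C where "C = max 0 C0"
  have fC: "f z \<le> ennreal C" for z using f[rule_format, of z] by (rule order_trans) (auto simp: C_def intro: ennreal_leI)
  show ?thesis
  proof (rule that[of C])
    show C: "0 \<le> C" by (simp add: C_def)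
    fix g m assume g[measurable]: "g \<in> borel_measurable MX" and m: "AE s in P. \<bar>g (X s) - g1 (X s)\<bar> \<le> m"
    define d where "d x = g x - g1 x" for x
    define b where "b = (\<lambda>(x, y). if min (g x) (g1 x) \<le> y \<and> y \<le> max (g x) (g1 x) then \<bar>d x\<bar> else (0::real))"
    have d[measurable]: "d \<in> borel_measurable MX" unfolding d_def by measurable
    have b[measurable]: "b \<in> borel_measurable (MX \<Otimes>\<^sub>M borel)" unfolding b_def by measurable
    have XQ: "X \<in> measurable Q MX" by (simp add: measurable_Q)
    interpret QX: prob_space "distr Q MX X" using XQ by (rule Q.prob_space_distr)
    have bl: "(\<lambda>z. ennreal (b z)) \<in> borel_measurable (distr Q MX X \<Otimes>\<^sub>M lborel)"
      by (subst measurable_cong_sets[OF sets_pair_measure_cong[OF sets_distr sets_lborel] refl]) measurable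
    have 1: "(\<integral>\<^sup>+s. ennreal (b (X s, Y1 s)) \<partial>Q) \<le> ennreal C * (\<integral>\<^sup>+s. ennreal ((d (X s))\<^sup>2) \<partial>Q)"
    proof -
      have "(\<integral>\<^sup>+s. ennreal (b (X s, Y1 s)) \<partial>Q) = (\<integral>\<^sup>+z. f z * ennreal (b z) \<partial>(distr Q MX X \<Otimes>\<^sub>M lborel))"
        by (rule distributed_nn_integral[OF dist bl, symmetric])
      also have "\<dots> \<le> (\<integral>\<^sup>+z. ennreal C * ennreal (b z) \<partial>(distr Q MX X \<Otimes>\<^sub>M lborel))"
        using fC by (intro nn_integral_mono mult_right_mono) auto
      also have "\<dots> = ennreal C * (\<integral>\<^sup>+z. ennreal (b z) \<partial>(distr Q MX X \<Otimes>\<^sub>M lborel))"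
        by (rule nn_integral_cmult[OF bl])
      also have "(\<integral>\<^sup>+z. ennreal (b z) \<partial>(distr Q MX X \<Otimes>\<^sub>M lborel)) = (\<integral>\<^sup>+x. \<integral>\<^sup>+y. ennreal (b (x, y)) \<partial>lborel \<partial>distr Q MX X)"
        by (rule lborel.nn_integral_fst[OF bl, symmetric])
      also have "\<dots> = (\<integral>\<^sup>+x. ennreal ((d x)\<^sup>2) \<partial>distr Q MX X)"
      proof (intro nn_integral_cong)
        fix x
        have "(\<integral>\<^sup>+y. ennreal (b (x, y)) \<partial>lborel) = (\<integral>\<^sup>+y. ennreal \<bar>d x\<bar> * indicator {min (g x) (g1 x)..max (g x) (g1 x)} y \<partial>lborel)"
          by (intro nn_integral_cong) (auto simp: b_def indicator_def)
        also have "\<dots> = ennreal \<bar>d x\<bar> * ennreal (max (g x) (g1 x) - min (g x) (g1 x))"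
          by (subst nn_integral_cmult_indicator) auto
        also have "max (g x) (g1 x) - min (g x) (g1 x) = \<bar>d x\<bar>" by (auto simp: d_def max_def min_def)
        also have "ennreal \<bar>d x\<bar> * ennreal \<bar>d x\<bar> = ennreal (\<bar>d x\<bar> * \<bar>d x\<bar>)" by (rule ennreal_mult[symmetric]) auto
        also have "\<bar>d x\<bar> * \<bar>d x\<bar> = (d x)\<^sup>2" by (simp add: power2_eq_square)
        finally show "(\<integral>\<^sup>+y. ennreal (b (x, y)) \<partial>lborel) = ennreal ((d x)\<^sup>2)" .
      qed
      also have "\<dots> = (\<integral>\<^sup>+s. ennreal ((d (X s))\<^sup>2) \<partial>Q)"
        using XQ by (intro nn_integral_distr) auto
      finally show ?thesis .
    qed
    have m': "AE s in P. \<bar>d (X s)\<bar> \<le> m" using m by (simp add: d_def)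
    have d2b: "AE s in P. (d (X s))\<^sup>2 \<le> m\<^sup>2"
      using m' by eventually_elim (metis abs_ge_zero power2_abs power_mono)
    have int2: "integrable P (\<lambda>s. (d (X s))\<^sup>2)"
      by (rule integrable_const_bound[where B="m\<^sup>2"]) (use d2b in auto)
    have intb: "integrable P (\<lambda>s. a s * b (X s, Y s))"
    proof (rule integrable_const_bound[where B=m])
      show "AE s in P. norm (a s * b (X s, Y s)) \<le> m"
        using m' by eventually_elim (auto simp: b_def of_bool_def intro: order_trans[OF abs_ge_zero])
    qed measurable
    have int2a: "integrable P (\<lambda>s. a s * (d (X s))\<^sup>2)"
      by (rule Bochner_Integration.integrable_bound[OF int2]) (auto simp: of_bool_def)
    have eqQ: "(\<integral>\<^sup>+s. ennreal (b (X s, Y1 s)) \<partial>Q) = (\<integral>\<^sup>+s. ennreal (b (X s, Y s)) \<partial>Q)"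
      by (intro nn_integral_cong_AE) (auto simp: AE_Q Y_eq)
    have iQ: "integrable Q (\<lambda>s. b (X s, Y s))" "integrable Q (\<lambda>s. (d (X s))\<^sup>2)"
      using intb int2a by (subst integrable_Q; simp)+
    have "ennreal (\<integral>s. b (X s, Y s) \<partial>Q) \<le> ennreal C * ennreal (\<integral>s. (d (X s))\<^sup>2 \<partial>Q)"
      using 1 unfolding eqQ nn_integral_eq_integral[OF iQ(2) AE_I2[OF zero_le_power2]]
      by (subst (asm) nn_integral_eq_integral[OF iQ(1)]) (auto simp: b_def)
    also have "ennreal C * ennreal (\<integral>s. (d (X s))\<^sup>2 \<partial>Q) = ennreal (C * (\<integral>s. (d (X s))\<^sup>2 \<partial>Q))"
      using C by (intro ennreal_mult[symmetric]) auto
    finally have "(\<integral>s. b (X s, Y s) \<partial>Q) \<le> C * (\<integral>s. (d (X s))\<^sup>2 \<partial>Q)"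
      using C by (subst (asm) ennreal_le_iff) auto
    then have "(\<integral>s. a s * b (X s, Y s) \<partial>P) / pA \<le> C * ((\<integral>s. a s * (d (X s))\<^sup>2 \<partial>P) / pA)"
      by (subst (asm) (1 2) integral_Q) auto
    then have "(\<integral>s. a s * b (X s, Y s) \<partial>P) \<le> C * (\<integral>s. a s * (d (X s))\<^sup>2 \<partial>P)"
      using pA_pos by (simp add: divide_simps)
    also have "\<dots> \<le> C * (\<integral>s. (d (X s))\<^sup>2 \<partial>P)"
      using int2 int2a by (intro mult_left_mono integral_mono) (auto simp: C_def of_bool_def)
    finally show "(\<integral>s. a s * crossing g s \<partial>P)
      \<le> C * (\<integral>s. (g (X s) - g1 (X s))\<^sup>2 \<partial>P)"
      by (simp only: b_def d_def crossing_def prod.case)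
  qed
qed

definition w1 :: "'x \<Rightarrow> real" where "w1 x = weight (e1 x) (\<nu>1 x)"

lemma w1_meas[measurable]: "w1 \<in> borel_measurable MX" unfolding w1_def weight_def by measurable

lemma e1_bounds: "AE s in P. \<epsilon> \<le> e1 (X s) \<and> e1 (X s) \<le> 1 - \<epsilon> \<and> e1 (X s) \<le> 1 \<and> 0 < e1 (X s)"
  using overlap' by eventually_elim (use eps in auto)

text \<open>\<open>K\<close> may depend on the lower bound \<open>c\<close> for the third component,
  but not on the nuisance or on \<open>m\<close>; the same constant thus serves all large
  \<open>n\<close> on a given sample path.\<close>

definition quadratic_bias :: "real \<Rightarrow> real \<Rightarrow> bool" where
  "quadratic_bias c K \<longleftrightarrow> (\<forall>\<eta> m. \<eta> \<in> borel_measurable MX \<longrightarrow>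
      (AE s in P. \<epsilon> \<le> fst (snd (\<eta> (X s))) \<and> fst (snd (\<eta> (X s))) \<le> 1 - \<epsilon> \<and> c \<le> snd (snd (\<eta> (X s)))) \<longrightarrow>
      (AE s in P. norm (\<eta> (X s) - \<eta>1 (X s)) \<le> m) \<longrightarrow>
      \<bar>(\<integral>s. psi \<Gamma> (Y s, A s, X s) 0 \<eta> \<partial>P) - \<mu>1\<bar> \<le> K * (\<integral>s. (norm (\<eta> (X s) - \<eta>1 (X s)))\<^sup>2 \<partial>P))"

text \<open>The identity \<open>e1 \<nu>1 w1 = 1 - e1\<close> cancels the first-order effect of \<open>g\<close>; the density bound makes
  the remainder of the linearised score quadratic.\<close>
lemma psi_bias:
  assumes c: "0 < c"
  obtains K where "0 \<le> K" "quadratic_bias c K"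
proof -
  obtain C where C: "0 \<le> C" and Cle: "\<And>g m. g \<in> borel_measurable MX \<Longrightarrow> (AE s in P. \<bar>g (X s) - g1 (X s)\<bar> \<le> m) \<Longrightarrow>
    (\<integral>s. a s * crossing g s \<partial>P) \<le> C * (\<integral>s. (g (X s) - g1 (X s))\<^sup>2 \<partial>P)"
    using crossing_cost_bound by blast
  define k where "k = 1 / (\<epsilon> * c) + 1 / \<epsilon>\<^sup>2"
  have k0: "0 \<le> k" using eps c by (simp add: k_def)
  define K where "K = \<Gamma> * k + \<Gamma> / (\<epsilon> * c) * C"
  show ?thesis
  proof (rule that[of K])
    show "0 \<le> K" using Gamma k0 C eps c by (simp add: K_def)
    show "quadratic_bias c K"
      unfolding quadratic_bias_def
    proof (intro allI impI)
      fix \<eta> :: "'x nuisance" and m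
      define g where "g x = fst (\<eta> x)" for x
      define e where "e x = fst (snd (\<eta> x))" for x
      define \<nu> where "\<nu> x = snd (snd (\<eta> x))" for x
      have eta: "\<eta> x = (g x, e x, \<nu> x)" for x by (simp add: g_def e_def \<nu>_def)
      assume eta_meas: "\<eta> \<in> borel_measurable MX" and
        "AE s in P. \<epsilon> \<le> fst (snd (\<eta> (X s))) \<and> fst (snd (\<eta> (X s))) \<le> 1 - \<epsilon> \<and> c \<le> snd (snd (\<eta> (X s)))"
        and nb: "AE s in P. norm (\<eta> (X s) - \<eta>1 (X s)) \<le> m"
      then have ae: "AE s in P. \<epsilon> \<le> e (X s) \<and> e (X s) \<le> 1 - \<epsilon> \<and> c \<le> \<nu> (X s)" by (simp only: e_def \<nu>_def)
      note [measurable] = measurable_triple[OF eta_meas, folded g_def e_def \<nu>_def] eta_meas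
      have eta1_meas[measurable]: "\<eta>1 \<in> borel_measurable MX" by measurable
      define N where "N s = norm (\<eta> (X s) - \<eta>1 (X s))" for s
      define w where "w x = weight (e x) (\<nu> x)" for x
      define d where "d x = g x - g1 x" for x
      have w_meas[measurable]: "w \<in> borel_measurable MX" unfolding w_def weight_def by measurable
      have d_meas[measurable]: "d \<in> borel_measurable MX" unfolding d_def by measurable
      have N_meas[measurable]: "N \<in> borel_measurable P" unfolding N_def by measurable
      have N0: "0 \<le> N s" for s by (simp add: N_def)
      have wb: "AE s in P. 0 \<le> w (X s) \<and> w (X s) \<le> 1 / (\<epsilon> * c)"
        using ae
      proof eventually_elim
        case (elim s)
        then have "e (X s) \<le> 1" using eps by auto
        then show ?case using elim weight_bounds[OF eps, of "e (X s)" c "\<nu> (X s)"] c by (simp add: w_def)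
      qed
      have wabs: "AE s in P. \<bar>w (X s)\<bar> \<le> 1 / (\<epsilon> * c)" using wb by eventually_elim simp
      have wd: "AE s in P. \<bar>w (X s) - w1 (X s)\<bar> \<le> k * N s"
        using ae e1_bounds nu1_bounds
      proof eventually_elim
        case (elim s)
        have "e (X s) \<le> 1" using elim eps by auto
        then show ?case unfolding w_def w1_def k_def N_def eta using elim eps c by (intro weight_diff_norm) auto
      qed
      have dN: "\<bar>d (X s)\<bar> \<le> N s" for s unfolding d_def N_def eta by (rule norm_triple_ge)
      have db: "AE s in P. \<bar>d (X s)\<bar> \<le> m"
        using nb
      proof eventually_elim
        case (elim s) then show ?case using dN[of s] by (simp add: N_def)
      qed
      have N2b: "AE s in P. (N s)\<^sup>2 \<le> m\<^sup>2"
        using nb by eventually_elim (auto simp: N_def intro!: power_mono)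
      have N2: "integrable P (\<lambda>s. (N s)\<^sup>2)"
        by (rule integrable_const_bound[where B="m\<^sup>2"]) (use N2b in auto)
      have d2: "integrable P (\<lambda>s. (d (X s))\<^sup>2)"
        by (rule Bochner_Integration.integrable_bound[OF N2]) (use dN in \<open>auto intro!: AE_I2 simp: power2_le_iff_abs_le[OF N0]\<close>)
      have dint: "integrable P (\<lambda>s. d (X s))"
        by (rule integrable_const_bound[where B=m]) (use db in auto)
      have dw: "AE s in P. \<bar>d (X s) * w (X s)\<bar> \<le> m * (1 / (\<epsilon> * c))"
        using db wb
      proof eventually_elim
        case (elim s)
        have "\<bar>d (X s)\<bar> * \<bar>w (X s)\<bar> \<le> m * (1 / (\<epsilon> * c))" using elim by (intro mult_mono) auto
        then show ?case by (simp only: abs_mult)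
      qed
      define R where "R s = score \<Gamma> (Y s - g (X s)) - score \<Gamma> (res s) + V s * d (X s)" for s
      define b where "b = crossing g"
      have Rb: "\<bar>R s\<bar> \<le> \<Gamma> * b s" for s
        using score_linearization[OF Gamma, of "Y s" "g (X s)" "g1 (X s)"]
        by (simp add: R_def b_def crossing_def d_def V_def split: if_splits)
      have R_meas[measurable]: "R \<in> borel_measurable P" unfolding R_def by measurable
      have b_meas[measurable]: "b \<in> borel_measurable P" unfolding b_def crossing_def d_def by measurable
      have bint: "integrable P (\<lambda>s. a s * b s)"
      proof (rule integrable_const_bound[where B=m])
        show "AE s in P. norm (a s * b s) \<le> m"
          using db by eventually_elim (auto simp: b_def crossing_def d_def of_bool_def intro: order_trans[OF abs_ge_zero])
      qed measurable
      have Rw: "AE s in P. \<bar>a s * (R s * w (X s))\<bar> \<le> \<Gamma> / (\<epsilon> * c) * (a s * b s)"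
        using wb
      proof eventually_elim
        case (elim s)
        have "\<bar>R s\<bar> * \<bar>w (X s)\<bar> \<le> (\<Gamma> * b s) * (1 / (\<epsilon> * c))" using elim Rb[of s] by (intro mult_mono) auto
        then show ?case by (auto simp: abs_mult of_bool_def)
      qed
      have Rint: "integrable P (\<lambda>s. a s * (R s * w (X s)))"
      proof (rule Bochner_Integration.integrable_bound[OF integrable_mult_right[OF bint, of "\<Gamma> / (\<epsilon> * c)"]])
        show "AE s in P. norm (a s * (R s * w (X s))) \<le> norm (\<Gamma> / (\<epsilon> * c) * (a s * b s))"
          using Rw
        proof eventually_elim
          case (elim s)
          then show ?case unfolding real_norm_def by (rule order_trans[OF _ abs_ge_self])
        qed
      qed measurable
      have sint: "integrable P (\<lambda>s. a s * score \<Gamma> (res s) * w (X s))"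
        by (rule score_integrable[OF w_meas wabs])
      \<comment> \<open>The perturbed weight is a bounded function of the covariates, hence a
        legitimate direction in the first-order condition; an error in \<open>e\<close> or
        \<open>\<nu>\<close> alone therefore causes no bias.\<close>
      have s0: "(\<integral>s. a s * score \<Gamma> (res s) * w (X s) \<partial>P) = 0"
        by (rule score_orthogonal[OF w_meas wabs])
      have Vint: "integrable P (\<lambda>s. a s * (V s * (d (X s) * w (X s))))"
      proof (rule integrable_const_bound[where B="\<Gamma> * (m * (1 / (\<epsilon> * c)))"])
        show "AE s in P. norm (a s * (V s * (d (X s) * w (X s)))) \<le> \<Gamma> * (m * (1 / (\<epsilon> * c)))"
          using dw
        proof eventually_elim
          case (elim s)
          have "\<bar>V s\<bar> * \<bar>d (X s) * w (X s)\<bar> \<le> \<Gamma> * (m * (1 / (\<epsilon> * c)))"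
          proof (rule mult_mono[OF _ elim])
            show "\<bar>V s\<bar> \<le> \<Gamma>" "0 \<le> \<Gamma>" using V_bounds[of s] by linarith+
          qed simp
          moreover have "0 \<le> \<Gamma> * (m * (1 / (\<epsilon> * c)))" using elim Gamma by (intro mult_nonneg_nonneg[of \<Gamma>] order_trans[OF abs_ge_zero elim]) simp
          ultimately show ?case by (cases "A s") (simp_all add: abs_mult)
        qed
      qed measurable
      define h where "h x = \<nu>1 x * (d x * w x)" for x
      have h_meas[measurable]: "h \<in> borel_measurable MX" unfolding h_def by measurable
      have hint: "integrable P (\<lambda>s. h (X s))"
      proof (rule integrable_const_bound[where B="\<Gamma> * (m * (1 / (\<epsilon> * c)))"])
        show "AE s in P. norm (h (X s)) \<le> \<Gamma> * (m * (1 / (\<epsilon> * c)))"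
          using dw nu1_bounds
        proof eventually_elim
          case (elim s)
          have "\<bar>\<nu>1 (X s)\<bar> * \<bar>d (X s) * w (X s)\<bar> \<le> \<Gamma> * (m * (1 / (\<epsilon> * c)))"
          proof (rule mult_mono[OF _ elim(1)])
            show "\<bar>\<nu>1 (X s)\<bar> \<le> \<Gamma>" "0 \<le> \<Gamma>" using elim(2) by linarith+
          qed simp
          then show ?case by (simp only: h_def real_norm_def abs_mult)
        qed
      qed measurable
      have Veq: "(\<integral>s. a s * (V s * (d (X s) * w (X s))) \<partial>P) = (\<integral>s. e1 (X s) * h (X s) \<partial>P)"
        using nu1_integral[of "\<lambda>x. d x * w x", OF _ dw] e1_integral(3)[OF h_meas hint] by (simp add: h_def)
      \<comment> \<open>The expansion replaces \<open>g\<close> by \<open>g1 + d\<close> and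
        linearises the score. After averaging over treatment and outcome given the covariates, the
        terms linear in \<open>d\<close> become \<open>(1 - e1 - e1 * \<nu>1 * w) * d\<close>. By
        the identity for \<open>w1\<close> this equals \<open>e1 * \<nu>1 * (w1 - w) * d\<close>, a
        product of two errors.\<close>
      have psi: "psi \<Gamma> (Y s, A s, X s) 0 \<eta> = (a s * Y s + (1 - a s) * g1 (X s)) + (d (X s) - a s * d (X s))
        + a s * score \<Gamma> (res s) * w (X s) - a s * (V s * (d (X s) * w (X s))) + a s * (R s * w (X s))" for s
        by (simp add: psi_eq[where \<eta>=\<eta> and x="X s", OF eta] w_def R_def d_def algebra_simps)
      have i0: "integrable P (\<lambda>s. a s * Y s + (1 - a s) * g1 (X s))"
        using aY_integrable g1_integrable e1_integral(1)[OF g1_meas g1_integrable] by (simp add: left_diff_distrib)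
      note ad = e1_integral[OF d_meas dint]
      have "(\<integral>s. psi \<Gamma> (Y s, A s, X s) 0 \<eta> \<partial>P) = \<mu>1 + ((\<integral>s. d (X s) \<partial>P) - (\<integral>s. e1 (X s) * d (X s) \<partial>P))
        + 0 - (\<integral>s. e1 (X s) * h (X s) \<partial>P) + (\<integral>s. a s * (R s * w (X s)) \<partial>P)"
        unfolding psi \<mu>1_def using i0 dint ad sint Vint Rint s0 Veq by simp
      also have "\<dots> = \<mu>1 + (\<integral>s. d (X s) - e1 (X s) * d (X s) - e1 (X s) * h (X s) \<partial>P) + (\<integral>s. a s * (R s * w (X s)) \<partial>P)"
        using dint ad e1_integral(2)[OF h_meas hint] by simp
      finally have eq: "(\<integral>s. psi \<Gamma> (Y s, A s, X s) 0 \<eta> \<partial>P) - \<mu>1 =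
        (\<integral>s. d (X s) - e1 (X s) * d (X s) - e1 (X s) * h (X s) \<partial>P) + (\<integral>s. a s * (R s * w (X s)) \<partial>P)"
        by simp
      have t1: "\<bar>\<integral>s. d (X s) - e1 (X s) * d (X s) - e1 (X s) * h (X s) \<partial>P\<bar> \<le> \<Gamma> * k * (\<integral>s. (N s)\<^sup>2 \<partial>P)"
      proof -
        have "AE s in P. \<bar>d (X s) - e1 (X s) * d (X s) - e1 (X s) * h (X s)\<bar> \<le> \<Gamma> * k * (N s)\<^sup>2"
          using wd e1_bounds nu1_bounds
        proof eventually_elim
          case (elim s)
          have id: "e1 (X s) * \<nu>1 (X s) * w1 (X s) = 1 - e1 (X s)"
          proof -
            have "e1 (X s) \<noteq> 0" "\<nu>1 (X s) \<noteq> 0" using elim by linarith+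
            then show ?thesis by (simp add: w1_def weight_def)
          qed
          have "d (X s) - e1 (X s) * d (X s) - e1 (X s) * h (X s)
              = (1 - e1 (X s)) * d (X s) - e1 (X s) * \<nu>1 (X s) * w (X s) * d (X s)"
            by (simp add: h_def algebra_simps)
          also have "\<dots> = (e1 (X s) * \<nu>1 (X s)) * ((w1 (X s) - w (X s)) * d (X s))"
            unfolding id[symmetric] by (simp add: algebra_simps)
          also have "\<bar>\<dots>\<bar> \<le> (1 * \<Gamma>) * ((k * N s) * N s)"
            unfolding abs_mult using elim dN[of s] N0[of s] k0
            by (intro mult_mono) (auto simp: abs_minus_commute intro!: mult_nonneg_nonneg)
          finally show ?case by (simp add: power2_eq_square mult_ac)
        qed
        then have "(\<integral>s. \<bar>d (X s) - e1 (X s) * d (X s) - e1 (X s) * h (X s)\<bar> \<partial>P) \<le> (\<integral>s. \<Gamma> * k * (N s)\<^sup>2 \<partial>P)"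
          using dint ad e1_integral(2)[OF h_meas hint] N2 by (intro integral_mono_AE) auto
        then show ?thesis by (intro order_trans[OF integral_abs_bound]) simp
      qed
      have t2: "\<bar>\<integral>s. a s * (R s * w (X s)) \<partial>P\<bar> \<le> \<Gamma> / (\<epsilon> * c) * C * (\<integral>s. (N s)\<^sup>2 \<partial>P)"
      proof -
        have "\<bar>\<integral>s. a s * (R s * w (X s)) \<partial>P\<bar> \<le> (\<integral>s. \<bar>a s * (R s * w (X s))\<bar> \<partial>P)" by (rule integral_abs_bound)
        also have "\<dots> \<le> (\<integral>s. \<Gamma> / (\<epsilon> * c) * (a s * b s) \<partial>P)"
          using Rw by (intro integral_mono_AE integrable_abs Rint integrable_mult_right bint) auto
        also have "\<dots> = \<Gamma> / (\<epsilon> * c) * (\<integral>s. a s * b s \<partial>P)" by (rule integral_mult_right_zero)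
        also have "\<dots> \<le> \<Gamma> / (\<epsilon> * c) * (C * (\<integral>s. (d (X s))\<^sup>2 \<partial>P))"
          using Cle[of g m] db Gamma eps c unfolding b_def crossing_def d_def by (intro mult_left_mono) auto
        also have "\<dots> \<le> \<Gamma> / (\<epsilon> * c) * (C * (\<integral>s. (N s)\<^sup>2 \<partial>P))"
          using d2 N2 dN N0 C Gamma eps c
          by (intro mult_left_mono integral_mono) (auto simp: power2_le_iff_abs_le)
        finally show ?thesis by (simp only: mult.assoc)
      qed
      show "\<bar>(\<integral>s. psi \<Gamma> (Y s, A s, X s) 0 \<eta> \<partial>P) - \<mu>1\<bar> \<le> K * (\<integral>s. (norm (\<eta> (X s) - \<eta>1 (X s)))\<^sup>2 \<partial>P)"
      proof -
        have "\<bar>(\<integral>s. psi \<Gamma> (Y s, A s, X s) 0 \<eta> \<partial>P) - \<mu>1\<bar> \<le> K * (\<integral>s. (N s)\<^sup>2 \<partial>P)"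
          unfolding eq K_def distrib_right by (intro order_trans[OF abs_triangle_ineq] add_mono t1 t2)
        then show ?thesis by (simp only: N_def)
      qed
    qed
  qed
qed

text \<open>At the true nuisance the correction term is the first-order condition in the direction
  \<open>w1\<close>, so it integrates to 0.\<close>

lemma psi_true_mean: "(\<integral>s. psi \<Gamma> (Y s, A s, X s) 0 \<eta>1 \<partial>P) = \<mu>1"
proof -
  have wabs: "AE s in P. \<bar>w1 (X s)\<bar> \<le> 1 / (\<epsilon> * 1)"
    using e1_bounds nu1_bounds
  proof eventually_elim
    case (elim s)
    then show ?case using weight_bounds[OF eps, of "e1 (X s)" 1 "\<nu>1 (X s)"] by (simp add: w1_def)
  qed
  have "psi \<Gamma> (Y s, A s, X s) 0 \<eta>1 = (a s * Y s + (1 - a s) * g1 (X s)) + a s * score \<Gamma> (res s) * w1 (X s)" for s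
    by (simp add: psi_eq[where \<eta>=\<eta>1 and x="X s", OF refl] w1_def algebra_simps)
  moreover have "integrable P (\<lambda>s. a s * Y s + (1 - a s) * g1 (X s))"
    using aY_integrable g1_integrable e1_integral(1)[OF g1_meas g1_integrable] by (simp add: left_diff_distrib)
  ultimately show ?thesis
    using score_integrable[OF w1_meas wabs] score_orthogonal[OF w1_meas wabs] by (simp add: \<mu>1_def)
qed

text \<open>For fixed covariates the estimating function of a treated unit is strictly increasing in the outcome,
  so its level sets are graphs, which are null for a law with a density.\<close>
lemma psi_true_nondegenerate: "(\<integral>s. \<bar>psi \<Gamma> (Y s, A s, X s) 0 \<eta>1 - \<mu>1\<bar> \<partial>P) \<noteq> 0"
  if int: "integrable P (\<lambda>s. psi \<Gamma> (Y s, A s, X s) 0 \<eta>1)"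
proof
  assume 0: "(\<integral>s. \<bar>psi \<Gamma> (Y s, A s, X s) 0 \<eta>1 - \<mu>1\<bar> \<partial>P) = 0"
  have "AE s in P. \<bar>psi \<Gamma> (Y s, A s, X s) 0 \<eta>1 - \<mu>1\<bar> = 0"
    using 0 int by (subst integral_nonneg_eq_0_iff_AE[symmetric]) auto
  then have "AE s in P. A s \<longrightarrow> Y1 s + score \<Gamma> (Y1 s - g1 (X s)) * w1 (X s) = \<mu>1 \<and> 0 \<le> w1 (X s)"
    using e1_bounds nu1_bounds
  proof eventually_elim
    case (elim s)
    have "0 \<le> w1 (X s)" using elim unfolding w1_def weight_def by auto
    then show ?case using elim Y_eq[of s]
      by (auto simp: psi_eq[where \<eta>="\<eta>1" and x="X s", OF refl] w1_def)
  qed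
  then have aeQ: "AE s in Q. Y1 s + score \<Gamma> (Y1 s - g1 (X s)) * w1 (X s) = \<mu>1 \<and> 0 \<le> w1 (X s)"
    by (simp only: AE_Q)
  define B where "B = {z \<in> space (MX \<Otimes>\<^sub>M borel). snd z + score \<Gamma> (snd z - g1 (fst z)) * w1 (fst z) = \<mu>1 \<and> 0 \<le> w1 (fst z)}"
  have B: "B \<in> sets (MX \<Otimes>\<^sub>M borel)" unfolding B_def by measurable
  obtain f where dist: "distributed Q (distr Q MX X \<Otimes>\<^sub>M lborel) (\<lambda>s. (X s, Y1 s)) f"
    using cond_density by blast
  have XQ: "X \<in> measurable Q MX" by (simp add: measurable_Q)
  interpret QX: prob_space "distr Q MX X" using XQ by (rule Q.prob_space_distr)
  have sets_eq: "sets (distr Q MX X \<Otimes>\<^sub>M lborel) = sets (MX \<Otimes>\<^sub>M borel)"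
    by (intro sets_pair_measure_cong) auto
  have B': "B \<in> sets (distr Q MX X \<Otimes>\<^sub>M lborel)" using B by (simp add: sets_eq)
  have "emeasure (distr Q MX X \<Otimes>\<^sub>M lborel) B = (\<integral>\<^sup>+x. emeasure lborel (Pair x -` B) \<partial>distr Q MX X)"
    by (rule lborel.emeasure_pair_measure_alt[OF B'])
  also have "\<dots> = (\<integral>\<^sup>+x. 0 \<partial>distr Q MX X)"
  proof (intro nn_integral_cong)
    fix x
    have uniq: "y = y'" if "y + score \<Gamma> (y - g1 x) * w1 x = \<mu>1" "y' + score \<Gamma> (y' - g1 x) * w1 x = \<mu>1" "0 \<le> w1 x" for y y'
    proof -
      have lt: False if "y < y'" "y + score \<Gamma> (y - g1 x) * w1 x = \<mu>1" "y' + score \<Gamma> (y' - g1 x) * w1 x = \<mu>1" "0 \<le> w1 x" for y y'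
      proof -
        have "score \<Gamma> (y - g1 x) \<le> score \<Gamma> (y' - g1 x)"
        proof -
          consider "0 \<le> y - g1 x" | "y - g1 x < 0" "0 \<le> y' - g1 x" | "y' - g1 x < 0" using that by linarith
          then show ?thesis
          proof cases
            case 1 then show ?thesis using that by (simp add: score_eq)
          next
            case 2
            have "\<Gamma> * (y - g1 x) \<le> 0" using 2 Gamma by (simp add: mult_le_0_iff)
            then show ?thesis using 2 by (simp add: score_eq)
          next
            case 3 then show ?thesis using that Gamma by (simp add: score_eq)
          qed
        qed
        then have "score \<Gamma> (y - g1 x) * w1 x \<le> score \<Gamma> (y' - g1 x) * w1 x" using that by (intro mult_right_mono) auto
        then show False using that by linarith
      qed
      show ?thesis using that lt[of y y'] lt[of y' y] by (cases y y' rule: linorder_cases) auto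
    qed
    \<comment> \<open>By \<open>uniq\<close> a section has at most one point; it is therefore
      contained in the singleton of its description, also when it is empty.\<close>
    have "Pair x -` B \<subseteq> {THE y. y \<in> Pair x -` B}"
    proof
      fix y assume y: "y \<in> Pair x -` B"
      have "(THE y. y \<in> Pair x -` B) = y"
      proof (rule the_equality[where P="\<lambda>y. y \<in> Pair x -` B", OF y])
        fix z assume "z \<in> Pair x -` B"
        then show "z = y" using y by (intro uniq[of z y]) (simp_all add: B_def)
      qed
      then show "y \<in> {THE y. y \<in> Pair x -` B}" by simp
    qed
    then have "finite (Pair x -` B)" by (rule finite_subset) simp
    then show "emeasure lborel (Pair x -` B) = 0" by (rule emeasure_lborel_countable[OF countable_finite])
  qed
  finally have null: "emeasure (distr Q MX X \<Otimes>\<^sub>M lborel) B = 0" by simp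
  have "emeasure Q ((\<lambda>s. (X s, Y1 s)) -` B \<inter> space Q) = (\<integral>\<^sup>+z. f z * indicator B z \<partial>(distr Q MX X \<Otimes>\<^sub>M lborel))"
    by (rule distributed_emeasure[OF dist B'])
  also have "\<dots> = 0"
    using null B' distributed_borel_measurable[OF dist]
    by (subst nn_integral_null_set[of B]) (auto simp: null_sets_def)
  finally have "emeasure Q ((\<lambda>s. (X s, Y1 s)) -` B \<inter> space Q) = 0" .
  moreover have "emeasure Q ((\<lambda>s. (X s, Y1 s)) -` B \<inter> space Q) = emeasure Q (space Q)"
  proof (rule emeasure_eq_AE)
    show "AE s in Q. (s \<in> (\<lambda>s. (X s, Y1 s)) -` B \<inter> space Q) = (s \<in> space Q)"
      using aeQ AE_space
      by eventually_elim (use measurable_space[OF XQ] in \<open>auto simp: B_def space_pair_measure\<close>)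
    have "(\<lambda>s. (X s, Y1 s)) \<in> measurable Q (MX \<Otimes>\<^sub>M borel)" by (simp add: measurable_Q)
    from measurable_sets[OF this B] show "(\<lambda>s. (X s, Y1 s)) -` B \<inter> space Q \<in> sets Q" .
  qed simp
  ultimately show False by (simp add: Q.emeasure_space_1)
qed

end

section \<open>The estimating function at an estimated nuisance\<close>

lemma psi_altdef:
  "psi \<Gamma> z \<mu> \<eta> = of_bool (fst (snd z)) * fst z + (1 - of_bool (fst (snd z))) * fst (\<eta> (snd (snd z)))
    + of_bool (fst (snd z)) * (score \<Gamma> (fst z - fst (\<eta> (snd (snd z))))
      * weight (fst (snd (\<eta> (snd (snd z))))) (snd (snd (\<eta> (snd (snd z)))))) - \<mu>"
proof -
  obtain y t x where z: "z = (y, t, x)" by (cases z)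
  obtain g e \<nu> where e: "\<eta> x = (g, e, \<nu>)" by (cases "\<eta> x")
  show ?thesis unfolding z by (simp add: psi_eq[where \<eta>=\<eta> and x=x, OF e] e)
qed

lemma psi_joint_measurable:
  fixes E :: "'c \<Rightarrow> 'x \<Rightarrow> real \<times> real \<times> real"
  assumes E: "(\<lambda>(w, x). E w x) \<in> borel_measurable (N \<Otimes>\<^sub>M MX)"
  shows "(\<lambda>(w, z). psi \<Gamma> z \<mu> (E w)) \<in> borel_measurable (N \<Otimes>\<^sub>M obs_space MX)"
proof -
  let ?O = "N \<Otimes>\<^sub>M obs_space MX"
  have z[measurable]: "(\<lambda>p. fst (snd p)) \<in> borel_measurable ?O"
    "(\<lambda>p. fst (snd (snd p))) \<in> measurable ?O (count_space UNIV)"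
    "(\<lambda>p. snd (snd (snd p))) \<in> measurable ?O MX"
    unfolding obs_space_def by measurable
  have "(\<lambda>p. (\<lambda>(w, x). E w x) (fst p, snd (snd (snd p)))) \<in> borel_measurable ?O"
    by (rule measurable_compose[OF measurable_Pair[OF measurable_fst z(3)] E])
  then have "(\<lambda>p. E (fst p) (snd (snd (snd p)))) \<in> borel_measurable ?O" by simp
  note [measurable] = measurable_triple[OF this]
  show ?thesis
    unfolding psi_altdef weight_def case_prod_beta by measurable
qed

lemma psi_measurable:
  assumes "\<eta> \<in> borel_measurable MX"
  shows "(\<lambda>z. psi \<Gamma> z \<mu> \<eta>) \<in> borel_measurable (obs_space MX)"
proof -
  have "(\<lambda>(w :: unit, x). \<eta> x) \<in> borel_measurable (count_space UNIV \<Otimes>\<^sub>M MX)" 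
    unfolding case_prod_beta by (rule measurable_compose[OF measurable_snd assms])
  from psi_joint_measurable[OF this]
  have "(\<lambda>(w :: unit, z). psi \<Gamma> z \<mu> \<eta>) \<in> borel_measurable (count_space UNIV \<Otimes>\<^sub>M obs_space MX)" .
  from measurable_compose[OF measurable_Pair1'[of "()"] this] show ?thesis by simp
qed

locale split_sample_estimation =
  pop: selection_population P MX Y1 Y A X \<Gamma> q Cq \<epsilon> g1 e1 \<nu>1 +
  smp: split_sample M MX "distr P (obs_space MX) (\<lambda>s. (Y s, A s, X s))" W \<kappa> K
  for P :: "'p measure" and MX :: "'x measure" and Y1 Y :: "'p \<Rightarrow> real" and A :: "'p \<Rightarrow> bool" and X :: "'p \<Rightarrow> 'x"
    and \<Gamma> q Cq \<epsilon> :: real and g1 e1 \<nu>1 :: "'x \<Rightarrow> real"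
    and M :: "'w measure" and W :: "nat \<Rightarrow> 'w \<Rightarrow> 'x obs" and \<kappa> :: "nat \<Rightarrow> 'w \<Rightarrow> nat" and K :: nat +
  fixes T :: "'x learner"
  assumes learner: "measurable_learner MX T"
begin

abbreviation "L \<equiv> distr P (obs_space MX) (\<lambda>s. (Y s, A s, X s))"
abbreviation "PX \<equiv> distr P MX X"
abbreviation "\<eta>1 \<equiv> \<lambda>x. (g1 x, e1 x, \<nu>1 x)"

lemma obs_measurable: "(\<lambda>s. (Y s, A s, X s)) \<in> measurable P (obs_space MX)"
  unfolding obs_space_def by (intro measurable_Pair pop.Y pop.A pop.X)

lemma integral_L: "h \<in> borel_measurable (obs_space MX) \<Longrightarrow> (\<integral>z. h z \<partial>L) = (\<integral>s. h (Y s, A s, X s) \<partial>P)"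
  for h :: "'x obs \<Rightarrow> real"
  by (rule integral_distr[OF obs_measurable])

lemma integrable_L: "h \<in> borel_measurable (obs_space MX) \<Longrightarrow> integrable L h \<longleftrightarrow> integrable P (\<lambda>s. h (Y s, A s, X s))"
  for h :: "'x obs \<Rightarrow> real"
  by (rule integrable_distr_eq[OF obs_measurable])

sublocale env: split_sample_envelope M MX L W \<kappa> K pop.D q
proof
  show "integrable L (\<lambda>z. pop.D z powr q)"
    using pop.D_powr_integrable pop.D_meas by (subst integrable_L) auto
qed (auto simp: pop.D_meas pop.D_ge_1 pop.q)

sublocale PX: prob_space PX by (rule pop.prob_space_distr[OF pop.X])

lemma eta1_meas: "\<eta>1 \<in> borel_measurable MX"
  using pop.g1_meas pop.e1_meas pop.nu1_meas by measurable

lemma AE_L: "Measurable.pred (obs_space MX) R \<Longrightarrow> (AE z in L. R z) \<longleftrightarrow> (AE s in P. R (Y s, A s, X s))"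
  using obs_measurable by (subst AE_distr_iff) auto

text \<open>\<open>psi\<close> is affine in the target with slope -1, so the estimator is the
  average of \<open>\<phi>\<close> at the estimated nuisance over the evaluation fold.\<close>

definition \<phi> :: "'x nuisance \<Rightarrow> 'x obs \<Rightarrow> real" where "\<phi> \<eta> z = psi \<Gamma> z 0 \<eta>"

lemma psi_phi: "psi \<Gamma> z \<mu> \<eta> = \<phi> \<eta> z - \<mu>"
  by (simp add: \<phi>_def psi_altdef)

lemma phi_meas: "\<eta> \<in> borel_measurable MX \<Longrightarrow> \<phi> \<eta> \<in> borel_measurable (obs_space MX)"
  unfolding \<phi>_def by (rule psi_measurable)

definition \<Delta> :: "'x nuisance \<Rightarrow> 'x \<Rightarrow> real" where "\<Delta> \<eta> x = norm (\<eta> x - \<eta>1 x)"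

text \<open>\<open>regular m\<close> collects the bounds that hold for a realised estimate once \<open>n\<close> is large; the level \<open>m\<close>
  is random, so it is kept as an integer to be quantified over countably many values.\<close>
definition regular :: "nat \<Rightarrow> 'x nuisance \<Rightarrow> 'x \<Rightarrow> bool" where
  "regular m \<eta> x \<longleftrightarrow> fst (snd (\<eta> x)) \<in> {\<epsilon>..1 - \<epsilon>} \<and> 1 / m \<le> snd (snd (\<eta> x)) \<and> \<Delta> \<eta> x \<le> m"

text \<open>The constant of \<open>psi_diff_bound\<close> with \<open>c = 1 / m\<close>.\<close>

definition Cm :: "nat \<Rightarrow> real" where
  "Cm m = 1 + \<Gamma> / (\<epsilon> * (1 / m)) + \<Gamma> * (1 / (\<epsilon> * (1 / m)) + 1 / \<epsilon>\<^sup>2)"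

lemma Cm_pos: "Cm m > 0"
  using pop.Gamma pop.eps by (auto simp: Cm_def intro!: add_pos_nonneg mult_nonneg_nonneg)

lemma phi_diff_bound:
  assumes m: "m \<ge> 1" and eta: "\<eta> \<in> borel_measurable MX" and reg: "AE x in PX. regular m \<eta> x"
  shows "AE z in L. \<bar>\<phi> \<eta> z - \<phi> \<eta>1 z\<bar> \<le> Cm m * pop.D z * \<Delta> \<eta> (snd (snd z))"
proof (subst AE_L)
  have D: "\<Delta> \<eta> \<in> borel_measurable MX" unfolding \<Delta>_def using eta eta1_meas by measurable
  have "(\<lambda>z. snd (snd z)) \<in> measurable (obs_space MX) MX" unfolding obs_space_def by measurable
  from measurable_compose[OF this D] show "Measurable.pred (obs_space MX) (\<lambda>z. \<bar>\<phi> \<eta> z - \<phi> \<eta>1 z\<bar> \<le> Cm m * pop.D z * \<Delta> \<eta> (snd (snd z)))"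
    using phi_meas[OF eta] phi_meas[OF eta1_meas] pop.D_meas by measurable
  show "AE s in P. \<bar>\<phi> \<eta> (Y s, A s, X s) - \<phi> \<eta>1 (Y s, A s, X s)\<bar> \<le> Cm m * pop.D (Y s, A s, X s) * \<Delta> \<eta> (snd (snd (Y s, A s, X s)))"
    using pop.AE_X[OF reg] pop.e1_bounds pop.nu1_bounds
  proof eventually_elim
    case (elim s)
    obtain g e \<nu> where h: "\<eta> (X s) = (g, e, \<nu>)" by (cases "\<eta> (X s)")
    have e1: "e \<le> 1" using elim h pop.eps by (auto simp: regular_def)
    show ?case
      unfolding \<phi>_def Cm_def pop.D_def \<Delta>_def prod.case snd_conv
      by (rule psi_diff_bound[where \<eta>=\<eta> and x="X s" and \<eta>'=\<eta>1, OF pop.Gamma pop.eps _ e1 _ _ _ _ _ h refl])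
        (use elim h m in \<open>auto simp: regular_def\<close>)
  qed
qed

text \<open>The envelope is unbounded, so a small second moment of \<open>d\<close> does not at once
  make the product small. Where \<open>D \<le> R\<close> the square is at most
  \<open>R\<^sup>2 * d\<^sup>2\<close> up to the constant; elsewhere \<open>d \<le> m\<close> and
  \<open>D\<^sup>2 \<le> R powr (2 - q) * D powr q\<close>. First \<open>R\<close> makes the tail
  small, then \<open>\<delta>\<close> the main part.\<close>

lemma small_gap:
  assumes v: "v > 0"
  obtains \<delta> where "\<delta> > 0" and "\<And>d. d \<in> borel_measurable MX \<Longrightarrow> (AE x in PX. 0 \<le> d x \<and> d x \<le> m) \<Longrightarrow> (\<integral>x. (d x)\<^sup>2 \<partial>PX) \<le> \<delta> \<Longrightarrow>
    integrable L (\<lambda>z. (c * pop.D z * d (snd (snd z)))\<^sup>2) \<and> (\<integral>z. (c * pop.D z * d (snd (snd z)))\<^sup>2 \<partial>L) \<le> v"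
proof -
  have "((\<lambda>R::real. c\<^sup>2 * m\<^sup>2 * env.mD * R powr (2 - q)) \<longlongrightarrow> c\<^sup>2 * m\<^sup>2 * env.mD * 0) at_top"
    using pop.q by (intro tendsto_mult_left tendsto_neg_powr filterlim_ident) auto
  then have "\<forall>\<^sub>F R in at_top. c\<^sup>2 * m\<^sup>2 * env.mD * R powr (2 - q) < v / 2"
    using v by (intro order_tendstoD) auto
  then have "\<forall>\<^sub>F R in at_top. c\<^sup>2 * m\<^sup>2 * env.mD * R powr (2 - q) < v / 2 \<and> R \<ge> 1"
    using eventually_ge_at_top[of 1] by eventually_elim auto
  then obtain R where R: "c\<^sup>2 * m\<^sup>2 * env.mD * R powr (2 - q) < v / 2" "R \<ge> 1"
    using eventually_happens'[OF trivial_limit_at_top_linorder] by blast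
  \<comment> \<open>The summand 1 permits division by \<open>S\<close> also when
    \<open>c = 0\<close>.\<close>
  define S where "S = c\<^sup>2 * R\<^sup>2 + 1"
  define \<delta> where "\<delta> = v / (2 * S)"
  have pos: "0 < S" by (simp add: S_def add_nonneg_pos)
  show ?thesis
  proof (rule that[of \<delta>])
    show d0: "\<delta> > 0" using v pos by (simp add: \<delta>_def)
    fix d assume d[measurable]: "d \<in> borel_measurable MX" and b: "AE x in PX. 0 \<le> d x \<and> d x \<le> m" and le: "(\<integral>x. (d x)\<^sup>2 \<partial>PX) \<le> \<delta>"
    have bP: "AE s in P. 0 \<le> d (X s) \<and> d (X s) \<le> m" by (rule pop.AE_X[OF b])
    let ?Z = "\<lambda>s. (Y s, A s, X s)"
    have xm: "(\<lambda>z. snd (snd z)) \<in> measurable (obs_space MX) MX" unfolding obs_space_def by measurable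
    have m1: "(\<lambda>z. (c * pop.D z * d (snd (snd z)))\<^sup>2) \<in> borel_measurable (obs_space MX)"
      using pop.D_meas measurable_compose[OF xm d] by measurable
    have d2: "integrable P (\<lambda>s. (d (X s))\<^sup>2)"
    proof (rule pop.integrable_const_bound[where B="m\<^sup>2"])
      show "AE s in P. norm ((d (X s))\<^sup>2) \<le> m\<^sup>2" using bP by eventually_elim (auto intro!: power_mono)
    qed (use pop.X in measurable)
    let ?u = "\<lambda>s. c\<^sup>2 * R\<^sup>2 * (d (X s))\<^sup>2 + c\<^sup>2 * m\<^sup>2 * R powr (2 - q) * pop.D (?Z s) powr q"
    have iu: "integrable P ?u" using d2 pop.D_powr_integrable by simp
    have bound: "AE s in P. (c * pop.D (?Z s) * d (X s))\<^sup>2 \<le> ?u s"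
      using bP
    proof eventually_elim
      case (elim s)
      let ?D = "pop.D (?Z s)"
      have D1: "?D \<ge> 1" by (rule pop.D_ge_1)
      have dm: "(d (X s))\<^sup>2 \<le> m\<^sup>2" using elim by (intro power_mono) auto
      have "?D\<^sup>2 * (d (X s))\<^sup>2 \<le> R\<^sup>2 * (d (X s))\<^sup>2 + m\<^sup>2 * R powr (2 - q) * ?D powr q"
      proof (cases "?D \<le> R")
        case True
        then have "?D\<^sup>2 * (d (X s))\<^sup>2 \<le> R\<^sup>2 * (d (X s))\<^sup>2" using D1 by (intro mult_right_mono power_mono) auto
        then show ?thesis by (simp add: add_increasing2)
      next
        case False
        have "?D\<^sup>2 = ?D powr (2 - q) * ?D powr q" using D1 by (simp add: powr_add[symmetric])
        also have "\<dots> \<le> R powr (2 - q) * ?D powr q"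
          using False R D1 pop.q by (intro mult_right_mono powr_mono2') auto
        finally have "?D\<^sup>2 * (d (X s))\<^sup>2 \<le> (R powr (2 - q) * ?D powr q) * m\<^sup>2" using dm by (intro mult_mono) auto
        then show ?thesis by (simp add: mult_ac add_increasing)
      qed
      then have "c\<^sup>2 * (?D\<^sup>2 * (d (X s))\<^sup>2) \<le> c\<^sup>2 * (R\<^sup>2 * (d (X s))\<^sup>2 + m\<^sup>2 * R powr (2 - q) * ?D powr q)"
        by (intro mult_left_mono) auto
      then show ?case by (simp add: power_mult_distrib algebra_simps)
    qed
    have xP: "(\<lambda>s. (c * pop.D (?Z s) * d (X s))\<^sup>2) \<in> borel_measurable P"
      using measurable_compose[OF obs_measurable m1] by simp
    have iP: "integrable P (\<lambda>s. (c * pop.D (?Z s) * d (X s))\<^sup>2)"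
    proof (rule Bochner_Integration.integrable_bound[OF iu xP])
      show "AE s in P. norm ((c * pop.D (?Z s) * d (X s))\<^sup>2) \<le> norm (?u s)"
        using bound
      proof eventually_elim
        case (elim s)
        then show ?case by (simp only: real_norm_def abs_power2)
      qed
    qed
    have "(\<integral>s. (c * pop.D (?Z s) * d (X s))\<^sup>2 \<partial>P) \<le> (\<integral>s. ?u s \<partial>P)"
      using iP iu bound by (rule integral_mono_AE)
    also have "\<dots> = c\<^sup>2 * R\<^sup>2 * (\<integral>s. (d (X s))\<^sup>2 \<partial>P) + c\<^sup>2 * m\<^sup>2 * R powr (2 - q) * (\<integral>s. pop.D (?Z s) powr q \<partial>P)"
      using d2 pop.D_powr_integrable by simp
    also have "(\<integral>s. (d (X s))\<^sup>2 \<partial>P) = (\<integral>x. (d x)\<^sup>2 \<partial>PX)"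
      by (rule integral_distr[OF pop.X, symmetric]) measurable
    also have "(\<integral>s. pop.D (?Z s) powr q \<partial>P) = env.mD"
      unfolding env.mD_def using pop.D_meas by (subst integral_L) auto
    also have "c\<^sup>2 * R\<^sup>2 * (\<integral>x. (d x)\<^sup>2 \<partial>PX) \<le> S * \<delta>"
      using le d0 pos by (intro mult_mono) (auto simp: S_def)
    also have "S * \<delta> = v / 2" using pos by (simp add: \<delta>_def)
    also have "c\<^sup>2 * m\<^sup>2 * R powr (2 - q) * env.mD \<le> v / 2" using R by (simp add: mult_ac)
    finally show "integrable L (\<lambda>z. (c * pop.D z * d (snd (snd z)))\<^sup>2) \<and> (\<integral>z. (c * pop.D z * d (snd (snd z)))\<^sup>2 \<partial>L) \<le> v"
      using iP m1 by (simp add: integral_L integrable_L)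
  qed
qed

end

section \<open>From assumptions on norms to regular training samples\<close>

lemma Lp_norm_2_le:
  fixes f :: "'a \<Rightarrow> 'b::{real_normed_vector, second_countable_topology}"
  assumes f: "f \<in> borel_measurable N" and le: "Lp_norm N 2 f \<le> ennreal r" and r: "0 \<le> r"
  shows "(\<integral>x. (norm (f x))\<^sup>2 \<partial>N) \<le> r\<^sup>2"
proof -
  define I where "I = (\<integral>\<^sup>+x. ennreal (norm (f x) powr 2) \<partial>N)"
  have fin: "I \<noteq> \<infinity>"
    using le unfolding Lp_norm_def Let_def I_def[symmetric] by (auto simp: top_unique split: if_splits)
  then have "ennreal (enn2real I powr (1 / 2)) \<le> ennreal r"
    using le unfolding Lp_norm_def Let_def I_def[symmetric] by simp
  then have s: "sqrt (enn2real I) \<le> r" using r by (simp add: powr_half_sqrt)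
  have "(\<integral>x. (norm (f x))\<^sup>2 \<partial>N) = enn2real (\<integral>\<^sup>+x. ennreal ((norm (f x))\<^sup>2) \<partial>N)"
    using f by (intro integral_eq_nn_integral) auto
  also have "\<dots> = enn2real I" by (simp add: I_def)
  also have "\<dots> = (sqrt (enn2real I))\<^sup>2" by simp
  also have "\<dots> \<le> r\<^sup>2" using s by (intro power_mono) auto
  finally show ?thesis .
qed

lemma Linf_norm_AE_le:
  assumes "Linf_norm N f \<le> ennreal C"
  shows "AE x in N. norm (f x) \<le> max 0 C"
proof -
  have "AE x in N. ennreal (norm (f x)) \<le> Linf_norm N f" unfolding Linf_norm_def by (rule esssup_AE)
  then show ?thesis
  proof eventually_elim
    case (elim x)
    then have "ennreal (norm (f x)) \<le> ennreal (max 0 C)"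
      using assms by (metis ennreal_max_0 max.commute order_trans)
    then show ?case by (subst (asm) ennreal_le_iff) auto
  qed
qed

context split_sample_estimation
begin

text \<open>The learner with its training set described by the complementary evaluation fold, to fit
  the indexing in \<open>admissible\<close>.\<close>

definition est :: "nat \<Rightarrow> nat set \<Rightarrow> (nat \<Rightarrow> 'x obs) \<Rightarrow> 'x nuisance" where
  "est n J = T n ({1..n} - J)"

abbreviation "etah \<equiv> eta_hat T \<kappa> W"

lemma etah_eq: "etah n s = est n (smp.F n s) (smp.training n s)"
  by (simp only: eta_hat_def est_def Let_def)

lemma est_joint_measurable:
  "J \<subseteq> {1..n} \<Longrightarrow> (\<lambda>(w, x). est n J w x) \<in> borel_measurable ((smp.training_space n J) \<Otimes>\<^sub>M MX)"
  using learner unfolding measurable_learner_def est_def by blast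

lemma est_measurable:
  assumes "J \<subseteq> {1..n}" "w \<in> space (smp.training_space n J)"
  shows "est n J w \<in> borel_measurable MX"
  using measurable_compose[OF measurable_Pair1'[OF assms(2)] est_joint_measurable[OF assms(1)]] by simp

text \<open>A condition on the fold and the training sample alone, so that cutting off by it leaves
  a function that is fixed once both are given.\<close>

definition good :: "nat \<Rightarrow> real \<Rightarrow> nat \<Rightarrow> nat set \<Rightarrow> (nat \<Rightarrow> 'x obs) \<Rightarrow> bool" where
  "good m \<delta> n J w \<longleftrightarrow> (AE x in PX. regular m (est n J w) x) \<and> (\<integral>x. (\<Delta> (est n J w) x)\<^sup>2 \<partial>PX) \<le> \<delta>"

text \<open>The almost everywhere condition says that a section of a measurable set has measure 0,
  and the measure of a section depends measurably on the training sample.\<close>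

lemma good_measurable:
  assumes J: "J \<subseteq> {1..n}"
  shows "Measurable.pred (smp.training_space n J) (good m \<delta> n J)"
proof -
  let ?T = "\<Pi>\<^sub>M i\<in>{1..n} - J. obs_space MX"
  have setsPX: "sets (?T \<Otimes>\<^sub>M PX) = sets (?T \<Otimes>\<^sub>M MX)" by (intro sets_pair_measure_cong) auto
  have e: "(\<lambda>p. est n J (fst p) (snd p)) \<in> borel_measurable (?T \<Otimes>\<^sub>M PX)"
    using est_joint_measurable[OF J] unfolding case_prod_beta measurable_cong_sets[OF setsPX refl] .
  note [measurable] = measurable_triple[OF e]
  have eta1: "\<eta>1 \<in> borel_measurable PX" using eta1_meas by simp
  have d[measurable]: "(\<lambda>p. \<Delta> (est n J (fst p)) (snd p)) \<in> borel_measurable (?T \<Otimes>\<^sub>M PX)"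
    unfolding \<Delta>_def
    using measurable_compose[OF borel_measurable_diff[OF e measurable_compose[OF measurable_snd eta1]] borel_measurable_norm] .
  define B where "B = {p \<in> space (?T \<Otimes>\<^sub>M PX). \<not> regular m (est n J (fst p)) (snd p)}"
  have B: "B \<in> sets (?T \<Otimes>\<^sub>M PX)" unfolding B_def regular_def by measurable
  have [measurable]: "(\<lambda>w. emeasure PX (Pair w -` B)) \<in> borel_measurable ?T"
    by (rule PX.measurable_emeasure_Pair[OF B])
  have [measurable]: "(\<lambda>w. \<integral>x. (\<Delta> (est n J w) x)\<^sup>2 \<partial>PX) \<in> borel_measurable ?T"
    by (rule PX.borel_measurable_lebesgue_integral) (use d in \<open>simp add: case_prod_beta\<close>)
  have "good m \<delta> n J w \<longleftrightarrow> emeasure PX (Pair w -` B) = 0 \<and> (\<integral>x. (\<Delta> (est n J w) x)\<^sup>2 \<partial>PX) \<le> \<delta>" if w: "w \<in> space ?T" for w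
  proof -
    have "Pair w -` B = {x \<in> space PX. \<not> regular m (est n J w) x}"
      using w by (auto simp: B_def space_pair_measure)
    moreover have "Pair w -` B \<in> sets PX" using B by (rule sets_Pair1)
    ultimately show ?thesis unfolding good_def using AE_iff_measurable[of "Pair w -` B" PX "regular m (est n J w)"] by auto
  qed
  note cong = this
  have r: "Measurable.pred ?T (\<lambda>w. emeasure PX (Pair w -` B) = 0 \<and> (\<integral>x. (\<Delta> (est n J w) x)\<^sup>2 \<partial>PX) \<le> \<delta>)"
    by measurable
  show ?thesis by (subst measurable_cong[OF cong]) (assumption, rule r)
qed

text \<open>Setting the difference to 0 on irregular training samples makes its bounds hold for every
  training sample, which is what conditioning requires.\<close>
definition H where
  "H m \<delta> n J w z = (if good m \<delta> n J w then \<phi> (est n J w) z - \<phi> \<eta>1 z else 0)"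

lemma H_joint_measurable:
  assumes J: "J \<subseteq> {1..n}"
  shows "(\<lambda>(w, z). H m \<delta> n J w z) \<in> borel_measurable ((smp.training_space n J) \<Otimes>\<^sub>M obs_space MX)"
proof -
  note [measurable] = good_measurable[OF J]
  have 1[measurable]: "(\<lambda>p. \<phi> (est n J (fst p)) (snd p)) \<in> borel_measurable ((smp.training_space n J) \<Otimes>\<^sub>M obs_space MX)"
    using psi_joint_measurable[OF est_joint_measurable[OF J], of \<Gamma> 0] unfolding \<phi>_def case_prod_beta .
  have [measurable]: "\<phi> \<eta>1 \<in> borel_measurable (obs_space MX)" by (rule phi_meas[OF eta1_meas])
  show ?thesis unfolding H_def case_prod_beta by measurable
qed

text \<open>\<open>small_gap\<close> turns a small \<open>L2\<close> error into a second moment at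
  most \<open>v\<close>, with one \<open>\<delta>\<close> for all \<open>n\<close>. The version with
  absolute values controls the mean distance between the estimated and the true function, which the
  lower bound on the standard deviation requires.\<close>

lemma H_admissible:
  assumes m: "m \<ge> 1" and v: "v > 0"
  obtains \<delta> where "\<delta> > 0" "\<And>n. smp.admissible pop.D (Cm m * m) v n (H m \<delta> n)"
    "\<And>n. smp.admissible pop.D (Cm m * m) v n (\<lambda>J w z. \<bar>H m \<delta> n J w z\<bar>)"
proof -
  obtain \<delta> where d0: "\<delta> > 0" and gap: "\<And>d. d \<in> borel_measurable MX \<Longrightarrow> (AE x in PX. 0 \<le> d x \<and> d x \<le> real m) \<Longrightarrow> (\<integral>x. (d x)\<^sup>2 \<partial>PX) \<le> \<delta> \<Longrightarrow>
    integrable L (\<lambda>z. (Cm m * pop.D z * d (snd (snd z)))\<^sup>2) \<and> (\<integral>z. (Cm m * pop.D z * d (snd (snd z)))\<^sup>2 \<partial>L) \<le> v"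
    using small_gap[OF v] by blast
  have bounds: "(AE z in L. \<bar>H m \<delta> n J w z\<bar> \<le> Cm m * real m * pop.D z) \<and> (\<integral>z. (H m \<delta> n J w z)\<^sup>2 \<partial>L) \<le> v"
    if J: "J \<subseteq> {1..n}" and w: "w \<in> space (smp.training_space n J)" for n J w
  proof (cases "good m \<delta> n J w")
    case False
    have "0 \<le> Cm m * real m * pop.D z" for z using Cm_pos[of m] pop.D_ge_1[of z] by (intro mult_nonneg_nonneg) auto
    then show ?thesis using False v by (simp add: H_def)
  next
    case True
    define \<eta> where "\<eta> = est n J w"
    have eta: "\<eta> \<in> borel_measurable MX" unfolding \<eta>_def by (rule est_measurable[OF J w])
    have D: "\<Delta> \<eta> \<in> borel_measurable MX" unfolding \<Delta>_def using eta eta1_meas by measurable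
    have reg: "AE x in PX. regular m \<eta> x" and le: "(\<integral>x. (\<Delta> \<eta> x)\<^sup>2 \<partial>PX) \<le> \<delta>"
      using True by (auto simp: good_def \<eta>_def)
    have reg': "AE x in PX. 0 \<le> \<Delta> \<eta> x \<and> \<Delta> \<eta> x \<le> real m"
      using reg by eventually_elim (auto simp: regular_def \<Delta>_def)
    have Heq: "H m \<delta> n J w z = \<phi> \<eta> z - \<phi> \<eta>1 z" for z using True by (simp add: H_def \<eta>_def)
    note b = phi_diff_bound[OF m eta reg]
    have xm: "(\<lambda>z. snd (snd z)) \<in> measurable (obs_space MX) MX" unfolding obs_space_def by measurable
    have "AE z in L. \<Delta> \<eta> (snd (snd z)) \<le> real m"
    proof (subst AE_L)
      show "Measurable.pred (obs_space MX) (\<lambda>z. \<Delta> \<eta> (snd (snd z)) \<le> real m)"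
        using measurable_compose[OF xm D] by measurable
      show "AE s in P. \<Delta> \<eta> (snd (snd (Y s, A s, X s))) \<le> real m"
        using pop.AE_X[OF reg'] by eventually_elim simp
    qed
    then have 1: "AE z in L. \<bar>H m \<delta> n J w z\<bar> \<le> Cm m * real m * pop.D z"
      using b
    proof eventually_elim
      case (elim z)
      have "0 \<le> Cm m * pop.D z" using Cm_pos[of m] pop.D_ge_1[of z] by (intro mult_nonneg_nonneg) auto
      then have "Cm m * pop.D z * \<Delta> \<eta> (snd (snd z)) \<le> Cm m * pop.D z * real m" using elim by (intro mult_left_mono) auto
      then show ?case using elim by (simp add: Heq mult_ac)
    qed
    have g: "integrable L (\<lambda>z. (Cm m * pop.D z * \<Delta> \<eta> (snd (snd z)))\<^sup>2)" "(\<integral>z. (Cm m * pop.D z * \<Delta> \<eta> (snd (snd z)))\<^sup>2 \<partial>L) \<le> v"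
      using gap[OF D reg' le] by auto
    have "(\<integral>z. (H m \<delta> n J w z)\<^sup>2 \<partial>L) \<le> (\<integral>z. (Cm m * pop.D z * \<Delta> \<eta> (snd (snd z)))\<^sup>2 \<partial>L)"
    proof (rule integral_mono_AE'[OF g(1)])
      show "AE z in L. (H m \<delta> n J w z)\<^sup>2 \<le> (Cm m * pop.D z * \<Delta> \<eta> (snd (snd z)))\<^sup>2"
        using b
      proof eventually_elim
        case (elim z)
        then have "\<bar>\<phi> \<eta> z - \<phi> \<eta>1 z\<bar>\<^sup>2 \<le> (Cm m * pop.D z * \<Delta> \<eta> (snd (snd z)))\<^sup>2" by (intro power_mono) auto
        then show ?case by (simp add: Heq)
      qed
    qed auto
    then show ?thesis using 1 g(2) by linarith
  qed
  have adm: "smp.admissible pop.D (Cm m * m) v n (H m \<delta> n)" for n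
    unfolding smp.admissible_def using H_joint_measurable bounds by blast
  have "smp.admissible pop.D (Cm m * m) v n (\<lambda>J w z. \<bar>H m \<delta> n J w z\<bar>)" for n
    unfolding smp.admissible_def
  proof (intro allI impI conjI ballI)
    fix J assume J: "J \<subseteq> {1..n}"
    show "(\<lambda>(w, z). \<bar>H m \<delta> n J w z\<bar>) \<in> borel_measurable ((smp.training_space n J) \<Otimes>\<^sub>M obs_space MX)"
      using borel_measurable_abs[OF H_joint_measurable[OF J]] by (simp add: case_prod_beta)
    fix w assume w: "w \<in> space (smp.training_space n J)"
    show "AE z in L. \<bar>\<bar>H m \<delta> n J w z\<bar>\<bar> \<le> Cm m * m * pop.D z" "(\<integral>z. \<bar>H m \<delta> n J w z\<bar>\<^sup>2 \<partial>L) \<le> v"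
      using bounds[OF J w] by simp_all
  qed
  with d0 adm show ?thesis by (rule that)
qed

lemma training_space: "s \<in> space M \<Longrightarrow> smp.training n s \<in> space (\<Pi>\<^sub>M i\<in>{1..n} - smp.F n s. obs_space MX)"
  using measurable_space[OF smp.W_measurable] by (auto simp: space_PiM)

lemma etah_measurable: "s \<in> space M \<Longrightarrow> etah n s \<in> borel_measurable MX"
  unfolding etah_eq by (rule est_measurable[OF smp.F_subset training_space])

text \<open>The square of the rate in assumption (d).\<close>

definition log_rate :: "nat \<Rightarrow> real" where "log_rate n = (ln (ln n) / n) powr (1 / 2)"

lemma eventually_good:
  assumes w: "s \<in> space M"
    and ov: "\<forall>\<^sub>F n in sequentially. AE x in PX. fst (snd (etah n s x)) \<in> {\<epsilon> .. 1 - \<epsilon>}"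
    and nu: "\<exists>c>0. \<forall>\<^sub>F n in sequentially. AE x in PX. snd (snd (etah n s x)) \<ge> c"
    and sup: "\<exists>C::real. \<forall>\<^sub>F n in sequentially. Linf_norm PX (\<lambda>x. etah n s x - \<eta>1 x) \<le> ennreal C"
    and rate: "\<forall>c>0. \<forall>\<^sub>F n in sequentially.
           Lp_norm PX 2 (\<lambda>x. etah n s x - \<eta>1 x) \<le> ennreal (c * (ln (ln (real n)) / real n) powr (1 / 4))"
  obtains m :: nat where "m \<ge> 1"
    and "\<forall>\<^sub>F n in sequentially. (AE x in PX. regular m (etah n s) x) \<and> (\<integral>x. (\<Delta> (etah n s) x)\<^sup>2 \<partial>PX) \<le> log_rate n"
    and "\<And>\<delta>. \<delta> > 0 \<Longrightarrow> \<forall>\<^sub>F n in sequentially. good m \<delta> n (smp.F n s) (smp.training n s)"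
proof -
  obtain c where c: "c > 0" and nu': "\<forall>\<^sub>F n in sequentially. AE x in PX. snd (snd (etah n s x)) \<ge> c" using nu by blast
  obtain C :: real where C: "\<forall>\<^sub>F n in sequentially. Linf_norm PX (\<lambda>x. etah n s x - \<eta>1 x) \<le> ennreal C" using sup by blast
  \<comment> \<open>One integer dominates the sup bound \<open>C\<close> and the reciprocal of the
    lower bound \<open>c\<close>, as \<open>regular\<close> demands.\<close>
  define m where "m = nat \<lceil>max 1 (max (1 / c) C)\<rceil>"
  have m: "real m \<ge> 1" "real m \<ge> 1 / c" "real m \<ge> C" unfolding m_def by linarith+
  have mc: "1 / real m \<le> c" using m(1,2) c by (simp add: divide_simps mult.commute)
  have rate1: "\<forall>\<^sub>F n in sequentially. Lp_norm PX 2 (\<lambda>x. etah n s x - \<eta>1 x) \<le> ennreal (1 * (ln (ln (real n)) / real n) powr (1 / 4))"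
    using rate[rule_format, OF zero_less_one] .
  have ev: "\<forall>\<^sub>F n in sequentially. (AE x in PX. regular m (etah n s) x) \<and> (\<integral>x. (\<Delta> (etah n s) x)\<^sup>2 \<partial>PX) \<le> log_rate n"
    using ov nu' C rate1
  proof eventually_elim
    case (elim n)
    have meas: "(\<lambda>x. etah n s x - \<eta>1 x) \<in> borel_measurable PX"
      using etah_measurable[OF w, of n] eta1_meas by simp
    have "(\<integral>x. (\<Delta> (etah n s) x)\<^sup>2 \<partial>PX) \<le> (1 * (ln (ln (real n)) / real n) powr (1 / 4))\<^sup>2"
      unfolding \<Delta>_def by (rule Lp_norm_2_le[OF meas elim(4)]) simp
    also have "\<dots> = log_rate n" by (simp add: log_rate_def power2_eq_square powr_add[symmetric])
    finally have 1: "(\<integral>x. (\<Delta> (etah n s) x)\<^sup>2 \<partial>PX) \<le> log_rate n" .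
    have "AE x in PX. regular m (etah n s) x"
      using elim(1,2) Linf_norm_AE_le[OF elim(3)]
    proof eventually_elim
      case (elim x)
      have "\<Delta> (etah n s) x \<le> max 0 C" using elim(3) by (simp add: \<Delta>_def)
      also have "\<dots> \<le> real m" using m by simp
      finally show ?case using elim mc by (auto simp: regular_def)
    qed
    with 1 show ?case by blast
  qed
  show ?thesis
  proof (rule that[OF _ ev])
    show "m \<ge> 1" using m by simp
    fix \<delta> :: real assume d: "\<delta> > 0"
    have "(log_rate \<longlongrightarrow> 0) sequentially" unfolding log_rate_def by real_asymp
    then have "\<forall>\<^sub>F n in sequentially. log_rate n < \<delta>" using d by (rule order_tendstoD)
    with ev show "\<forall>\<^sub>F n in sequentially. good m \<delta> n (smp.F n s) (smp.training n s)"
      by eventually_elim (auto simp: good_def etah_eq)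
  qed
qed

end

section \<open>Coverage\<close>

text \<open>The deterministic core. Triangle inequalities carry the mean absolute deviation
  \<open>M1\<close> of the true function over to the estimated one, and the Cauchy-Schwarz
  inequality turns it into a lower bound \<open>M1 / (3 * K)\<close> for the standard deviation. The
  value of \<open>\<delta>\<close> makes the error bound \<open>3 * \<delta> * s / N\<close> at most
  \<open>M1 / (3 * K) * (s / n)\<close> when \<open>N\<close> is at least
  \<open>n / (2 * K)\<close>.\<close>

lemma studentized_error_le:
  fixes \<phi> \<phi>' :: "'i \<Rightarrow> real" and mu \<mu> \<delta> s M1 If Ia sg hw N n K :: real
  assumes F: "finite F" "N = card F" and K: "1 \<le> K" and n: "0 < n" and N: "n / (2 * K) \<le> N" "N \<le> n"
    and mu: "(\<Sum>i\<in>F. \<phi>' i) = N * mu" and M1: "0 < M1" and d: "\<delta> = M1 / (18 * K\<^sup>2)" and s: "0 \<le> s"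
    and e1: "\<bar>\<Sum>i\<in>F. \<phi> i - \<mu>\<bar> \<le> \<delta> * s"
    and e2: "\<bar>\<Sum>i\<in>F. \<bar>\<phi> i - \<mu>\<bar> - M1\<bar> \<le> \<delta> * s"
    and e3: "\<bar>\<Sum>i\<in>F. (\<phi>' i - \<phi> i) - If\<bar> \<le> \<delta> * s"
    and e4: "\<bar>\<Sum>i\<in>F. \<bar>\<phi>' i - \<phi> i\<bar> - Ia\<bar> \<le> \<delta> * s"
    and e5: "n * \<bar>If\<bar> \<le> \<delta> * s" and e6: "Ia \<le> \<delta>"
    and e8: "5 * \<delta> * s \<le> n / (2 * K) * (M1 / 4)" and e9: "s / n \<le> hw"
    and sg: "sqrt (1 / n * (\<Sum>i\<in>F. (\<phi>' i - mu)\<^sup>2)) \<le> sg"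
  shows "\<bar>mu - \<mu>\<bar> \<le> sg * hw"
proof -
  have "0 < n / (2 * K)" using n K by simp
  then have N0: "0 < N" using N(1) by (rule less_le_trans)
  have d0: "0 < \<delta>" using M1 K by (simp add: d)
  have d4: "\<delta> \<le> M1 / 4"
  proof -
    have "4 \<le> 18 * K\<^sup>2" using one_le_power[OF K, of 2] by linarith
    then show ?thesis unfolding d using M1 by (intro divide_left_mono) auto
  qed
  have "N * (mu - \<mu>) = (\<Sum>i\<in>F. \<phi> i - \<mu>) + (\<Sum>i\<in>F. (\<phi>' i - \<phi> i) - If) + N * If"
    using mu by (simp add: sum_subtractf sum.distrib F(2) algebra_simps)
  then have "\<bar>N * (mu - \<mu>)\<bar> \<le> \<delta> * s + \<delta> * s + \<bar>N * If\<bar>" using e1 e3 by linarith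
  moreover have "\<bar>N * If\<bar> \<le> n * \<bar>If\<bar>" unfolding abs_mult using N N0 by (intro mult_right_mono) auto
  ultimately have dev: "N * \<bar>mu - \<mu>\<bar> \<le> 3 * \<delta> * s" using e5 N0 by (simp add: abs_mult)
  \<comment> \<open>Of \<open>N * M1\<close> one loses \<open>5 * \<delta> * s\<close> (1 and 1 from
    the two absolute deviations, 3 from the error of the estimator) and \<open>N * Ia\<close>; each
    is at most a quarter of \<open>N * M1\<close>.\<close>
  have "(\<Sum>i\<in>F. \<bar>\<phi> i - \<mu>\<bar>) \<le> (\<Sum>i\<in>F. \<bar>\<phi>' i - mu\<bar> + \<bar>\<phi>' i - \<phi> i\<bar> + \<bar>mu - \<mu>\<bar>)"
    by (intro sum_mono) linarith
  then have "(\<Sum>i\<in>F. \<bar>\<phi> i - \<mu>\<bar>) \<le> (\<Sum>i\<in>F. \<bar>\<phi>' i - mu\<bar>) + (\<Sum>i\<in>F. \<bar>\<phi>' i - \<phi> i\<bar>) + N * \<bar>mu - \<mu>\<bar>"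
    by (simp add: sum.distrib F(2))
  moreover have "N * M1 - \<delta> * s \<le> (\<Sum>i\<in>F. \<bar>\<phi> i - \<mu>\<bar>)" using e2 by (simp add: sum_subtractf F(2) abs_le_iff)
  moreover have "(\<Sum>i\<in>F. \<bar>\<phi>' i - \<phi> i\<bar>) \<le> N * Ia + \<delta> * s" using e4 by (simp add: sum_subtractf F(2) abs_le_iff)
  moreover have "N * Ia \<le> N * (M1 / 4)" using e6 d4 N0 by (intro mult_left_mono) auto
  moreover have "5 * \<delta> * s \<le> N * (M1 / 4)"
  proof -
    have "n / (2 * K) * (M1 / 4) \<le> N * (M1 / 4)" using N(1) M1 by (intro mult_right_mono) auto
    then show ?thesis using e8 by linarith
  qed
  ultimately have low: "N * (M1 / 2) \<le> (\<Sum>i\<in>F. \<bar>\<phi>' i - mu\<bar>)" using dev by (simp add: algebra_simps)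
  have "(N * (M1 / 2))\<^sup>2 \<le> (\<Sum>i\<in>F. \<bar>\<phi>' i - mu\<bar>)\<^sup>2" using low N0 M1 by (intro power_mono) auto
  also have "\<dots> \<le> N * (\<Sum>i\<in>F. (\<phi>' i - mu)\<^sup>2)"
    using Cauchy_Schwarz_ineq_sum[of "\<lambda>_. 1" "\<lambda>i. \<bar>\<phi>' i - mu\<bar>" F] by (simp add: F(2))
  finally have "N * (N * (M1 / 2)\<^sup>2) \<le> N * (\<Sum>i\<in>F. (\<phi>' i - mu)\<^sup>2)" by (simp add: power2_eq_square mult_ac)
  then have "N * (M1 / 2)\<^sup>2 \<le> (\<Sum>i\<in>F. (\<phi>' i - mu)\<^sup>2)" using N0 by simp
  moreover have "n / (2 * K) * (M1 / 2)\<^sup>2 \<le> N * (M1 / 2)\<^sup>2" using N(1) by (intro mult_right_mono) auto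
  ultimately have "1 / n * (n / (2 * K) * (M1 / 2)\<^sup>2) \<le> 1 / n * (\<Sum>i\<in>F. (\<phi>' i - mu)\<^sup>2)"
    using n by (intro mult_left_mono) auto
  moreover have "(M1 / (3 * K))\<^sup>2 \<le> 1 / n * (n / (2 * K) * (M1 / 2)\<^sup>2)"
  proof -
    have "8 * K \<le> 9 * K\<^sup>2" using K mult_right_mono[OF K, of K] by (simp add: power2_eq_square)
    then have "M1\<^sup>2 / (9 * K\<^sup>2) \<le> M1\<^sup>2 / (8 * K)" using K by (intro divide_left_mono) auto
    then show ?thesis using n by (simp add: power_divide power_mult_distrib)
  qed
  ultimately have "sqrt ((M1 / (3 * K))\<^sup>2) \<le> sg"
    by (intro order_trans[OF real_sqrt_le_mono sg]) linarith
  then have sg': "M1 / (3 * K) \<le> sg" using M1 K by simp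
  have "\<bar>mu - \<mu>\<bar> \<le> 3 * \<delta> * s / N" using dev N0 by (simp add: field_simps)
  also have "\<dots> \<le> 3 * \<delta> * s / (n / (2 * K))" using N N0 n K d0 s by (intro divide_left_mono) auto
  also have "\<dots> = M1 / (3 * K) * (s / n)" using K n by (simp add: d power2_eq_square field_simps)
  also have "\<dots> \<le> sg * hw" using sg' e9 M1 K s n by (intro mult_mono) (auto intro: order_trans[OF _ sg'])
  finally show ?thesis .
qed

text \<open>The first factor of the radicand is at least \<open>2 / n\<close>, and the logarithm
  eventually exceeds \<open>ln n / 2\<close> for every \<open>\<rho>\<close>; dividing by
  \<open>\<alpha> < 1\<close> only enlarges it.\<close>

lemma eventually_half_width_ge:
  assumes a: "0 < \<alpha>" "\<alpha> < 1" and r: "\<rho> > 0"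
  shows "\<forall>\<^sub>F n::nat in sequentially. sqrt (n * ln n) / n \<le> half_width \<alpha> \<rho> n"
proof -
  have "\<forall>\<^sub>F n::nat in sequentially. ln (real n) / 2 \<le> ln (real n * \<rho>\<^sup>2 + 1)" using r by real_asymp
  with eventually_ge_at_top[of 1] show ?thesis
  proof eventually_elim
    case (elim n)
    have n: "real n > 0" using elim by simp
    have x: "0 < real n * \<rho>\<^sup>2 + 1" by (intro add_nonneg_pos) auto
    have "ln (real n) / 2 \<le> ln ((real n * \<rho>\<^sup>2 + 1) / \<alpha>)"
      using elim x a by (simp add: ln_div) (smt (verit) ln_less_zero)
    then have "2 / n * (ln (real n) / 2) \<le> (2 * real n * \<rho>\<^sup>2 + 1) / ((real n)\<^sup>2 * \<rho>\<^sup>2) * ln ((real n * \<rho>\<^sup>2 + 1) / \<alpha>)"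
      using elim n r
      by (intro mult_mono) (auto simp: divide_simps power2_eq_square)
    then have "sqrt (ln n / n) \<le> half_width \<alpha> \<rho> n" unfolding half_width_def by simp
    moreover have "sqrt (n * ln n) / n = sqrt (ln n / n)"
      using n by (simp add: real_sqrt_mult real_sqrt_divide field_simps)
    ultimately show ?case by simp
  qed
qed

context split_sample_estimation
begin

lemma K_ge_1: "K \<ge> 1"
proof -
  obtain s where "s \<in> space M" using smp.not_empty by blast
  then have "\<kappa> 1 s \<in> {1..K}" using smp.partition by (auto simp: random_partition_def)
  then show ?thesis by auto
qed

lemma phi_true_bound: "AE z in L. \<bar>\<phi> \<eta>1 z\<bar> \<le> (1 + \<Gamma> / \<epsilon>) * pop.D z"
proof (subst AE_L)
  show "Measurable.pred (obs_space MX) (\<lambda>z. \<bar>\<phi> \<eta>1 z\<bar> \<le> (1 + \<Gamma> / \<epsilon>) * pop.D z)"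
    using phi_meas[OF eta1_meas] pop.D_meas by measurable
  show "AE s in P. \<bar>\<phi> \<eta>1 (Y s, A s, X s)\<bar> \<le> (1 + \<Gamma> / \<epsilon>) * pop.D (Y s, A s, X s)"
    using pop.e1_bounds pop.nu1_bounds
  proof eventually_elim
    case (elim s)
    let ?D = "pop.D (Y s, A s, X s)" and ?w = "weight (e1 (X s)) (\<nu>1 (X s))"
    have w: "0 \<le> ?w" "?w \<le> 1 / \<epsilon>"
      using elim weight_bounds[OF pop.eps, of "e1 (X s)" 1 "\<nu>1 (X s)"] by auto
    have G: "0 \<le> \<Gamma> / \<epsilon>" using pop.Gamma pop.eps by simp
    show ?case
    proof (cases "A s")
      case False
      then have "\<bar>\<phi> \<eta>1 (Y s, A s, X s)\<bar> = \<bar>g1 (X s)\<bar>"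
        by (simp add: \<phi>_def psi_eq[where \<eta>=\<eta>1 and x="X s", OF refl])
      also have "\<dots> \<le> ?D" using False by (simp add: pop.D_def)
      also have "?D = 1 * ?D" by simp
      also have "\<dots> \<le> (1 + \<Gamma> / \<epsilon>) * ?D" using G pop.D_ge_1[of "(Y s, A s, X s)"] by (intro mult_right_mono) auto
      finally show ?thesis .
    next
      case True
      have r: "\<bar>Y s - g1 (X s)\<bar> \<le> ?D" "\<bar>Y s\<bar> \<le> ?D" using True by (auto simp: pop.D_def)
      have "\<bar>\<phi> \<eta>1 (Y s, A s, X s)\<bar> = \<bar>Y s + score \<Gamma> (Y s - g1 (X s)) * ?w\<bar>"
        using True by (simp add: \<phi>_def psi_eq[where \<eta>=\<eta>1 and x="X s", OF refl])
      also have "\<dots> \<le> \<bar>Y s\<bar> + \<bar>score \<Gamma> (Y s - g1 (X s))\<bar> * \<bar>?w\<bar>"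
        by (rule order_trans[OF abs_triangle_ineq]) (simp add: abs_mult)
      also have "\<bar>score \<Gamma> (Y s - g1 (X s))\<bar> * \<bar>?w\<bar> \<le> (\<Gamma> * ?D) * (1 / \<epsilon>)"
      proof (rule mult_mono)
        show "\<bar>score \<Gamma> (Y s - g1 (X s))\<bar> \<le> \<Gamma> * ?D"
          using pop.Gamma r by (intro order_trans[OF abs_score_le[OF pop.Gamma]] mult_left_mono) auto
        show "\<bar>?w\<bar> \<le> 1 / \<epsilon>" using w by simp
        show "0 \<le> \<Gamma> * ?D" using pop.Gamma pop.D_ge_1[of "(Y s, A s, X s)"] by simp
      qed simp
      finally show ?thesis using r(2) by (simp add: distrib_right)
    qed
  qed
qed

lemma phi_true_dev_bound: "AE z in L. \<bar>\<bar>\<phi> \<eta>1 z - pop.\<mu>1\<bar>\<bar> \<le> (1 + \<Gamma> / \<epsilon> + \<bar>pop.\<mu>1\<bar>) * pop.D z"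
  using phi_true_bound
proof eventually_elim
  case (elim z)
  have "\<bar>pop.\<mu>1\<bar> * 1 \<le> \<bar>pop.\<mu>1\<bar> * pop.D z" using pop.D_ge_1[of z] by (intro mult_left_mono) auto
  then show ?case using elim by (simp add: distrib_right)
qed

lemma phi_true_mean: "integrable L (\<phi> \<eta>1)" "(\<integral>z. \<phi> \<eta>1 z \<partial>L) = pop.\<mu>1"
proof -
  show "integrable L (\<phi> \<eta>1)" by (rule env.integrable_dominated(1)[OF phi_meas[OF eta1_meas] phi_true_bound])
  show "(\<integral>z. \<phi> \<eta>1 z \<partial>L) = pop.\<mu>1"
    using pop.psi_true_mean phi_meas[OF eta1_meas] by (subst integral_L) (auto simp: \<phi>_def)
qed

text \<open>An absolute deviation takes the place of the variance because its integrand is still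
  dominated by a multiple of \<open>D\<close>.\<close>

definition M1 :: real where "M1 = (\<integral>z. \<bar>\<phi> \<eta>1 z - pop.\<mu>1\<bar> \<partial>L)"

lemma M1_pos: "M1 > 0"
proof -
  have m[measurable]: "\<phi> \<eta>1 \<in> borel_measurable (obs_space MX)" by (rule phi_meas[OF eta1_meas])
  have "integrable P (\<lambda>s. psi \<Gamma> (Y s, A s, X s) 0 \<eta>1)"
    using phi_true_mean(1) m by (subst (asm) integrable_L) (auto simp: \<phi>_def)
  then have "(\<integral>s. \<bar>psi \<Gamma> (Y s, A s, X s) 0 \<eta>1 - pop.\<mu>1\<bar> \<partial>P) \<noteq> 0" by (rule pop.psi_true_nondegenerate)
  moreover have "M1 = (\<integral>s. \<bar>psi \<Gamma> (Y s, A s, X s) 0 \<eta>1 - pop.\<mu>1\<bar> \<partial>P)"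
  proof -
    have "(\<lambda>z. \<bar>\<phi> \<eta>1 z - pop.\<mu>1\<bar>) \<in> borel_measurable (obs_space MX)" by measurable
    from integral_L[OF this] show ?thesis by (simp add: M1_def \<phi>_def)
  qed
  moreover have "0 \<le> M1" unfolding M1_def by simp
  ultimately show ?thesis by linarith
qed

lemma phi_bias:
  assumes m: "m \<ge> (1::nat)"
  obtains B where "0 \<le> B" "\<And>\<eta>. \<eta> \<in> borel_measurable MX \<Longrightarrow> (AE x in PX. regular m \<eta> x) \<Longrightarrow>
     integrable L (\<phi> \<eta>) \<and> \<bar>(\<integral>z. \<phi> \<eta> z \<partial>L) - pop.\<mu>1\<bar> \<le> B * (\<integral>x. (\<Delta> \<eta> x)\<^sup>2 \<partial>PX)"
proof -
  have c: "0 < 1 / real m" using m by simp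
  obtain B where B0: "0 \<le> B" and B: "pop.quadratic_bias (1 / real m) B" by (rule pop.psi_bias[OF c])
  show ?thesis
  proof (rule that[OF B0], rule conjI)
    fix \<eta> :: "'x nuisance" assume eta: "\<eta> \<in> borel_measurable MX" and reg: "AE x in PX. regular m \<eta> x"
    have r: "AE s in P. regular m \<eta> (X s)" by (rule pop.AE_X[OF reg])
    have r': "AE z in L. regular m \<eta> (snd (snd z))"
    proof (subst AE_L)
      have x: "(\<lambda>z. snd (snd z)) \<in> measurable (obs_space MX) MX" unfolding obs_space_def by measurable
      note [measurable] = measurable_triple[OF eta]
      have [measurable]: "\<Delta> \<eta> \<in> borel_measurable MX" unfolding \<Delta>_def using eta eta1_meas by measurable
      have "Measurable.pred MX (regular m \<eta>)" unfolding regular_def by measurable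
      from measurable_compose[OF x this] show "Measurable.pred (obs_space MX) (\<lambda>z. regular m \<eta> (snd (snd z)))" .
    qed (use r in simp)
    have "AE z in L. \<bar>\<phi> \<eta> z\<bar> \<le> (Cm m * real m + (1 + \<Gamma> / \<epsilon>)) * pop.D z"
      using phi_diff_bound[OF m eta reg] phi_true_bound r'
    proof eventually_elim
      case (elim z)
      have "0 \<le> Cm m * pop.D z" using Cm_pos[of m] pop.D_ge_1[of z] by (intro mult_nonneg_nonneg) auto
      then have "Cm m * pop.D z * \<Delta> \<eta> (snd (snd z)) \<le> Cm m * pop.D z * real m"
        using elim(3) by (intro mult_left_mono) (auto simp: regular_def)
      then have "\<bar>\<phi> \<eta> z\<bar> \<le> Cm m * pop.D z * real m + (1 + \<Gamma> / \<epsilon>) * pop.D z" using elim by linarith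
      then show ?case by (simp add: algebra_simps)
    qed
    then show "integrable L (\<phi> \<eta>)" by (rule env.integrable_dominated(1)[OF phi_meas[OF eta]])
    have "\<bar>(\<integral>s. psi \<Gamma> (Y s, A s, X s) 0 \<eta> \<partial>P) - pop.\<mu>1\<bar> \<le> B * (\<integral>s. (norm (\<eta> (X s) - \<eta>1 (X s)))\<^sup>2 \<partial>P)"
    proof (rule B[unfolded pop.quadratic_bias_def, rule_format, OF eta, of "real m"])
      show "AE s in P. \<epsilon> \<le> fst (snd (\<eta> (X s))) \<and> fst (snd (\<eta> (X s))) \<le> 1 - \<epsilon> \<and> 1 / real m \<le> snd (snd (\<eta> (X s)))"
        using r by eventually_elim (auto simp: regular_def)
      show "AE s in P. norm (\<eta> (X s) - \<eta>1 (X s)) \<le> real m"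
        using r by eventually_elim (auto simp: regular_def \<Delta>_def)
    qed
    moreover have "(\<integral>s. psi \<Gamma> (Y s, A s, X s) 0 \<eta> \<partial>P) = (\<integral>z. \<phi> \<eta> z \<partial>L)"
      using phi_meas[OF eta] by (subst integral_L) (auto simp: \<phi>_def)
    moreover have "(\<integral>s. (norm (\<eta> (X s) - \<eta>1 (X s)))\<^sup>2 \<partial>P) = (\<integral>x. (\<Delta> \<eta> x)\<^sup>2 \<partial>PX)"
      unfolding \<Delta>_def using eta eta1_meas by (intro integral_distr[OF pop.X, symmetric]) measurable
    ultimately show "\<bar>(\<integral>z. \<phi> \<eta> z \<partial>L) - pop.\<mu>1\<bar> \<le> B * (\<integral>x. (\<Delta> \<eta> x)\<^sup>2 \<partial>PX)" by simp
  qed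
qed

definition regular_sample :: "'w \<Rightarrow> bool" where
  "regular_sample s \<longleftrightarrow> (\<exists>m::nat. m \<ge> 1 \<and>
     (\<forall>\<^sub>F n in sequentially. (AE x in PX. regular m (etah n s) x) \<and> (\<integral>x. (\<Delta> (etah n s) x)\<^sup>2 \<partial>PX) \<le> log_rate n) \<and>
     (\<forall>\<delta>>0. \<forall>\<^sub>F n in sequentially. good m \<delta> n (smp.F n s) (smp.training n s)))"

lemma eventually_error_le_half_width:
  assumes alpha: "0 < \<alpha>" "\<alpha> < 1" and rho: "\<rho> > 0"
    and muh: "\<And>n s. s \<in> space M \<Longrightarrow>
           (\<Sum>i\<in>smp.F n s. psi \<Gamma> (W i s) (muh n s) (etah n s)) / real (card (smp.F n s)) = 0"
    and sigmah: "\<And>n s. sigmah n s =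
           sqrt (1 / real n * (\<Sum>k=1..K. \<Sum>i\<in>fold_idx \<kappa> k n s. (psi \<Gamma> (W i s) (muh n s) (etah n s))\<^sup>2))"
    and regular: "AE s in M. regular_sample s"
  shows "AE s in M. \<forall>\<^sub>F n in sequentially. smp.F n s \<noteq> {} \<and> \<bar>muh n s - pop.\<mu>1\<bar> \<le> sigmah n s * half_width \<alpha> \<rho> n"
proof -
  define \<delta> where "\<delta> = M1 / (18 * (real K)\<^sup>2)"
  have K: "1 \<le> real K" using K_ge_1 by simp
  have d: "\<delta> > 0" using M1_pos K by (simp add: \<delta>_def)
  have v: "0 < \<delta>\<^sup>2 / 32" using d by simp
  define admissible_gap where "admissible_gap m e \<longleftrightarrow> e > 0 \<and> (\<forall>n. smp.admissible pop.D (Cm m * m) (\<delta>\<^sup>2 / 32) n (H m e n)) \<and>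
      (\<forall>n. smp.admissible pop.D (Cm m * m) (\<delta>\<^sup>2 / 32) n (\<lambda>J w z. \<bar>H m e n J w z\<bar>))" for m :: nat and e :: real
  have ex: "\<exists>e. admissible_gap m e" if "m \<ge> 1" for m
  proof (rule H_admissible[OF that v])
    fix e assume "0 < e" "\<And>n. smp.admissible pop.D (Cm m * m) (\<delta>\<^sup>2 / 32) n (H m e n)"
      "\<And>n. smp.admissible pop.D (Cm m * m) (\<delta>\<^sup>2 / 32) n (\<lambda>J w z. \<bar>H m e n J w z\<bar>)"
    then have "admissible_gap m e" unfolding admissible_gap_def by (intro conjI allI)
    then show ?thesis by (rule exI)
  qed
  \<comment> \<open>The cut-off level has to be fixed for each \<open>m\<close> beforehand: the
    exceptional null sets may depend on it, while \<open>m\<close> is read off from the sample path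
    only later.\<close>
  define dm where "dm m = (SOME e. admissible_gap m e)" for m
  have gap: "admissible_gap m (dm m)" if "m \<ge> 1" for m
    unfolding dm_def by (rule someI_ex[OF ex[OF that]])
  note gap' = gap[unfolded admissible_gap_def]
  note dm = gap'[THEN conjunct1] gap'[THEN conjunct2, THEN conjunct1, THEN spec] gap'[THEN conjunct2, THEN conjunct2, THEN spec]
  have Cmm: "0 \<le> Cm m * real m" for m using Cm_pos[of m] by simp
  have phi1[measurable]: "\<phi> \<eta>1 \<in> borel_measurable (obs_space MX)" by (rule phi_meas[OF eta1_meas])
  have a1: "AE s in M. \<forall>\<^sub>F n in sequentially. \<bar>\<Sum>i\<in>smp.F n s. \<phi> \<eta>1 (W i s) - pop.\<mu>1\<bar> \<le> \<delta> * sqrt (n * ln n)"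
    using env.iid_deviation[OF phi1 phi_true_bound _ d] pop.Gamma pop.eps by (simp add: phi_true_mean)
  have a2: "AE s in M. \<forall>\<^sub>F n in sequentially. \<bar>\<Sum>i\<in>smp.F n s. \<bar>\<phi> \<eta>1 (W i s) - pop.\<mu>1\<bar> - M1\<bar> \<le> \<delta> * sqrt (n * ln n)"
    unfolding M1_def using env.iid_deviation[OF _ phi_true_dev_bound _ d] pop.Gamma pop.eps by simp
  \<comment> \<open>Countably many integers \<open>m\<close> cost only countably many null sets, so
    the random \<open>m\<close> of \<open>regular_sample\<close> may be inserted afterwards.\<close>
  have a3: "AE s in M. \<forall>m. m \<ge> 1 \<longrightarrow> (\<forall>\<^sub>F n in sequentially. \<bar>smp.dev (H m (dm m) n) n {1..n} s\<bar> \<le> \<delta> * sqrt (n * ln n)) \<and>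
      (\<forall>\<^sub>F n in sequentially. \<bar>smp.dev (\<lambda>J w z. \<bar>H m (dm m) n J w z\<bar>) n {1..n} s\<bar> \<le> \<delta> * sqrt (n * ln n))"
  proof (subst AE_all_countable, rule allI)
    fix m :: nat
    show "AE s in M. m \<ge> 1 \<longrightarrow> (\<forall>\<^sub>F n in sequentially. \<bar>smp.dev (H m (dm m) n) n {1..n} s\<bar> \<le> \<delta> * sqrt (n * ln n)) \<and>
      (\<forall>\<^sub>F n in sequentially. \<bar>smp.dev (\<lambda>J w z. \<bar>H m (dm m) n J w z\<bar>) n {1..n} s\<bar> \<le> \<delta> * sqrt (n * ln n))"
    proof (cases "m \<ge> 1")
      case True
      from env.array_deviation[OF Cmm d dm(2)[OF True]] env.array_deviation[OF Cmm d dm(3)[OF True]]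
      show ?thesis by eventually_elim blast
    qed simp
  qed
  have a4: "AE s in M. (\<lambda>n. real (card (smp.F n s)) / real n) \<longlonglongrightarrow> 1 / real K"
    using smp.partition K_ge_1 by (auto simp: random_partition_def)
  show ?thesis
    using a1 a2 a3 a4 regular AE_space
  proof eventually_elim
    case (elim s)
    have w: "s \<in> space M" by fact
    obtain m :: nat where m: "m \<ge> 1"
      and reg: "\<forall>\<^sub>F n in sequentially. (AE x in PX. regular m (etah n s) x) \<and> (\<integral>x. (\<Delta> (etah n s) x)\<^sup>2 \<partial>PX) \<le> log_rate n"
      and gd: "\<And>\<delta>. \<delta> > 0 \<Longrightarrow> \<forall>\<^sub>F n in sequentially. good m \<delta> n (smp.F n s) (smp.training n s)"
      using \<open>regular_sample s\<close> unfolding regular_sample_def by blast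
    obtain B where B0: "0 \<le> B" and B: "\<And>\<eta>. \<eta> \<in> borel_measurable MX \<Longrightarrow> (AE x in PX. regular m \<eta> x) \<Longrightarrow>
        integrable L (\<phi> \<eta>) \<and> \<bar>(\<integral>z. \<phi> \<eta> z \<partial>L) - pop.\<mu>1\<bar> \<le> B * (\<integral>x. (\<Delta> \<eta> x)\<^sup>2 \<partial>PX)"
      using phi_bias[OF m] by blast
    have card_ge: "\<forall>\<^sub>F n in sequentially. 1 / (2 * real K) < real (card (smp.F n s)) / real n"
      using elim(4) by (rule order_tendstoD) (use K in \<open>simp add: field_simps\<close>)
    \<comment> \<open>\<open>n * log_rate n\<close> is \<open>sqrt (n * ln (ln n))\<close>, which is
      of smaller order than \<open>sqrt (n * ln n)\<close>.\<close>
    have bias_small: "\<forall>\<^sub>F n::nat in sequentially. n * (B * log_rate n) \<le> \<delta> * sqrt (n * ln n)"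
    proof -
      have "((\<lambda>n::nat. n * log_rate n / sqrt (n * ln n)) \<longlongrightarrow> 0) sequentially"
        unfolding log_rate_def by real_asymp
      then have "((\<lambda>n::nat. B * (n * log_rate n / sqrt (n * ln n))) \<longlongrightarrow> B * 0) sequentially" by (rule tendsto_mult_left)
      then have "\<forall>\<^sub>F n::nat in sequentially. B * (n * log_rate n / sqrt (n * ln n)) < \<delta>"
        using d by (intro order_tendstoD) auto
      with eventually_ge_at_top[of 2] show ?thesis
      proof eventually_elim
        case (elim n)
        have "0 < sqrt (n * ln n)" using elim by simp
        then show ?case using elim by (simp add: field_simps)
      qed
    qed
    have scale_small: "\<forall>\<^sub>F n::nat in sequentially. 5 * \<delta> * sqrt (n * ln n) \<le> n / (2 * real K) * (M1 / 4)"
    proof -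
      have "((\<lambda>n::nat. sqrt (n * ln n) / n) \<longlongrightarrow> 0) sequentially" by real_asymp
      then have "((\<lambda>n::nat. 5 * \<delta> * (sqrt (n * ln n) / n)) \<longlongrightarrow> 5 * \<delta> * 0) sequentially" by (rule tendsto_mult_left)
      moreover have "0 < 1 / (2 * real K) * (M1 / 4)" using K M1_pos by simp
      ultimately have "\<forall>\<^sub>F n::nat in sequentially. 5 * \<delta> * (sqrt (n * ln n) / n) < 1 / (2 * real K) * (M1 / 4)"
        by (intro order_tendstoD) auto
      with eventually_ge_at_top[of 1] show ?thesis
      proof eventually_elim
        case (elim n)
        then have "n * (5 * \<delta> * (sqrt (n * ln n) / n)) \<le> n * (1 / (2 * real K) * (M1 / 4))" by (intro mult_left_mono) auto
        then show ?case using elim by simp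
      qed
    qed
    have dev1: "\<forall>\<^sub>F n in sequentially. \<bar>smp.dev (H m (dm m) n) n {1..n} s\<bar> \<le> \<delta> * sqrt (n * ln n)"
      and dev2: "\<forall>\<^sub>F n in sequentially. \<bar>smp.dev (\<lambda>J w z. \<bar>H m (dm m) n J w z\<bar>) n {1..n} s\<bar> \<le> \<delta> * sqrt (n * ln n)"
      using elim(3) m by auto
    from elim(1,2) dev1 dev2 reg gd[OF dm(1)[OF m]] card_ge bias_small scale_small
      eventually_half_width_ge[OF alpha rho] eventually_ge_at_top[of 1]
    show ?case
    proof eventually_elim
      case (elim n)
      define F where "F = smp.F n s"
      define \<eta> where "\<eta> = etah n s"
      have n: "0 < real n" using elim by simp
      have Fsub: "F \<subseteq> {1..n}" unfolding F_def by (rule smp.F_subset)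
      have finF: "finite F" using Fsub finite_subset by auto
      have cardF: "real n / (2 * real K) \<le> real (card F)" "real (card F) \<le> real n"
        using elim(7) n K card_mono[OF _ Fsub] by (simp_all add: F_def field_simps)
      have Fpos: "0 < real (card F)" using cardF(1) n K by (smt (verit) divide_pos_pos)
      have eta_meas: "\<eta> \<in> borel_measurable MX" unfolding \<eta>_def by (rule etah_measurable[OF w])
      have regn: "AE x in PX. regular m \<eta> x" and int: "(\<integral>x. (\<Delta> \<eta> x)\<^sup>2 \<partial>PX) \<le> log_rate n"
        using elim(5) by (auto simp: \<eta>_def)
      have H_eq: "H m (dm m) n (smp.F n s) (smp.training n s) z = \<phi> \<eta> z - \<phi> \<eta>1 z" for z
        using elim(6) by (simp add: H_def \<eta>_def etah_eq)
      then have H_fun: "H m (dm m) n (smp.F n s) (smp.training n s) = (\<lambda>z. \<phi> \<eta> z - \<phi> \<eta>1 z)" by (rule ext)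
      have Fint: "smp.F n s \<inter> {1..n} = F" using Fsub by (auto simp: F_def)
      define If where "If = (\<integral>z. \<phi> \<eta> z - \<phi> \<eta>1 z \<partial>L)"
      define Ia where "Ia = (\<integral>z. \<bar>\<phi> \<eta> z - \<phi> \<eta>1 z\<bar> \<partial>L)"
      note Bn = B[OF eta_meas regn]
      have If_eq: "If = (\<integral>z. \<phi> \<eta> z \<partial>L) - pop.\<mu>1"
        unfolding If_def using Bn phi_true_mean by simp
      have "n * \<bar>If\<bar> \<le> n * (B * log_rate n)"
        unfolding If_eq using Bn mult_left_mono[OF int B0] n by (intro mult_left_mono) auto
      then have e5: "n * \<bar>If\<bar> \<le> \<delta> * sqrt (n * ln n)" using elim(8) by linarith
      \<comment> \<open>The squared mean is at most the second moment, which admissibility bounds by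
        \<open>\<delta>\<^sup>2 / 32\<close>.\<close>
      have e6: "Ia \<le> \<delta>"
      proof -
        have adm: "smp.admissible pop.D (Cm m * m) (\<delta>\<^sup>2 / 32) n (H m (dm m) n)" by (rule dm(2)[OF m])
        have sp: "smp.training n s \<in> space (\<Pi>\<^sub>M i\<in>{1..n} - smp.F n s. obs_space MX)" by (rule training_space[OF w])
        have hb: "AE z in L. \<bar>\<phi> \<eta> z - \<phi> \<eta>1 z\<bar> \<le> Cm m * m * pop.D z" and hv: "(\<integral>z. (\<phi> \<eta> z - \<phi> \<eta>1 z)\<^sup>2 \<partial>L) \<le> \<delta>\<^sup>2 / 32"
          using adm smp.F_subset sp unfolding smp.admissible_def H_eq[symmetric] by blast+
        have hm: "(\<lambda>z. \<phi> \<eta> z - \<phi> \<eta>1 z) \<in> borel_measurable (obs_space MX)"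
          using phi_meas[OF eta_meas] phi1 by measurable
        note i = env.integrable_dominated[OF hm hb]
        have "Ia\<^sup>2 \<le> (\<integral>z. \<bar>\<phi> \<eta> z - \<phi> \<eta>1 z\<bar>\<^sup>2 \<partial>L)"
          using env.L.variance_eq[of "\<lambda>z. \<bar>\<phi> \<eta> z - \<phi> \<eta>1 z\<bar>"] env.L.variance_positive[of "\<lambda>z. \<bar>\<phi> \<eta> z - \<phi> \<eta>1 z\<bar>"] i
          by (simp add: Ia_def)
        also have "\<dots> \<le> \<delta>\<^sup>2 / 32" using hv by simp
        also have "\<dots> \<le> \<delta>\<^sup>2" by simp
        finally show ?thesis by (rule power2_le_imp_le) (use d in simp)
      qed
      have e3: "\<bar>\<Sum>i\<in>F. (\<phi> \<eta> (W i s) - \<phi> \<eta>1 (W i s)) - If\<bar> \<le> \<delta> * sqrt (n * ln n)"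
        using elim(3) unfolding smp.dev_def Fint H_fun If_def .
      have e4: "\<bar>\<Sum>i\<in>F. \<bar>\<phi> \<eta> (W i s) - \<phi> \<eta>1 (W i s)\<bar> - Ia\<bar> \<le> \<delta> * sqrt (n * ln n)"
        using elim(4) unfolding smp.dev_def Fint H_fun Ia_def .
      have mu: "(\<Sum>i\<in>F. \<phi> \<eta> (W i s)) = real (card F) * muh n s"
        using muh[OF w, of n, folded F_def \<eta>_def] Fpos by (simp add: psi_phi sum_subtractf)
      have sg: "sqrt (1 / n * (\<Sum>i\<in>F. (\<phi> \<eta> (W i s) - muh n s)\<^sup>2)) \<le> sigmah n s"
      \<comment> \<open>The estimated variance sums nonnegative terms over all folds, so the
        evaluation fold alone bounds it from below.\<close>
      proof -
        have "(\<Sum>i\<in>F. (\<phi> \<eta> (W i s) - muh n s)\<^sup>2) \<le> (\<Sum>k=1..K. \<Sum>i\<in>fold_idx \<kappa> k n s. (\<phi> \<eta> (W i s) - muh n s)\<^sup>2)"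
          unfolding F_def using K_ge_1
          by (intro member_le_sum[of 1 "{1..K}" "\<lambda>k. \<Sum>i\<in>fold_idx \<kappa> k n s. (\<phi> \<eta> (W i s) - muh n s)\<^sup>2"]) (auto intro: sum_nonneg)
        then show ?thesis
          unfolding sigmah psi_phi \<eta>_def by (intro real_sqrt_le_mono mult_left_mono) simp_all
      qed
      have "\<bar>muh n s - pop.\<mu>1\<bar> \<le> sigmah n s * half_width \<alpha> \<rho> n"
      proof (rule studentized_error_le[where F=F and \<phi>="\<lambda>i. \<phi> \<eta>1 (W i s)" and \<phi>'="\<lambda>i. \<phi> \<eta> (W i s)"
            and N="real (card F)" and n="real n" and K="real K" and \<delta>=\<delta> and s="sqrt (n * ln n)" and If=If and Ia=Ia and ?M1.0=M1])
        show "\<bar>\<Sum>i\<in>F. \<phi> \<eta>1 (W i s) - pop.\<mu>1\<bar> \<le> \<delta> * sqrt (n * ln n)" using elim(1) by (simp add: F_def)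
        show "\<bar>\<Sum>i\<in>F. \<bar>\<phi> \<eta>1 (W i s) - pop.\<mu>1\<bar> - M1\<bar> \<le> \<delta> * sqrt (n * ln n)" using elim(2) by (simp add: F_def)
        show "0 \<le> sqrt (n * ln n)" using elim by simp
      qed (use finF K n cardF mu M1_pos \<delta>_def e3 e4 e5 e6 elim(9,10) sg in auto)
      moreover have "smp.F n s \<noteq> {}" using Fpos by (auto simp: F_def)
      ultimately show ?case by simp
    qed
  qed
qed

text \<open>The random fold takes finitely many values, each on a measurable event, so measurable
  pieces can be glued.\<close>

lemma measurable_fold_dependent:
  fixes G :: "nat set \<Rightarrow> 'w \<Rightarrow> real"
  assumes G: "\<And>J. J \<subseteq> {1..n} \<Longrightarrow> G J \<in> borel_measurable M"
  shows "(\<lambda>s. G (smp.F n s) s) \<in> borel_measurable M"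
proof (rule measurable_compose_countable'[where I="Pow {1..n}"])
  show "smp.F n \<in> measurable M (count_space (Pow {1..n}))"
  proof (subst measurable_count_space_eq_countable)
    show "countable (Pow {1..n})" by (intro countable_finite) auto
    show "smp.F n \<in> space M \<rightarrow> Pow {1..n} \<and> (\<forall>J\<in>Pow {1..n}. smp.F n -` {J} \<inter> space M \<in> sets M)"
    proof (intro conjI ballI)
      fix J assume "J \<in> Pow {1..n}"
      have "smp.F n -` {J} \<inter> space M = {s \<in> space M. smp.F n s = J}" by auto
      then show "smp.F n -` {J} \<inter> space M \<in> sets M" using smp.fold_event' by simp
    qed (use smp.F_subset in auto)
  qed
qed (use G in \<open>auto intro!: countable_finite\<close>)

lemma phi_etah_measurable:
  assumes i: "i \<in> {1..n}"
  shows "(\<lambda>s. \<phi> (etah n s) (W i s)) \<in> borel_measurable M"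
proof -
  have "(\<lambda>s. \<phi> (est n J (restrict (\<lambda>i. W i s) ({1..n} - J))) (W i s)) \<in> borel_measurable M" if J: "J \<subseteq> {1..n}" for J
  proof -
    have r: "(\<lambda>s. restrict (\<lambda>i. W i s) ({1..n} - J)) \<in> measurable M (smp.training_space n J)"
      by (intro measurable_restrict smp.W_measurable) auto
    have Wi: "W i \<in> measurable M (obs_space MX)" using i by (intro smp.W_measurable) auto
    have "(\<lambda>(w, z). psi \<Gamma> z 0 (est n J w)) \<in> borel_measurable ((smp.training_space n J) \<Otimes>\<^sub>M obs_space MX)"
      by (rule psi_joint_measurable[OF est_joint_measurable[OF J]])
    from measurable_compose[OF measurable_Pair[OF r Wi] this] show ?thesis by (simp add: \<phi>_def)
  qed
  from measurable_fold_dependent[of n "\<lambda>J s. \<phi> (est n J (restrict (\<lambda>i. W i s) ({1..n} - J))) (W i s)", OF this]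
  show ?thesis by (simp add: etah_eq)
qed

text \<open>On a nonempty fold the estimating equation determines \<open>muh\<close> as an average
  of measurable terms. On an empty fold it reads \<open>0 = 0\<close> and leaves \<open>muh\<close>
  arbitrary, possibly not measurable; the constant \<open>b\<close> is put there instead.\<close>

lemma covering_measurable:
  fixes muh sigmah :: "nat \<Rightarrow> 'w \<Rightarrow> real" and b c :: real and f :: "real \<Rightarrow> real"
  assumes f: "f \<in> borel_measurable borel"
    and muh: "\<And>n s. s \<in> space M \<Longrightarrow>
           (\<Sum>i\<in>smp.F n s. psi \<Gamma> (W i s) (muh n s) (etah n s)) / real (card (smp.F n s)) = 0"
    and sigmah: "\<And>n s. sigmah n s =
           sqrt (1 / real n * (\<Sum>k=1..K. \<Sum>i\<in>fold_idx \<kappa> k n s. (psi \<Gamma> (W i s) (muh n s) (etah n s))\<^sup>2))"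
  shows "(\<lambda>s. if smp.F n s = {} then b else f (muh n s + c * sigmah n s)) \<in> borel_measurable M"
proof -
  define p where "p i s = (if i \<in> {1..n} then \<phi> (etah n s) (W i s) else 0)" for i s
  have p[measurable]: "p i \<in> borel_measurable M" for i unfolding p_def using phi_etah_measurable[of i n] by (cases "i \<in> {1..n}") auto
  define mm where "mm s = (\<Sum>i\<in>smp.F n s. p i s) / real (card (smp.F n s))" for s
  have mm[measurable]: "mm \<in> borel_measurable M"
    unfolding mm_def by (rule measurable_fold_dependent[of n "\<lambda>J s. (\<Sum>i\<in>J. p i s) / real (card J)"]) measurable
  \<comment> \<open>The sums run over the fixed range \<open>{1..n}\<close> with the label as a
    condition, which makes measurability visible term by term.\<close>
  define ss where "ss s = sqrt (1 / real n * (\<Sum>k=1..K. \<Sum>i=1..n. if \<kappa> i s = k then (p i s - mm s)\<^sup>2 else 0))" for s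
  have kap: "Measurable.pred M (\<lambda>s. \<kappa> i s = k)" if "i \<in> {1..n}" for i k
  proof -
    have "\<kappa> i \<in> measurable M (count_space UNIV)" using smp.partition that by (auto simp: random_partition_def)
    then show ?thesis by measurable
  qed
  have ss[measurable]: "ss \<in> borel_measurable M"
  proof -
    have "(\<lambda>s. if \<kappa> i s = k then (p i s - mm s)\<^sup>2 else 0) \<in> borel_measurable M" if "i \<in> {1..n}" for i k
      by (rule measurable_If[OF _ _ kap[OF that, unfolded pred_def]]) measurable
    then show ?thesis unfolding ss_def by measurable
  qed
  have eq: "muh n s = mm s \<and> sigmah n s = ss s" if w: "s \<in> space M" and ne: "smp.F n s \<noteq> {}" for s
  proof -
    have fin: "finite (smp.F n s)" using smp.F_subset finite_subset by blast
    then have card: "real (card (smp.F n s)) \<noteq> 0" using ne by simp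
    have pe: "\<phi> (etah n s) (W i s) = p i s" if "i \<in> fold_idx \<kappa> k n s" for i k
      using that by (simp add: p_def fold_idx_def)
    have "(\<Sum>i\<in>smp.F n s. p i s) = real (card (smp.F n s)) * muh n s"
      using muh[OF w, of n] card by (simp add: psi_phi sum_subtractf pe)
    then have 1: "muh n s = mm s" using card by (simp add: mm_def)
    have "(\<Sum>i\<in>fold_idx \<kappa> k n s. (psi \<Gamma> (W i s) (muh n s) (etah n s))\<^sup>2)
        = (\<Sum>i=1..n. if \<kappa> i s = k then (p i s - mm s)\<^sup>2 else 0)" for k
      unfolding fold_idx_def by (subst sum.inter_filter[symmetric]) (auto simp: psi_phi p_def 1)
    then show ?thesis using 1 by (simp add: sigmah ss_def)
  qed
  have F: "Measurable.pred M (\<lambda>s. smp.F n s = {})" using smp.fold_event'[of n "{}"] by (simp add: pred_def)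
  have "(\<lambda>s. if smp.F n s = {} then b else f (mm s + c * ss s)) \<in> borel_measurable M"
    by (rule measurable_If[OF _ measurable_compose[OF _ f] F[unfolded pred_def]]) measurable
  then show ?thesis by (rule measurable_cong[THEN iffD1, rotated]) (use eq in auto)
qed

end

theorem theorem4p1:
  fixes P :: "'p measure" and M :: "'w measure"
    and MX :: "'x measure" and MU :: "'u measure"
    and Y0 Y1 Y :: "'p \<Rightarrow> real" and A :: "'p \<Rightarrow> bool" and X :: "'p \<Rightarrow> 'x" and U :: "'p \<Rightarrow> 'u"
    and \<alpha> \<Gamma> \<mu>1 q Cq \<epsilon> \<rho> :: real
    and g1 e1 \<nu>1 :: "'x \<Rightarrow> real" and \<eta>1 :: "'x nuisance"
    and W :: "nat \<Rightarrow> 'w \<Rightarrow> 'x obs" and \<kappa> :: "nat \<Rightarrow> 'w \<Rightarrow> nat" and K :: nat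
    and T :: "'x learner" and etah :: "nat \<Rightarrow> 'w \<Rightarrow> 'x nuisance"
    and gh eh nuh :: "nat \<Rightarrow> 'w \<Rightarrow> 'x \<Rightarrow> real"
    and muh sigmah :: "nat \<Rightarrow> 'w \<Rightarrow> real" and PX :: "'x measure"
  assumes "prob_space P" and "prob_space M"
    and alpha: "0 < \<alpha>" "\<alpha> < 1"
    \<comment> \<open>population model\<close>
    and "Y0 \<in> borel_measurable P" "Y1 \<in> borel_measurable P"
    and "A \<in> measurable P (count_space UNIV)"
    and "X \<in> measurable P MX" "U \<in> measurable P MU"
    and Y_def: "Y = (\<lambda>\<omega>. of_bool (A \<omega>) * Y1 \<omega> + (1 - of_bool (A \<omega>)) * Y0 \<omega>)"
    and PX_def: "PX = distr P MX X"
    and unconfounded: "cond_indep_var P (sigma_gen P (MX \<Otimes>\<^sub>M MU) (\<lambda>\<omega>. (X \<omega>, U \<omega>)))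
           (borel \<Otimes>\<^sub>M borel) (\<lambda>\<omega>. (Y0 \<omega>, Y1 \<omega>)) (count_space UNIV) A"
    and Gamma: "1 \<le> \<Gamma>"
    and selection_bias: "selection_bias_model P MX MU A X U \<Gamma>"
    \<comment> \<open>true nuisance and target\<close>
    and g1: "is_g1 P MX Y A X \<Gamma> g1"
    and e1: "is_e1 P MX A X e1"
    and nu1: "is_nu1 P MX Y A X \<Gamma> g1 \<nu>1"
    and eta1_def: "\<eta>1 = (\<lambda>x. (g1 x, e1 x, \<nu>1 x))"
    and mu1_def: "\<mu>1 = (\<integral>\<omega>. of_bool (A \<omega>) * Y \<omega> + (1 - of_bool (A \<omega>)) * g1 (X \<omega>) \<partial>P)"
    \<comment> \<open>sample, folds and estimators\<close>
    and iid_indep: "prob_space.indep_vars M (\<lambda>_. obs_space MX) W {1..}"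
    and iid_copies: "\<And>i. i \<ge> 1 \<Longrightarrow>
           distr M (obs_space MX) (W i) = distr P (obs_space MX) (\<lambda>\<omega>. (Y \<omega>, A \<omega>, X \<omega>))"
    and folds: "random_partition M K MX W \<kappa>"
    and learner: "measurable_learner MX T"
    and etah_def: "etah = eta_hat T \<kappa> W"
    and etah_components: "\<And>n \<omega> x. etah n \<omega> x = (gh n \<omega> x, eh n \<omega> x, nuh n \<omega> x)"
    and muh: "\<And>n \<omega>. \<omega> \<in> space M \<Longrightarrow>
           (\<Sum>i\<in>fold_idx \<kappa> 1 n \<omega>. psi \<Gamma> (W i \<omega>) (muh n \<omega>) (etah n \<omega>)) / real (card (fold_idx \<kappa> 1 n \<omega>)) = 0"
    and sigmah_def: "\<And>n \<omega>. sigmah n \<omega> =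
           sqrt (1 / real n * (\<Sum>k=1..K. \<Sum>i\<in>fold_idx \<kappa> k n \<omega>. (psi \<Gamma> (W i \<omega>) (muh n \<omega>) (etah n \<omega>))\<^sup>2))"
    \<comment> \<open>(a) regularity\<close>
    and moment: "q > 2" "(\<integral>\<^sup>+\<omega>. ennreal (\<bar>Y1 \<omega>\<bar> powr q) \<partial>P) \<le> ennreal Cq"
    and cond_density: "\<exists>f C. (\<forall>z. f z \<le> ennreal C) \<and>
           distributed (given_treated P A) (distr (given_treated P A) MX X \<Otimes>\<^sub>M lborel)
             (\<lambda>\<omega>. (X \<omega>, Y1 \<omega>)) f"
    \<comment> \<open>(b) boundedness\<close>
    and eps: "\<epsilon> > 0"
    and overlap: "AE x in PX. e1 x \<in> {\<epsilon> .. 1 - \<epsilon>}"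
    and overlap_hat: "AE \<omega> in M. \<forall>\<^sub>F n in sequentially. AE x in PX. eh n \<omega> x \<in> {\<epsilon> .. 1 - \<epsilon>}"
    \<comment> \<open>implicit regularity: the estimate of nu1 (which is at least 1) stays away from 0\<close>
    and nuh_bounded_below: "AE \<omega> in M. \<exists>c>0. \<forall>\<^sub>F n in sequentially. AE x in PX. nuh n \<omega> x \<ge> c"
    \<comment> \<open>(c) strong consistency\<close>
    and consistency_g: "AE \<omega> in M. (\<lambda>n. Lp_norm PX 1 (\<lambda>x. gh n \<omega> x - g1 x)) \<longlonglongrightarrow> 0"
    and consistency_eta: "AE \<omega> in M. AE x in PX. (\<lambda>n. etah n \<omega> x) \<longlonglongrightarrow> \<eta>1 x"
    and sup_bounded: "AE \<omega> in M. \<exists>C::real. \<forall>\<^sub>F n in sequentially.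
           Linf_norm PX (\<lambda>x. etah n \<omega> x - \<eta>1 x) \<le> ennreal C"
    \<comment> \<open>(d) rate\<close>
    and rate: "AE \<omega> in M. \<forall>c>0. \<forall>\<^sub>F n in sequentially.
           Lp_norm PX 2 (\<lambda>x. etah n \<omega> x - \<eta>1 x) \<le> ennreal (c * (ln (ln (real n)) / real n) powr (1 / 4))"
    and rho: "\<rho> > 0"
  shows "asymptotic_confidence_sequence M \<alpha> \<mu>1
           (\<lambda>n \<omega>. muh n \<omega> - sigmah n \<omega> * half_width \<alpha> \<rho> n)
           (\<lambda>n \<omega>. muh n \<omega> + sigmah n \<omega> * half_width \<alpha> \<rho> n)"
proof -
  interpret E: split_sample_estimation P MX Y1 Y A X \<Gamma> q Cq \<epsilon> g1 e1 \<nu>1 M W \<kappa> K T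
  proof (intro split_sample_estimation.intro selection_population.intro split_sample.intro
      selection_population_axioms.intro split_sample_axioms.intro split_sample_estimation_axioms.intro)
    show "Y \<in> borel_measurable P"
      unfolding Y_def using \<open>Y0 \<in> borel_measurable P\<close> \<open>Y1 \<in> borel_measurable P\<close> \<open>A \<in> measurable P (count_space UNIV)\<close>
      by measurable
    show "A \<omega> \<Longrightarrow> Y \<omega> = Y1 \<omega>" for \<omega> by (simp add: Y_def)
    show "AE x in distr P MX X. e1 x \<in> {\<epsilon>..1 - \<epsilon>}" using overlap by (simp only: PX_def)
  qed fact+
  have mu1: "E.pop.\<mu>1 = \<mu>1" by (simp add: E.pop.\<mu>1_def mu1_def)
  have comp: "eta_hat T \<kappa> W n \<omega> x = (gh n \<omega> x, eh n \<omega> x, nuh n \<omega> x)" for n \<omega> x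
    using etah_components[of n \<omega> x] by (simp only: etah_def)
  have reg: "AE \<omega> in M. E.regular_sample \<omega>"
    using overlap_hat nuh_bounded_below sup_bounded rate AE_space
  proof eventually_elim
    case (elim \<omega>)
    have ov: "\<forall>\<^sub>F n in sequentially. AE x in distr P MX X. fst (snd (eta_hat T \<kappa> W n \<omega> x)) \<in> {\<epsilon> .. 1 - \<epsilon>}"
      using elim(1) by (simp only: comp fst_conv snd_conv PX_def)
    have nu: "\<exists>c>0. \<forall>\<^sub>F n in sequentially. AE x in distr P MX X. snd (snd (eta_hat T \<kappa> W n \<omega> x)) \<ge> c"
      using elim(2) by (simp only: comp fst_conv snd_conv PX_def)
    show ?case
      by (rule E.eventually_good[OF elim(5) ov nu elim(3,4)[unfolded etah_def eta1_def PX_def]])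
        (unfold E.regular_sample_def, blast)
  qed
  note muh' = muh[unfolded etah_def] and sigmah' = sigmah_def[unfolded etah_def]
  have error: "AE \<omega> in M. \<forall>\<^sub>F n in sequentially. fold_idx \<kappa> 1 n \<omega> \<noteq> {} \<and> \<bar>muh n \<omega> - \<mu>1\<bar> \<le> sigmah n \<omega> * half_width \<alpha> \<rho> n"
    unfolding mu1[symmetric]
    by (rule E.eventually_error_le_half_width[OF alpha rho _ _ reg], rule muh', assumption, rule sigmah')
  \<comment> \<open>On an empty fold the interval is the single point \<open>\<mu>1\<close>. The
    half-width enters the lower end as a negative coefficient, so that both ends are instances of
    \<open>covering_measurable\<close>.\<close>
  define Ls where "Ls n \<omega> = (if fold_idx \<kappa> 1 n \<omega> = {} then \<mu>1 else min (muh n \<omega> + (- half_width \<alpha> \<rho> n) * sigmah n \<omega>) \<mu>1)" for n \<omega>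
  define Us where "Us n \<omega> = (if fold_idx \<kappa> 1 n \<omega> = {} then \<mu>1 else max (muh n \<omega> + half_width \<alpha> \<rho> n * sigmah n \<omega>) \<mu>1)" for n \<omega>
  show ?thesis
    unfolding asymptotic_confidence_sequence_def
  proof (rule exI[of _ Ls], rule exI[of _ Us], intro conjI allI impI)
    fix n :: nat
    show "Ls n \<in> borel_measurable M"
      unfolding Ls_def
      by (rule E.covering_measurable[where f="\<lambda>x. min x \<mu>1"], measurable, rule muh', assumption, rule sigmah')
    show "Us n \<in> borel_measurable M"
      unfolding Us_def
      by (rule E.covering_measurable[where f="\<lambda>x. max x \<mu>1"], measurable, rule muh', assumption, rule sigmah')
  next
    have "{\<omega> \<in> space M. \<forall>n\<ge>1. \<mu>1 \<in> {Ls n \<omega>..Us n \<omega>}} = space M"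
      by (auto simp: Ls_def Us_def)
    then show "measure M {\<omega> \<in> space M. \<forall>n\<ge>1. \<mu>1 \<in> {Ls n \<omega>..Us n \<omega>}} \<ge> 1 - \<alpha>"
      using alpha E.smp.prob_space by simp
  next
    show "AE \<omega> in M. (\<lambda>n. Ls n \<omega>) \<sim>[sequentially] (\<lambda>n. muh n \<omega> - sigmah n \<omega> * half_width \<alpha> \<rho> n)"
      using error
    proof eventually_elim
      case (elim \<omega>)
      \<comment> \<open>The endpoints are eventually equal, so the ratio is eventually 1, also at
        times where both vanish, by the convention for \<open>0 / 0\<close>.\<close>
      then have "\<forall>\<^sub>F n in sequentially. Ls n \<omega> = muh n \<omega> - sigmah n \<omega> * half_width \<alpha> \<rho> n"
        by eventually_elim (auto simp: Ls_def min_def mult.commute)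
      then show ?case by (rule asymp_equiv_refl_ev)
    qed
    show "AE \<omega> in M. (\<lambda>n. Us n \<omega>) \<sim>[sequentially] (\<lambda>n. muh n \<omega> + sigmah n \<omega> * half_width \<alpha> \<rho> n)"
      using error
    proof eventually_elim
      case (elim \<omega>)
      then have "\<forall>\<^sub>F n in sequentially. Us n \<omega> = muh n \<omega> + sigmah n \<omega> * half_width \<alpha> \<rho> n"
        by eventually_elim (auto simp: Us_def max_def mult.commute)
      then show ?case by (rule asymp_equiv_refl_ev)
    qed
  qed
qed

end
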